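(* Let $n\ge 1$ and $\square=(0,1)^n$. Suppose that the univariate primal and dual scaling functions and wavelets satisfy, for some $\alpha>1$, the decay estimate $$|\phi_\lambda(x)|,\ |\psi_\lambda(x)|,\ |\tilde\phi_\lambda(x)|,\ |\tilde\psi_\lambda(x)|\ \lesssim\ 2^{j/2}\,\bigl(1+|2^jx-k|\bigr)^{-\alpha},\qquad \lambda=(j,k),\ x\in[0,1],$$ with a constant independent of $\lambda$ and $x$. Let $q\in\mathbb{R}$ and $s>0$ satisfy $s<\alpha-\frac12$ and $$q+s>\max\{0,\,n(s-\tfrac12)\}\quad\text{and}\quad q+sn>\max\{0,\,n(s-\tfrac12)\}.$$ Let $\tau$ be given by $\frac1\tau=s+\frac12$. Then the embeddings $$B^{q+sn,\tau}_{\tau}(\square)\hookrightarrow \mathfrak{B}^{q,s,\tau}_{\tau}(\square)\hookrightarrow B^{q+s,\tau}_{\tau}(\square)$$ are continuous. Here $B^{\alpha',\tau}_{\tau}(\square)$ is the isotropic Besov space and $\mathfrak{B}^{q,s,\tau}_\tau(\square)$ is the Besov space of hybrid regularity, both defined in the context through wavelet coefficients.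
   Context: Univariate wavelets. Let $(V_j)_{j\ge j_0}$ be a nested sequence of finite-dimensional function spaces on $[0,1]$ (a multiresolution analysis) with asymptotically dense union, where $V_j$ has a uniformly $L^2$-stable Riesz basis of scaling functions $\Phi_j=\{\phi_\lambda:\lambda\in\Delta_j\}$. Indices are $\lambda=(j,k)$ with level $|\lambda|=j$ and location $k\in\mathbb{Z}$; the functions are (up to boundary modifications) dyadic dilates and shifts, $\phi_\lambda(x)=2^{j/2}\phi(2^jx-k)$, and $|\Delta_j|\sim 2^j$. For $j>j_0$, $V_j=V_{j-1}\oplus W_j$, where $W_j$ has basis $\Psi_j=\{\psi_\lambda:\lambda\in\nabla_j\}$ (wavelets). By convention $W_{j_0}=V_{j_0}$, $\nabla_{j_0}=\Delta_{j_0}$, and $\psi_\lambda=\phi_\lambda$ for $\lambda\in\nabla_{j_0}$. Put $\nabla=\bigcup_{j\ge j_0}\nabla_j$. There is a biorthogonal (dual) multiresolution analysis $(\tilde V_j)_{j\ge j_0}$ with scaling functions $\tilde\phi_\lambda$ and wavelets $\tilde\psi_\lambda$, indexed by the same sets, with $\langle\tilde\phi_{\lambda'},\phi_\lambda\rangle=\delta_{\lambda,\lambda'}$ for $\lambda,\lambda'\in\Delta_j$ and $\langle\tilde\psi_{\lambda'},\psi_\lambda\rangle=\delta_{\lambda,\lambda'}$ for $\lambda,\lambda'\in\nabla$. The systems $\{\psi_\lambda\}_{\lambda\in\nabla}$ and $\{\tilde\psi_\lambda\}_{\lambda\in\nabla}$ are Riesz bases of $L^2([0,1])$. Tensor-product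 wavelets. For $\boldsymbol{j}=(j_1,\dots,j_n)$ with all $j_i\ge j_0$ (written $\boldsymbol j\ge\boldsymbol j_0$), let $\boldsymbol\nabla_{\boldsymbol j}=\nabla_{j_1}\times\dots\times\nabla_{j_n}$, and for $\boldsymbol\lambda=(\lambda_1,\dots,\lambda_n)\in\boldsymbol\nabla_{\boldsymbol j}$ let $\psi_{\boldsymbol\lambda}=\psi_{\lambda_1}\otimes\dots\otimes\psi_{\lambda_n}$, similarly $\tilde\psi_{\boldsymbol\lambda}$. Put $\boldsymbol\nabla=\bigcup_{\boldsymbol j\ge\boldsymbol j_0}\boldsymbol\nabla_{\boldsymbol j}$, $|\boldsymbol j|_\infty=\max_i j_i$, $|\boldsymbol j|_1=\sum_i j_i$, $|\boldsymbol\lambda|_1=|\boldsymbol j|_1$ for $\boldsymbol\lambda\in\boldsymbol\nabla_{\boldsymbol j}$. Isotropic wavelets. For $m>j_0$ and $\mathbf e\in\{0,1\}^n\setminus\{\mathbf 0\}$ let $\Theta_m^{\mathbf e}=\Theta_m^{e_1}\otimes\dots\otimes\Theta_m^{e_n}$ with $\Theta_m^{0}=\Phi_{m-1}$, $\Theta_m^{1}=\Psi_m$; let $\Theta_m=\bigcup_{\mathbf e\ne\mathbf 0}\Theta_m^{\mathbf e}$, and $\Theta_{j_0}=\Phi_{j_0}\otimes\dots\otimes\Phi_{j_0}$. Let $J_m$ be the index set of $\Theta_m=\{\theta_\mu:\mu\in J_m\}$, $|\mu|=m$ for $\mu\in J_m$, $J=\bigcup_{m\ge j_0}J_m$; dual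 functions $\tilde\theta_\mu$ are built in the same way from the dual univariate functions. Coefficients. For $0<p<\infty$ and a function $u=\sum_{\boldsymbol\lambda\in\boldsymbol\nabla}u_{\boldsymbol\lambda}\psi_{\boldsymbol\lambda}=\sum_{\mu\in J}v_\mu\theta_\mu$ with $u_{\boldsymbol\lambda}=\langle\tilde\psi_{\boldsymbol\lambda},u\rangle$, $v_\mu=\langle\tilde\theta_\mu,u\rangle$, define the rescaled coefficients (corresponding to $L^p$-normalised wavelets) $$u^{(p)}_{\boldsymbol\lambda}=2^{|\boldsymbol\lambda|_1(\frac12-\frac1p)}u_{\boldsymbol\lambda},\qquad v^{(p)}_\mu=2^{n|\mu|(\frac12-\frac1p)}v_\mu .$$ Besov spaces. For $\alpha'>0$ and $0<p,\tau<\infty$, $B^{\alpha',p}_\tau(\square)$ is the space of functions $u$ with finite (quasi-)norm $$\|u\|_{B^{\alpha',p}_\tau(\square)}=\Bigl[\sum_{m\ge j_0}2^{\tau m\alpha'}\Bigl[\sum_{\mu\in J_m}|v_\mu^{(p)}|^p\Bigr]^{\tau/p}\Bigr]^{1/\tau}.$$ For real $q$, $s>0$ and $0<p,\tau<\infty$, $\mathfrak B^{q,s,p}_\tau(\square)$ is the space of functions $u$ with finite (quasi-)norm $$\|u\|_{\mathfrak B^{q,s,p}_\tau(\square)}=\Bigl[\sum_{\boldsymbol j\ge\boldsymbol j_0}2^{\tau(q|\boldsymbol j|_\infty+s|\boldsymbol j|_1)}\Bigl[\sum_{\boldsymbol\lambda\in\boldsymbol\nabla_{\boldsymbol j}}|u^{(p)}_{\boldsymbol\lambda}|^p\Bigr]^{\tau/p}\Bigr]^{1/\tau}.$$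 *)

theory Defs
  imports "HOL-Analysis.Analysis"
begin

section \<open>Real Lebesgue spaces on the unit interval\<close>

text \<open>Functions are represented by Borel measurable representatives; identities between
  elements of \<open>L\<^sup>2([0,1])\<close> are identities almost everywhere on \<open>[0,1]\<close>.\<close>

definition L2_unit :: "(real \<Rightarrow> real) set" where
  "L2_unit = {f. set_borel_measurable lborel {0..1} f \<and>
                 set_integrable lborel {0..1} (\<lambda>x. (f x)\<^sup>2)}"

definition L2_inner :: "(real \<Rightarrow> real) \<Rightarrow> (real \<Rightarrow> real) \<Rightarrow> real" where
  "L2_inner f g = (LINT x:{0..1}|lborel. f x * g x)"

definition L2_nrm :: "(real \<Rightarrow> real) \<Rightarrow> real" where
  "L2_nrm f = sqrt (L2_inner f f)"

definition L2_eq :: "(real \<Rightarrow> real) \<Rightarrow> (real \<Rightarrow> real) \<Rightarrow> bool" where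
  "L2_eq f g \<longleftrightarrow> (AE x in lborel. x \<in> {0..1} \<longrightarrow> f x = g x)"

definition L2_span :: "'i set \<Rightarrow> ('i \<Rightarrow> real \<Rightarrow> real) \<Rightarrow> (real \<Rightarrow> real) set" where
  "L2_span I f = {g \<in> L2_unit. \<exists>F a. finite F \<and> F \<subseteq> I \<and>
                     L2_eq g (\<lambda>x. \<Sum>i\<in>F. a i * f i x)}"

definition L2_dense :: "(real \<Rightarrow> real) set \<Rightarrow> bool" where
  "L2_dense U \<longleftrightarrow> (\<forall>f\<in>L2_unit. \<forall>\<epsilon>>0. \<exists>g\<in>U. L2_nrm (\<lambda>x. f x - g x) < \<epsilon>)"

definition L2_direct_sum ::
    "(real \<Rightarrow> real) set \<Rightarrow> (real \<Rightarrow> real) set \<Rightarrow> (real \<Rightarrow> real) set \<Rightarrow> bool" where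
  "L2_direct_sum U V W \<longleftrightarrow>
     U = {f \<in> L2_unit. \<exists>v\<in>V. \<exists>w\<in>W. L2_eq f (\<lambda>x. v x + w x)} \<and>
     (\<forall>f \<in> V \<inter> W. L2_eq f (\<lambda>x. 0))"

text \<open>Riesz system with bounds \<open>c\<close>, \<open>C\<close>: the two-sided estimate for all finite linear
  combinations. A Riesz basis of \<open>L\<^sup>2([0,1])\<close> has in addition a dense span.\<close>

definition riesz_system ::
    "real \<Rightarrow> real \<Rightarrow> 'i set \<Rightarrow> ('i \<Rightarrow> real \<Rightarrow> real) \<Rightarrow> bool" where
  "riesz_system c C I f \<longleftrightarrow>
     0 < c \<and> (\<forall>i\<in>I. f i \<in> L2_unit) \<and>
     (\<forall>F a. finite F \<and> F \<subseteq> I \<longrightarrow>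
        c * (\<Sum>i\<in>F. (a i)\<^sup>2) \<le> (L2_nrm (\<lambda>x. \<Sum>i\<in>F. a i * f i x))\<^sup>2 \<and>
        (L2_nrm (\<lambda>x. \<Sum>i\<in>F. a i * f i x))\<^sup>2 \<le> C * (\<Sum>i\<in>F. (a i)\<^sup>2))"

definition riesz_basis :: "'i set \<Rightarrow> ('i \<Rightarrow> real \<Rightarrow> real) \<Rightarrow> bool" where
  "riesz_basis I f \<longleftrightarrow> (\<exists>c C. riesz_system c C I f) \<and> L2_dense (L2_span I f)"

section \<open>Univariate biorthogonal wavelets\<close>

text \<open>An index \<open>\<lambda> = (j,k)\<close> consists of a level \<open>j\<close> and a location \<open>k\<close>.\<close>

type_synonym index = "int \<times> int"

record wavelet_system =
  coarse   :: int                              \<comment> \<open>\<open>j\<^sub>0\<close>\<close>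
  scal_idx :: "int \<Rightarrow> index set"               \<comment> \<open>\<open>\<Delta>\<^sub>j\<close>\<close>
  wav_idx  :: "int \<Rightarrow> index set"               \<comment> \<open>\<open>\<nabla>\<^sub>j\<close>\<close>
  scal     :: "index \<Rightarrow> real \<Rightarrow> real"          \<comment> \<open>\<open>\<phi>\<^sub>\<lambda>\<close>\<close>
  wav      :: "index \<Rightarrow> real \<Rightarrow> real"          \<comment> \<open>\<open>\<psi>\<^sub>\<lambda>\<close>\<close>
  dscal    :: "index \<Rightarrow> real \<Rightarrow> real"          \<comment> \<open>dual scaling functions\<close>
  dwav     :: "index \<Rightarrow> real \<Rightarrow> real"          \<comment> \<open>dual wavelets\<close>

text \<open>The spaces \<open>V\<^sub>j\<close> and \<open>W\<^sub>j\<close> are the spans of their bases \<open>\<Phi>\<^sub>j\<close> and \<open>\<Psi>\<^sub>j\<close>; the linear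
  independence of \<open>\<Psi>\<^sub>j\<close> is part of the Riesz basis property. The shape
  \<open>\<phi>\<^sub>\<lambda>(x) = 2\<^bsup>j/2\<^esup> \<phi>(2\<^sup>j x - k)\<close> up to boundary modifications is not imposed.\<close>

definition multiresolution ::
    "int \<Rightarrow> (int \<Rightarrow> index set) \<Rightarrow> (int \<Rightarrow> index set) \<Rightarrow>
     (index \<Rightarrow> real \<Rightarrow> real) \<Rightarrow> (index \<Rightarrow> real \<Rightarrow> real) \<Rightarrow> bool" where
  "multiresolution j0 \<Delta> N \<phi> \<psi> \<longleftrightarrow>
     (let V = (\<lambda>j. L2_span (\<Delta> j) \<phi>); W = (\<lambda>j. L2_span (N j) \<psi>) in
      (\<forall>j\<ge>j0. finite (\<Delta> j) \<and> finite (N j)) \<and>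
      (\<forall>j\<ge>j0. \<forall>l \<in> \<Delta> j \<union> N j. fst l = j) \<and>
      (\<exists>c C. 0 < c \<and> (\<forall>j\<ge>j0. c * 2 powr j \<le> card (\<Delta> j) \<and> card (\<Delta> j) \<le> C * 2 powr j)) \<and>
      (\<exists>c C. \<forall>j\<ge>j0. riesz_system c C (\<Delta> j) \<phi>) \<and>
      (\<forall>j\<ge>j0. V j \<subseteq> V (j + 1)) \<and>
      L2_dense (\<Union>j\<in>{j0..}. V j) \<and>
      (\<forall>j>j0. L2_direct_sum (V j) (V (j - 1)) (W j)) \<and>
      N j0 = \<Delta> j0 \<and> (\<forall>l\<in>N j0. \<forall>x\<in>{0..1}. \<psi> l x = \<phi> l x) \<and>
      riesz_basis (\<Union>j\<in>{j0..}. N j) \<psi>)"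

definition biorthogonal_wavelets :: "wavelet_system \<Rightarrow> bool" where
  "biorthogonal_wavelets S \<longleftrightarrow>
     multiresolution (coarse S) (scal_idx S) (wav_idx S) (scal S) (wav S) \<and>
     multiresolution (coarse S) (scal_idx S) (wav_idx S) (dscal S) (dwav S) \<and>
     (\<forall>j\<ge>coarse S. \<forall>l\<in>scal_idx S j. \<forall>l'\<in>scal_idx S j.
        L2_inner (dscal S l') (scal S l) = (if l = l' then 1 else 0)) \<and>
     (\<forall>l\<in>(\<Union>j\<in>{coarse S..}. wav_idx S j). \<forall>l'\<in>(\<Union>j\<in>{coarse S..}. wav_idx S j).
        L2_inner (dwav S l') (wav S l) = (if l = l' then 1 else 0))"

definition decays ::
    "int \<Rightarrow> (int \<Rightarrow> index set) \<Rightarrow> real \<Rightarrow> (index \<Rightarrow> real \<Rightarrow> real) \<Rightarrow> bool" where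
  "decays j0 I \<alpha> f \<longleftrightarrow>
     (\<exists>C. \<forall>j k x. j0 \<le> j \<and> (j, k) \<in> I j \<and> x \<in> {0..1} \<longrightarrow>
        \<bar>f (j, k) x\<bar> \<le> C * 2 powr (j / 2) * (1 + \<bar>2 powr j * x - k\<bar>) powr (- \<alpha>))"

definition wavelet_decay :: "wavelet_system \<Rightarrow> real \<Rightarrow> bool" where
  "wavelet_decay S \<alpha> \<longleftrightarrow>
     decays (coarse S) (scal_idx S) \<alpha> (scal S) \<and> decays (coarse S) (wav_idx S) \<alpha> (wav S) \<and>
     decays (coarse S) (scal_idx S) \<alpha> (dscal S) \<and> decays (coarse S) (wav_idx S) \<alpha> (dwav S)"

section \<open>Besov spaces on the open unit cube\<close>

text \<open>The underlying functions are those in \<open>L\<^sup>1\<close> of the cube, not only those in \<open>L\<^sup>2\<close>: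
  dual wavelets satisfying the decay estimate are bounded, so the coefficients exist, while a
  Besov space of smoothness \<open>\<alpha> > max 0 (n(1/p - 1))\<close> embeds into \<open>L\<^sup>1\<close> but in general not
  into \<open>L\<^sup>2\<close>. That \<open>u\<close> is represented by its wavelet expansions is not a separate condition: the
  multiresolution projections of an \<open>L\<^sup>1\<close> function converge to it in \<open>L\<^sup>1\<close>.\<close>

definition unit_cube :: "(real ^ 'n) set" where
  "unit_cube = {x. \<forall>i. 0 < x $ i \<and> x $ i < 1}"

definition L1_cube :: "(real ^ 'n \<Rightarrow> real) set" where
  "L1_cube = {u. set_integrable lborel unit_cube u}"

definition cube_pairing :: "(real ^ 'n \<Rightarrow> real) \<Rightarrow> (real ^ 'n \<Rightarrow> real) \<Rightarrow> real" where
  "cube_pairing f u = (LINT x:unit_cube|lborel. f x * u x)"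

definition tensor :: "('n::finite \<Rightarrow> real \<Rightarrow> real) \<Rightarrow> real ^ 'n \<Rightarrow> real" where
  "tensor f x = (\<Prod>i\<in>UNIV. f i (x $ i))"

subsection \<open>Isotropic wavelets\<close>

text \<open>An index \<open>\<mu> = (m, e, l)\<close> of level \<open>|\<mu>| = m\<close> selects in direction \<open>i\<close> the univariate wavelet
  with index \<open>l i\<close> if \<open>e i\<close> holds, and the scaling function with index \<open>l i\<close> otherwise.\<close>

type_synonym 'n iso_index = "int \<times> ('n \<Rightarrow> bool) \<times> ('n \<Rightarrow> index)"

definition iso_idx :: "wavelet_system \<Rightarrow> int \<Rightarrow> 'n iso_index set" where
  "iso_idx S m =
     (if m = coarse S
      then {(m, e, l) | e l. (\<forall>i. \<not> e i) \<and> (\<forall>i. l i \<in> scal_idx S m)}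
      else {(m, e, l) | e l. (\<exists>i. e i) \<and>
              (\<forall>i. l i \<in> (if e i then wav_idx S m else scal_idx S (m - 1)))})"

definition dual_iso_wavelet ::
    "wavelet_system \<Rightarrow> ('n::finite) iso_index \<Rightarrow> real ^ 'n \<Rightarrow> real" where
  "dual_iso_wavelet S = (\<lambda>(m, e, l). tensor (\<lambda>i. if e i then dwav S (l i) else dscal S (l i)))"

definition iso_coeff ::
    "wavelet_system \<Rightarrow> real \<Rightarrow> (real ^ 'n::finite \<Rightarrow> real) \<Rightarrow> 'n iso_index \<Rightarrow> real" where
  "iso_coeff S p u \<mu> =
     2 powr (real CARD('n) * real_of_int (fst \<mu>) * (1/2 - 1/p)) * cube_pairing (dual_iso_wavelet S \<mu>) u"

definition besov_term ::
    "wavelet_system \<Rightarrow> real \<Rightarrow> real \<Rightarrow> real \<Rightarrow> (real ^ 'n::finite \<Rightarrow> real) \<Rightarrow> int \<Rightarrow> real" where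
  "besov_term S \<alpha> p \<tau> u m =
     2 powr (\<tau> * m * \<alpha>) * (\<Sum>\<mu>\<in>iso_idx S m. \<bar>iso_coeff S p u \<mu>\<bar> powr p) powr (\<tau> / p)"

definition besov_space ::
    "wavelet_system \<Rightarrow> real \<Rightarrow> real \<Rightarrow> real \<Rightarrow> (real ^ 'n::finite \<Rightarrow> real) set" where
  "besov_space S \<alpha> p \<tau> = {u \<in> L1_cube. besov_term S \<alpha> p \<tau> u summable_on {coarse S..}}"

definition besov_norm ::
    "wavelet_system \<Rightarrow> real \<Rightarrow> real \<Rightarrow> real \<Rightarrow> (real ^ 'n::finite \<Rightarrow> real) \<Rightarrow> real" where
  "besov_norm S \<alpha> p \<tau> u = (\<Sum>\<^sub>\<infinity>m\<in>{coarse S..}. besov_term S \<alpha> p \<tau> u m) powr (1 / \<tau>)"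

subsection \<open>Tensor-product wavelets and hybrid regularity\<close>

definition tensor_idx :: "wavelet_system \<Rightarrow> ('n \<Rightarrow> int) \<Rightarrow> ('n \<Rightarrow> index) set" where
  "tensor_idx S j = {l. \<forall>i. l i \<in> wav_idx S (j i)}"

definition dual_tensor_wavelet ::
    "wavelet_system \<Rightarrow> ('n::finite \<Rightarrow> index) \<Rightarrow> real ^ 'n \<Rightarrow> real" where
  "dual_tensor_wavelet S l = tensor (\<lambda>i. dwav S (l i))"

definition level_sum :: "('n::finite \<Rightarrow> int) \<Rightarrow> int" where
  "level_sum j = (\<Sum>i\<in>UNIV. j i)"

definition level_max :: "('n::finite \<Rightarrow> int) \<Rightarrow> int" where
  "level_max j = Max (range j)"

definition tensor_coeff ::
    "wavelet_system \<Rightarrow> real \<Rightarrow> (real ^ 'n::finite \<Rightarrow> real) \<Rightarrow> ('n \<Rightarrow> index) \<Rightarrow> real" where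
  "tensor_coeff S p u l =
     2 powr (level_sum (\<lambda>i. fst (l i)) * (1/2 - 1/p)) * cube_pairing (dual_tensor_wavelet S l) u"

definition hybrid_term ::
    "wavelet_system \<Rightarrow> real \<Rightarrow> real \<Rightarrow> real \<Rightarrow> real \<Rightarrow> (real ^ 'n::finite \<Rightarrow> real) \<Rightarrow> ('n \<Rightarrow> int) \<Rightarrow> real"
  where
  "hybrid_term S q s p \<tau> u j =
     2 powr (\<tau> * (q * level_max j + s * level_sum j)) *
     (\<Sum>l\<in>tensor_idx S j. \<bar>tensor_coeff S p u l\<bar> powr p) powr (\<tau> / p)"

definition hybrid_space ::
    "wavelet_system \<Rightarrow> real \<Rightarrow> real \<Rightarrow> real \<Rightarrow> real \<Rightarrow> (real ^ 'n::finite \<Rightarrow> real) set" where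
  "hybrid_space S q s p \<tau> =
     {u \<in> L1_cube. hybrid_term S q s p \<tau> u summable_on {j. \<forall>i. coarse S \<le> j i}}"

definition hybrid_norm ::
    "wavelet_system \<Rightarrow> real \<Rightarrow> real \<Rightarrow> real \<Rightarrow> real \<Rightarrow> (real ^ 'n::finite \<Rightarrow> real) \<Rightarrow> real" where
  "hybrid_norm S q s p \<tau> u =
     (\<Sum>\<^sub>\<infinity>j\<in>{j. \<forall>i. coarse S \<le> j i}. hybrid_term S q s p \<tau> u j) powr (1 / \<tau>)"

definition continuously_embedded ::
    "'u set \<Rightarrow> ('u \<Rightarrow> real) \<Rightarrow> 'u set \<Rightarrow> ('u \<Rightarrow> real) \<Rightarrow> bool" where
  "continuously_embedded X nX Y nY \<longleftrightarrow> X \<subseteq> Y \<and> (\<exists>C. \<forall>u\<in>X. nY u \<le> C * nX u)"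

end

theory Submission imports Defs begin

text \<open>
  Let \<open>|j|\<close> denote the largest and \<open>|j|\<^sub>1\<close> the sum of the levels \<open>j\<^sub>i\<close>, \<open>n\<close> the dimension, and
  put \<open>U\<^sub>l = \<langle>\<psi>~\<^sub>l, u\<rangle>\<close> for tensor indices \<open>l\<close> and \<open>V\<^sub>\<mu> = \<langle>\<theta>~\<^sub>\<mu>, u\<rangle>\<close> for isotropic indices \<open>\<mu>\<close>.
  Since \<open>1/\<tau> = s + 1/2\<close>, the rescaling of the coefficients is by \<open>2\<^bsup>-s|l|\<^sub>1\<^esup>\<close> and \<open>2\<^bsup>-sn|\<mu>|\<^esup>\<close>,
  and the \<open>\<tau>\<close>-th powers of the three quasi-norms become
  \<^item> \<open>\<Sum>\<^sub>m 2\<^bsup>\<tau>qm\<^esup> E\<^sub>V(m)\<close> for smoothness \<open>q + sn\<close>, where \<open>E\<^sub>V(m) = \<Sum>\<^bsub>|\<mu>|=m\<^esub> |V\<^sub>\<mu>|\<^bsup>\<tau>\<^esup>\<close>;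
  \<^item> \<open>\<Sum>\<^sub>m 2\<^bsup>\<tau>qm\<^esup> E\<^sub>U(m)\<close> for the hybrid space, where \<open>E\<^sub>U(m)\<close> sums \<open>|U\<^sub>l|\<^bsup>\<tau>\<^esup>\<close> over all \<open>l\<close>
    whose level vector has maximum \<open>m\<close>;
  \<^item> \<open>\<Sum>\<^sub>m 2\<^bsup>\<tau>qm - \<tau>s(n-1)m\<^esup> E\<^sub>V(m)\<close> for smoothness \<open>q + s\<close>.

  In all three sums \<open>q\<close> occurs in the same weight \<open>2\<^bsup>\<tau>qm\<^esup>\<close>, so both embeddings follow, level by
  level, from
  \<open>E\<^sub>U(m) \<lesssim> E\<^sub>V(m)\<close> and \<open>E\<^sub>V(m) \<lesssim> 2\<^bsup>\<tau>s(n-1)m\<^esup> E\<^sub>U(m)\<close>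
  (\<open>hybrid_energy_le\<close> and \<open>iso_energy_le\<close>).

  The two coefficient families decouple into levels \<open>m\<close> and types \<open>e\<close>. Write \<open>e\<^sub>i\<close> for "the
  direction \<open>i\<close> carries a wavelet of the finest level \<open>m\<close>". In the remaining directions the
  isotropic system uses the scaling functions of level \<open>m - 1\<close> and the tensor system the wavelets
  of all levels up to \<open>m - 1\<close>; the dual functions of either kind are a basis of the same
  finite-dimensional space, so each family is a \<^emph>\<open>finite\<close> linear combination of the other, with
  the tensor product of the univariate matrices \<open>\<langle>\<psi>~\<^sub>l, \<phi>\<^sub>k\<rangle>\<close> (respectively \<open>\<langle>\<phi>~\<^sub>k, \<psi>\<^sub>l\<rangle>\<close>) and of
  identity matrices (\<open>tensor_coeff_from_iso\<close>, \<open>iso_coeff_from_tensor\<close>). On the coarsest level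
  the two families coincide.

  By the decay of the generators these matrices satisfy, with \<open>d\<close> the level difference,
  \<open>|b\<^sub>l\<^sub>k| \<lesssim> 2\<^bsup>-d/2\<^esup> (1 + |2\<^bsup>-d\<^esup>k - l|)\<^bsup>-\<alpha>\<^esup>\<close> (\<open>decay_inner_bound\<close>). They are therefore bounded on
  \<open>l\<^sup>\<tau>\<close>, by a constant from fine to coarse and by a multiple of \<open>2\<^bsup>ms\<tau>\<^esup>\<close> (for \<open>\<tau>\<close>-th powers) from coarse to
  fine. The assumption \<open>s < \<alpha> - 1/2\<close> says \<open>\<alpha>\<tau> > 1\<close>, which makes the \<open>\<tau>\<close>-th powers of the entries
  summable. Boundedness is certified by a weighted Schur test which covers \<open>\<tau> \<le> 1\<close> and \<open>\<tau> > 1\<close>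
  simultaneously and is stable under tensor products (\<open>schur_test\<close>, \<open>schur_bound_tensor\<close>). In
  the second estimate at least one of the \<open>n\<close> directions is an identity, whence the factor \<open>n - 1\<close>.
\<close>

section \<open>Tensor products of Schur bounds\<close>

lemma powr_sum_subadditive:
  fixes x :: "'a \<Rightarrow> real"
  assumes "0 < p" "p \<le> 1" "\<And>i. i \<in> A \<Longrightarrow> 0 \<le> x i"
  shows "(\<Sum>i\<in>A. x i) powr p \<le> (\<Sum>i\<in>A. x i powr p)"
proof (cases "finite A \<and> 0 < (\<Sum>i\<in>A. x i)")
  case True
  define t where "t = (\<Sum>i\<in>A. x i)"
  have t: "0 < t" "finite A" using True by (auto simp: t_def)
  \<comment> \<open>after division by the sum all terms lie in \<open>[0,1]\<close>, where \<open>y \<le> y\<^bsup>p\<^esup>\<close>\<close>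
  have "x i / t \<le> (x i / t) powr p" if "i \<in> A" for i
  proof (cases "x i = 0")
    case False
    have "x i \<le> t" unfolding t_def using that assms(3) True by (intro member_le_sum) auto
    then have "(x i / t) powr 1 \<le> (x i / t) powr p"
      using False t assms(1,2) assms(3)[OF that] by (intro powr_mono') auto
    then show ?thesis using False t assms(3)[OF that] by simp
  qed simp
  then have "(\<Sum>i\<in>A. x i / t) \<le> (\<Sum>i\<in>A. (x i / t) powr p)" by (intro sum_mono)
  moreover have "(\<Sum>i\<in>A. x i / t) = 1" using t by (simp add: sum_divide_distrib[symmetric] t_def[symmetric])
  moreover have "(\<Sum>i\<in>A. (x i / t) powr p) = (\<Sum>i\<in>A. x i powr p) / t powr p"
    using t assms(3) by (simp add: powr_divide sum_divide_distrib)
  ultimately show ?thesis using t by (simp add: t_def[symmetric] field_simps)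
next
  case False
  then have "(\<Sum>i\<in>A. x i) = 0" using sum_nonneg[of A x] assms(3) by (cases "finite A") auto
  then show ?thesis by (simp add: sum_nonneg)
qed

text \<open>Jensen's inequality for \<open>x \<mapsto> x\<^bsup>p\<^esup>\<close> with weights that need not be normalised.\<close>

lemma powr_sum_weighted:
  fixes x w :: "'a \<Rightarrow> real"
  assumes "finite A" "1 \<le> p" "\<And>i. i \<in> A \<Longrightarrow> 0 \<le> x i" "\<And>i. i \<in> A \<Longrightarrow> 0 \<le> w i"
  shows "(\<Sum>i\<in>A. w i * x i) powr p \<le> (\<Sum>i\<in>A. w i) powr (p - 1) * (\<Sum>i\<in>A. w i * x i powr p)"
proof -
  \<comment> \<open>convexity is used on the open half-line, so the vanishing terms are discarded first\<close>
  define B where "B = {i \<in> A. w i * x i \<noteq> 0}"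
  have B: "finite B" "B \<subseteq> A" using assms(1) by (auto simp: B_def)
  have pos: "0 < w i" "0 < x i" if "i \<in> B" for i
    using that assms(3,4)[of i] by (auto simp: B_def less_le)
  define W where "W = (\<Sum>i\<in>B. w i)"
  have 1: "(\<Sum>i\<in>A. w i * x i) = (\<Sum>i\<in>B. w i * x i)"
    using assms(1) by (intro sum.mono_neutral_right) (auto simp: B_def)
  have 2: "(\<Sum>i\<in>A. w i * x i powr p) = (\<Sum>i\<in>B. w i * x i powr p)"
    using assms(1) by (intro sum.mono_neutral_right) (auto simp: B_def)
  have 3: "W \<le> (\<Sum>i\<in>A. w i)" unfolding W_def using assms B by (intro sum_mono2) auto
  have 4: "(\<Sum>i\<in>B. w i * x i) powr p \<le> W powr (p - 1) * (\<Sum>i\<in>B. w i * x i powr p)"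
  proof (cases "B = {}")
    case False
    then have W: "0 < W" unfolding W_def using B pos by (intro sum_pos) auto
    have "(\<Sum>i\<in>B. (w i / W) *\<^sub>R x i) powr p \<le> (\<Sum>i\<in>B. (w i / W) * x i powr p)"
      using B False pos W
      by (intro convex_on_sum[OF _ _ powr_convex[OF assms(2)]])
        (auto simp: sum_divide_distrib[symmetric] W_def[symmetric] less_imp_le)
    then have "((\<Sum>i\<in>B. w i * x i) / W) powr p \<le> (\<Sum>i\<in>B. w i * x i powr p) / W"
      by (simp add: sum_divide_distrib)
    moreover have "((\<Sum>i\<in>B. w i * x i) / W) powr p = (\<Sum>i\<in>B. w i * x i) powr p / W powr p"
      by (rule powr_divide)
    ultimately have "(\<Sum>i\<in>B. w i * x i) powr p \<le> W powr p * ((\<Sum>i\<in>B. w i * x i powr p) / W)"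
      using W by (simp add: field_simps)
    also have "\<dots> = W powr (p - 1) * (\<Sum>i\<in>B. w i * x i powr p)"
      using W by (simp add: powr_diff)
    finally show ?thesis .
  qed auto
  also have "\<dots> \<le> (\<Sum>i\<in>A. w i) powr (p - 1) * (\<Sum>i\<in>B. w i * x i powr p)"
    using 3 assms(2) pos by (intro mult_right_mono powr_mono2 sum_nonneg)
      (auto simp: W_def less_imp_le intro!: sum_nonneg)
  finally show ?thesis using 1 2 by simp
qed

text \<open>Together with the next exponent this treats \<open>\<tau> \<le> 1\<close> and \<open>\<tau> > 1\<close> in one formula:
  \<open>(\<rho>, \<sigma>)\<close> is \<open>(\<tau>, 0)\<close> in the first case, where the \<open>\<tau>\<close>-th power is subadditive, and
  \<open>(1, \<tau> - 1)\<close> in the second, where it is convex. In both cases \<open>\<tau> = \<rho>(1 + \<sigma>)\<close>.\<close>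

definition schur_rho :: "real \<Rightarrow> real" where "schur_rho \<tau> = min 1 \<tau>"
definition schur_sigma :: "real \<Rightarrow> real" where "schur_sigma \<tau> = max 1 \<tau> - 1"

lemma schur_exponents: 
  assumes "0 < \<tau>"
  shows "0 < schur_rho \<tau>" "0 \<le> schur_sigma \<tau>" "schur_rho \<tau> * (1 + schur_sigma \<tau>) = \<tau>"
  using assms by (auto simp: schur_rho_def schur_sigma_def min_def max_def)

text \<open>A certificate that the matrix \<open>a\<close> maps \<open>l\<^sup>\<tau>(Y)\<close> to \<open>l\<^sup>\<tau>(X)\<close>, the \<open>\<tau>\<close>-th power of its norm being at
  most \<open>K\<close>. For \<open>\<tau> \<le> 1\<close>, where \<open>\<sigma> = 0\<close>, the last condition bounds the column sums of
  \<open>|a|\<^bsup>\<tau>\<^esup>\<close> by \<open>K\<close>; for \<open>\<tau> > 1\<close> it is Schur's test with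
  column weights \<open>w\<close> and row bounds \<open>R\<close>. Letting \<open>R\<close> depend on the row and \<open>w\<close> on the column
  is what makes matrices that couple many levels at once accessible.\<close>

definition schur_bound where
  "schur_bound \<tau> X Y a w R K \<longleftrightarrow>
     finite X \<and> finite Y \<and> (\<forall>k\<in>Y. 0 < w k) \<and>
     (\<forall>l\<in>X. 0 < R l \<and> (\<Sum>k\<in>Y. \<bar>a l k\<bar> powr schur_rho \<tau> * w k) \<le> R l) \<and>
     (\<forall>k\<in>Y. (\<Sum>l\<in>X. R l powr schur_sigma \<tau> * \<bar>a l k\<bar> powr schur_rho \<tau>) \<le> K * w k powr schur_sigma \<tau>)"
  for \<tau> K :: real and a :: "'a \<Rightarrow> 'b \<Rightarrow> real" and w :: "'b \<Rightarrow> real" and R :: "'a \<Rightarrow> real"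

text \<open>This is subadditivity of the \<open>\<tau>\<close>-th power for \<open>\<tau> \<le> 1\<close>, and Jensen's inequality with weights
  \<open>|a\<^sub>l\<^sub>k| w\<^sub>k\<close> applied to \<open>|v\<^sub>k| / w\<^sub>k\<close> for \<open>\<tau> > 1\<close>.\<close>

lemma schur_row:
  assumes S: "schur_bound \<tau> X Y a w R K" and \<tau>: "0 < \<tau>" and l: "l \<in> X"
  shows "\<bar>\<Sum>k\<in>Y. a l k * v k\<bar> powr \<tau> \<le>
    (\<Sum>k\<in>Y. R l powr schur_sigma \<tau> * \<bar>a l k\<bar> powr schur_rho \<tau> * (\<bar>v k\<bar> powr \<tau> / w k powr schur_sigma \<tau>))"
proof -
  have S': "finite Y" "\<And>k. k \<in> Y \<Longrightarrow> 0 < w k" "0 < R l"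
    "(\<Sum>k\<in>Y. \<bar>a l k\<bar> powr schur_rho \<tau> * w k) \<le> R l"
    using S l by (auto simp: schur_bound_def)
  have "\<bar>\<Sum>k\<in>Y. a l k * v k\<bar> \<le> (\<Sum>k\<in>Y. \<bar>a l k\<bar> * \<bar>v k\<bar>)"
    by (rule order_trans[OF sum_abs]) (simp add: abs_mult)
  then have A: "\<bar>\<Sum>k\<in>Y. a l k * v k\<bar> powr \<tau> \<le> (\<Sum>k\<in>Y. \<bar>a l k\<bar> * \<bar>v k\<bar>) powr \<tau>"
    using \<tau> by (intro powr_mono2) auto
  show ?thesis
  proof (cases "\<tau> \<le> 1")
    case True
    then have e: "schur_rho \<tau> = \<tau>" "schur_sigma \<tau> = 0" by (auto simp: schur_rho_def schur_sigma_def)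
    have "(\<Sum>k\<in>Y. \<bar>a l k\<bar> * \<bar>v k\<bar>) powr \<tau> \<le> (\<Sum>k\<in>Y. (\<bar>a l k\<bar> * \<bar>v k\<bar>) powr \<tau>)"
      using True \<tau> by (intro powr_sum_subadditive) auto
    also have "\<dots> = (\<Sum>k\<in>Y. R l powr schur_sigma \<tau> * \<bar>a l k\<bar> powr schur_rho \<tau> * (\<bar>v k\<bar> powr \<tau> / w k powr schur_sigma \<tau>))"
      using S'(2,3) by (intro sum.cong) (auto simp: e powr_mult dest: S'(2))
    finally show ?thesis using A by linarith
  next
    case False
    then have e: "schur_rho \<tau> = 1" "schur_sigma \<tau> = \<tau> - 1" by (auto simp: schur_rho_def schur_sigma_def)
    have "(\<Sum>k\<in>Y. \<bar>a l k\<bar> * \<bar>v k\<bar>) = (\<Sum>k\<in>Y. (\<bar>a l k\<bar> * w k) * (\<bar>v k\<bar> / w k))"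
      by (intro sum.cong) (auto dest: S'(2))
    also have "\<dots> powr \<tau> \<le> (\<Sum>k\<in>Y. \<bar>a l k\<bar> * w k) powr (\<tau> - 1) *
                      (\<Sum>k\<in>Y. (\<bar>a l k\<bar> * w k) * (\<bar>v k\<bar> / w k) powr \<tau>)"
      using False S'(1) by (intro powr_sum_weighted) (auto dest!: S'(2) simp: less_imp_le)
    also have "\<dots> \<le> R l powr (\<tau> - 1) * (\<Sum>k\<in>Y. (\<bar>a l k\<bar> * w k) * (\<bar>v k\<bar> / w k) powr \<tau>)"
      using S'(4) False by (intro mult_right_mono powr_mono2 sum_nonneg) 
         (auto simp: e intro!: sum_nonneg dest!: S'(2) simp: less_imp_le)
    also have "\<dots> = (\<Sum>k\<in>Y. R l powr schur_sigma \<tau> * \<bar>a l k\<bar> powr schur_rho \<tau> * (\<bar>v k\<bar> powr \<tau> / w k powr schur_sigma \<tau>))"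
      unfolding sum_distrib_left
    proof (intro sum.cong refl)
      fix k assume "k \<in> Y"
      then have "0 < w k" by (rule S'(2))
      then show "R l powr (\<tau> - 1) * (\<bar>a l k\<bar> * w k * (\<bar>v k\<bar> / w k) powr \<tau>) =
         R l powr schur_sigma \<tau> * \<bar>a l k\<bar> powr schur_rho \<tau> * (\<bar>v k\<bar> powr \<tau> / w k powr schur_sigma \<tau>)"
        by (simp add: e powr_divide powr_diff)
    qed
    finally show ?thesis using A by linarith
  qed
qed

text \<open>Sum the row estimate over all rows and exchange the order of summation; the weights
  introduced there are absorbed by the column condition.\<close>

lemma schur_test:
  assumes S: "schur_bound \<tau> X Y a w R K" and \<tau>: "0 < \<tau>"
  shows "(\<Sum>l\<in>X. \<bar>\<Sum>k\<in>Y. a l k * v k\<bar> powr \<tau>) \<le> K * (\<Sum>k\<in>Y. \<bar>v k\<bar> powr \<tau>)"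
proof -
  have "(\<Sum>l\<in>X. \<bar>\<Sum>k\<in>Y. a l k * v k\<bar> powr \<tau>) \<le>
    (\<Sum>l\<in>X. \<Sum>k\<in>Y. R l powr schur_sigma \<tau> * \<bar>a l k\<bar> powr schur_rho \<tau> * (\<bar>v k\<bar> powr \<tau> / w k powr schur_sigma \<tau>))"
    by (intro sum_mono schur_row[OF S \<tau>])
  also have "\<dots> = (\<Sum>k\<in>Y. (\<Sum>l\<in>X. R l powr schur_sigma \<tau> * \<bar>a l k\<bar> powr schur_rho \<tau>) * (\<bar>v k\<bar> powr \<tau> / w k powr schur_sigma \<tau>))"
    by (subst sum.swap) (simp only: sum_distrib_right)
  also have "\<dots> \<le> (\<Sum>k\<in>Y. (K * w k powr schur_sigma \<tau>) * (\<bar>v k\<bar> powr \<tau> / w k powr schur_sigma \<tau>))"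
    using S by (intro sum_mono mult_right_mono) (auto simp: schur_bound_def)
  also have "\<dots> = K * (\<Sum>k\<in>Y. \<bar>v k\<bar> powr \<tau>)"
    unfolding sum_distrib_left using S by (intro sum.cong) (auto simp: schur_bound_def)
  finally show ?thesis .
qed

text \<open>All sums in the certificate are sums of products over a product index set, and hence
  factor into the univariate sums.\<close>

lemma schur_bound_tensor:
  fixes a :: "'n::finite \<Rightarrow> 'a \<Rightarrow> 'b \<Rightarrow> real"
  assumes S: "\<And>i. schur_bound \<tau> (X i) (Y i) (a i) (w i) (R i) (K i)"
  shows "schur_bound \<tau> (PiE UNIV X) (PiE UNIV Y) (\<lambda>l k. \<Prod>i\<in>UNIV. a i (l i) (k i))
           (\<lambda>k. \<Prod>i\<in>UNIV. w i (k i)) (\<lambda>l. \<Prod>i\<in>UNIV. R i (l i)) (\<Prod>i\<in>UNIV. K i)"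
  unfolding schur_bound_def
proof (intro conjI ballI)
  have fin: "finite (X i)" "finite (Y i)" for i using S[of i] by (auto simp: schur_bound_def)
  show "finite (PiE UNIV X)" "finite (PiE UNIV Y)" by (auto intro!: finite_PiE fin)
  fix k assume k: "k \<in> PiE UNIV Y"
  then have k: "k i \<in> Y i" for i by auto
  show "0 < (\<Prod>i\<in>UNIV. w i (k i))"
    using S k by (intro prod_pos) (auto simp: schur_bound_def)
  have "(\<Sum>l\<in>PiE UNIV X. (\<Prod>i\<in>UNIV. R i (l i)) powr schur_sigma \<tau> *
            \<bar>\<Prod>i\<in>UNIV. a i (l i) (k i)\<bar> powr schur_rho \<tau>) =
        (\<Sum>l\<in>PiE UNIV X. \<Prod>i\<in>UNIV. R i (l i) powr schur_sigma \<tau> * \<bar>a i (l i) (k i)\<bar> powr schur_rho \<tau>)"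
    by (simp add: prod_powr_distrib abs_prod prod.distrib)
  also have "\<dots> = (\<Prod>i\<in>UNIV. \<Sum>l\<in>X i. R i l powr schur_sigma \<tau> * \<bar>a i l (k i)\<bar> powr schur_rho \<tau>)"
    by (subst prod_sum_PiE) (auto simp: fin)
  also have "\<dots> \<le> (\<Prod>i\<in>UNIV. K i * w i (k i) powr schur_sigma \<tau>)"
    using S k by (intro prod_mono) (auto simp: schur_bound_def intro!: sum_nonneg)
  also have "\<dots> = (\<Prod>i\<in>UNIV. K i) * (\<Prod>i\<in>UNIV. w i (k i)) powr schur_sigma \<tau>"
    by (simp add: prod.distrib prod_powr_distrib)
  finally show "(\<Sum>l\<in>PiE UNIV X. (\<Prod>i\<in>UNIV. R i (l i)) powr schur_sigma \<tau> *
            \<bar>\<Prod>i\<in>UNIV. a i (l i) (k i)\<bar> powr schur_rho \<tau>)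
      \<le> (\<Prod>i\<in>UNIV. K i) * (\<Prod>i\<in>UNIV. w i (k i)) powr schur_sigma \<tau>" .
next
  have fin: "finite (X i)" "finite (Y i)" for i using S[of i] by (auto simp: schur_bound_def)
  fix l assume l: "l \<in> PiE UNIV X"
  then have l: "l i \<in> X i" for i by auto
  show "0 < (\<Prod>i\<in>UNIV. R i (l i))"
    using S l by (intro prod_pos) (auto simp: schur_bound_def)
  have "(\<Sum>k\<in>PiE UNIV Y. \<bar>\<Prod>i\<in>UNIV. a i (l i) (k i)\<bar> powr schur_rho \<tau> * (\<Prod>i\<in>UNIV. w i (k i))) =
        (\<Sum>k\<in>PiE UNIV Y. \<Prod>i\<in>UNIV. \<bar>a i (l i) (k i)\<bar> powr schur_rho \<tau> * w i (k i))"
    by (simp add: prod_powr_distrib abs_prod prod.distrib)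
  also have "\<dots> = (\<Prod>i\<in>UNIV. \<Sum>k\<in>Y i. \<bar>a i (l i) k\<bar> powr schur_rho \<tau> * w i k)"
    by (subst prod_sum_PiE) (auto simp: fin)
  also have "\<dots> \<le> (\<Prod>i\<in>UNIV. R i (l i))"
    using S l by (intro prod_mono) (auto simp: schur_bound_def less_imp_le intro!: sum_nonneg)
  finally show "(\<Sum>k\<in>PiE UNIV Y. \<bar>\<Prod>i\<in>UNIV. a i (l i) (k i)\<bar> powr schur_rho \<tau> * (\<Prod>i\<in>UNIV. w i (k i)))
     \<le> (\<Prod>i\<in>UNIV. R i (l i))" .
qed

lemma schur_bound_delta:
  fixes X :: "'a set" and \<tau> :: real
  assumes "finite X"
  shows "schur_bound \<tau> X X (\<lambda>l k. if l = k then 1 else 0) (\<lambda>_. 1) (\<lambda>_. 1) 1"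
  using assms by (auto simp: schur_bound_def if_distrib[of abs] if_distrib[of "\<lambda>x. x powr _"] cong: if_cong)

section \<open>Polynomial decay\<close>

definition poly_decay :: "real \<Rightarrow> real \<Rightarrow> real" where
  "poly_decay \<alpha> t = (1 + \<bar>t\<bar>) powr (- \<alpha>)"

lemma poly_decay_pos: "0 < poly_decay \<alpha> t" by (simp add: poly_decay_def)

lemma poly_decay_le_1: "0 \<le> \<alpha> \<Longrightarrow> poly_decay \<alpha> t \<le> 1"
  using powr_mono2'[of "-\<alpha>" 1 "1 + \<bar>t\<bar>"] by (simp add: poly_decay_def)

lemma poly_decay_uminus [simp]: "poly_decay \<alpha> (- t) = poly_decay \<alpha> t"
  by (simp add: poly_decay_def)

lemma poly_decay_shift:
  assumes "0 \<le> \<alpha>" "0 < c" "1 + \<bar>s\<bar> \<le> c * (1 + \<bar>t\<bar>)"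
  shows "poly_decay \<alpha> t \<le> c powr \<alpha> * poly_decay \<alpha> s"
proof -
  have "(1 + \<bar>t\<bar>) powr (-\<alpha>) \<le> ((1 + \<bar>s\<bar>) / c) powr (-\<alpha>)"
    using assms by (intro powr_mono2') (auto simp: field_simps)
  also have "\<dots> = c powr \<alpha> * (1 + \<bar>s\<bar>) powr (-\<alpha>)"
    using assms by (simp add: powr_divide powr_minus field_simps)
  finally show ?thesis by (simp add: poly_decay_def)
qed

lemma poly_decay_measurable [measurable]: "poly_decay \<alpha> \<in> borel_measurable borel"
  unfolding poly_decay_def by measurable

lemma nn_integral_poly_decay_half:
  assumes "1 < \<alpha>"
  shows "(\<integral>\<^sup>+x. ennreal (poly_decay \<alpha> x) * indicator {0..} x \<partial>lborel) = ennreal (1 / (\<alpha> - 1))"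
proof -
  have "(\<integral>\<^sup>+x. ennreal (poly_decay \<alpha> x) * indicator {0..} x \<partial>lborel)
      = ennreal (0 - (1 + 0) powr (1 - \<alpha>) / (1 - \<alpha>))"
  proof (rule nn_integral_FTC_atLeast)
    fix x :: real assume x: "0 \<le> x"
    have "DERIV (\<lambda>x. (1 + x) powr (1 - \<alpha>) / (1 - \<alpha>)) x :> (1 + x) powr (-\<alpha>)"
      using x assms by (auto intro!: derivative_eq_intros)
    then show "DERIV (\<lambda>x. (1 + x) powr (1 - \<alpha>) / (1 - \<alpha>)) x :> poly_decay \<alpha> x"
      using x by (simp add: poly_decay_def)
  next
    have "((\<lambda>x. (1 + x) powr (1 - \<alpha>)) \<longlongrightarrow> 0) at_top"
      using assms by (intro tendsto_neg_powr filterlim_tendsto_add_at_top[OF tendsto_const] filterlim_ident) auto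
    then show "((\<lambda>x. (1 + x) powr (1 - \<alpha>) / (1 - \<alpha>)) \<longlongrightarrow> 0) at_top"
      using tendsto_divide[OF _ tendsto_const, of _ 0 at_top "1 - \<alpha>"] assms by force
  qed (auto simp: poly_decay_pos less_imp_le)
  also have "0 - (1 + 0) powr (1 - \<alpha>) / (1 - \<alpha>) = 1 / (\<alpha> - 1)"
    using assms by (simp add: field_simps)
  finally show ?thesis .
qed

lemma nn_integral_poly_decay:
  assumes "1 < \<alpha>"
  shows "(\<integral>\<^sup>+x. ennreal (poly_decay \<alpha> x) \<partial>lborel) \<le> ennreal (2 / (\<alpha> - 1))"
proof -
  \<comment> \<open>reflection reduces the line to the half-line\<close>
  let ?g = "\<lambda>x. ennreal (poly_decay \<alpha> x) * indicator {0..} x"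
  have "(\<integral>\<^sup>+x. ennreal (poly_decay \<alpha> x) \<partial>lborel) \<le> (\<integral>\<^sup>+x. ?g x + ?g (0 + (-1) * x) \<partial>lborel)"
    by (intro nn_integral_mono) (auto simp: indicator_def)
  also have "\<dots> = (\<integral>\<^sup>+x. ?g x \<partial>lborel) + (\<integral>\<^sup>+x. ?g (0 + (-1) * x) \<partial>lborel)"
    by (intro nn_integral_add) auto
  also have "(\<integral>\<^sup>+x. ?g (0 + (-1) * x) \<partial>lborel) = (\<integral>\<^sup>+x. ?g x \<partial>lborel)"
    by (subst nn_integral_real_affine[of ?g "-1" 0]) auto
  also have "(\<integral>\<^sup>+x. ?g x \<partial>lborel) + (\<integral>\<^sup>+x. ?g x \<partial>lborel) = ennreal (2 / (\<alpha> - 1))"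
    using assms by (simp add: nn_integral_poly_decay_half ennreal_plus[symmetric] del: ennreal_plus)
  finally show ?thesis .
qed

lemma nn_integral_poly_decay_affine:
  assumes "1 < \<alpha>" "0 < h"
  shows "(\<integral>\<^sup>+x. ennreal (poly_decay \<alpha> (h * x - t)) \<partial>lborel) \<le> ennreal (2 / (\<alpha> - 1) / h)"
proof -
  let ?I = "\<integral>\<^sup>+x. ennreal (poly_decay \<alpha> (h * x - t)) \<partial>lborel"
  have "(\<integral>\<^sup>+x. ennreal (poly_decay \<alpha> x) \<partial>lborel) = ennreal h * ?I"
    using assms by (subst nn_integral_real_affine[of _ h "-t"]) auto
  then have "ennreal h * ?I \<le> ennreal (2 / (\<alpha> - 1))"
    using nn_integral_poly_decay[OF assms(1)] by simp
  then have "ennreal (1/h) * (ennreal h * ?I) \<le> ennreal (1/h) * ennreal (2 / (\<alpha> - 1))"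
    by (intro mult_left_mono) auto
  then show ?thesis
    using assms by (simp add: mult.assoc[symmetric] ennreal_mult[symmetric] field_simps)
qed

text \<open>Integral comparison: on \<open>[k, k + 1)\<close> the argument \<open>h x - t\<close> moves by at most \<open>h \<le> 1\<close>, so the
  summand is bounded by \<open>2\<^bsup>\<alpha>\<^esup>\<close> times the integrand there. The bound is independent of the
  translation \<open>t\<close> and of the finite set.\<close>

lemma sum_poly_decay_le:
  assumes "1 < \<alpha>" "0 < h" "h \<le> 1" "finite F"
  shows "(\<Sum>k\<in>F. poly_decay \<alpha> (h * real_of_int k - t)) \<le> 2 powr \<alpha> * (2 / (\<alpha> - 1)) / h"
proof -
  let ?g = "\<lambda>x. ennreal (poly_decay \<alpha> (h * x - t))"
  have "ennreal (\<Sum>k\<in>F. poly_decay \<alpha> (h * real_of_int k - t)) =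
      (\<Sum>k\<in>F. (\<integral>\<^sup>+x. ennreal (poly_decay \<alpha> (h * real_of_int k - t)) * indicator {k..<real_of_int k+1} x \<partial>lborel))"
    by (simp add: nn_integral_cmult_indicator sum_ennreal poly_decay_pos less_imp_le)
  also have "\<dots> \<le> (\<Sum>k\<in>F. (\<integral>\<^sup>+x. ennreal (2 powr \<alpha>) * (?g x * indicator {k..<real_of_int k+1} x) \<partial>lborel))"
  proof (intro sum_mono nn_integral_mono)
    fix k x
    have "poly_decay \<alpha> (h * real_of_int k - t) \<le> 2 powr \<alpha> * poly_decay \<alpha> (h * x - t)"
      if "real_of_int k \<le> x" "x < real_of_int k + 1"
    proof (rule poly_decay_shift)
      have "h * (x - k) \<le> 1 * 1" using that assms by (intro mult_mono) auto
      moreover have "0 \<le> h * (x - k)" using that assms by auto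
      moreover have "\<bar>(h * real_of_int k - t) + h * (x - k)\<bar> \<le> \<bar>h * real_of_int k - t\<bar> + \<bar>h * (x - k)\<bar>"
        by (rule abs_triangle_ineq)
      moreover have "(h * real_of_int k - t) + h * (x - k) = h * x - t" by (simp add: algebra_simps)
      ultimately have "\<bar>h * x - t\<bar> \<le> \<bar>h * real_of_int k - t\<bar> + 1" by simp
      moreover have aux: "a \<le> b + 1 \<Longrightarrow> 0 \<le> b \<Longrightarrow> 1 + a \<le> 2 * (1 + b)" for a b :: real by simp
      ultimately show "1 + \<bar>h * x - t\<bar> \<le> 2 * (1 + \<bar>h * real_of_int k - t\<bar>)"
        by (intro aux abs_ge_zero)
    qed (use assms in auto)
    then show "ennreal (poly_decay \<alpha> (h * real_of_int k - t)) * indicator {k..<real_of_int k+1} x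
        \<le> ennreal (2 powr \<alpha>) * (?g x * indicator {k..<real_of_int k+1} x)"
      by (auto simp: indicator_def ennreal_mult[symmetric] poly_decay_pos less_imp_le)
  qed
  also have "\<dots> = (\<integral>\<^sup>+x. ennreal (2 powr \<alpha>) * (\<Sum>k\<in>F. ?g x * indicator {k..<real_of_int k+1} x) \<partial>lborel)"
    by (simp add: nn_integral_sum nn_integral_cmult sum_distrib_left)
  also have "\<dots> \<le> (\<integral>\<^sup>+x. ennreal (2 powr \<alpha>) * ?g x \<partial>lborel)"
  proof (intro nn_integral_mono mult_left_mono)
    fix x :: real
    have "(\<Sum>k\<in>F. ?g x * indicator {k..<real_of_int k+1} x) = (\<Sum>k\<in>F. if k = \<lfloor>x\<rfloor> then ?g x else 0)"
      by (intro sum.cong) (auto simp: indicator_def floor_eq_iff, linarith+)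
    also have "\<dots> \<le> ?g x" using assms by simp
    finally show "(\<Sum>k\<in>F. ?g x * indicator {k..<real_of_int k+1} x) \<le> ?g x" .
  qed auto
  also have "\<dots> \<le> ennreal (2 powr \<alpha>) * ennreal (2 / (\<alpha> - 1) / h)"
    using nn_integral_poly_decay_affine[OF assms(1,2), of t]
    by (simp add: nn_integral_cmult mult_left_mono)
  also have "\<dots> = ennreal (2 powr \<alpha> * (2 / (\<alpha> - 1)) / h)"
    using assms by (simp add: ennreal_mult[symmetric])
  finally show ?thesis using assms by (subst (asm) ennreal_le_iff) auto
qed

text \<open>Two bumps of widths 1 and \<open>h\<close> (in the variable \<open>y\<close>), at distance \<open>t\<close>: wherever they are
  evaluated, one of the two points is far from its centre. If \<open>|y|\<close> is comparable to \<open>|t|\<close>, the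
  wide bump provides the decay in \<open>t\<close>; otherwise \<open>|z|\<close> is at least of order \<open>|t|/h\<close>, and the
  narrow bump provides it with the additional factor \<open>h\<^bsup>\<alpha>\<^esup> \<le> h\<close>. Both terms on the right have
  an integral of order \<open>h\<close>.\<close>

lemma poly_decay_product:
  assumes \<alpha>: "1 < \<alpha>" and h: "0 < h" "h \<le> 1" and t: "t = y - h * z"
  shows "poly_decay \<alpha> y * poly_decay \<alpha> z \<le>
           4 powr \<alpha> * poly_decay \<alpha> t * (poly_decay \<alpha> z + h * poly_decay \<alpha> y)"
proof -
  have nn: "0 \<le> poly_decay \<alpha> x" for x using poly_decay_pos[of \<alpha> x] by simp
  show ?thesis
  proof (cases "1 + \<bar>t\<bar> \<le> 4 * (1 + \<bar>y\<bar>)")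
    case True
    then have "poly_decay \<alpha> y \<le> 4 powr \<alpha> * poly_decay \<alpha> t" using \<alpha> by (intro poly_decay_shift) auto
    then have "poly_decay \<alpha> y * poly_decay \<alpha> z \<le> (4 powr \<alpha> * poly_decay \<alpha> t) * poly_decay \<alpha> z"
      by (intro mult_right_mono nn)
    also have "\<dots> \<le> (4 powr \<alpha> * poly_decay \<alpha> t) * (poly_decay \<alpha> z + h * poly_decay \<alpha> y)"
      using h by (intro mult_left_mono) (auto simp: nn)
    finally show ?thesis .
  next
    case False
    have "\<bar>t\<bar> \<le> \<bar>y\<bar> + h * \<bar>z\<bar>" using h t abs_triangle_ineq4[of y "h * z"] by (simp add: abs_mult)
    then have z: "1 + \<bar>t\<bar> \<le> 4 * (h * \<bar>z\<bar>)" using False by argo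
    have "poly_decay \<alpha> z \<le> ((1 + \<bar>t\<bar>) / (4 * h)) powr (-\<alpha>)"
      unfolding poly_decay_def using z \<alpha> h by (intro powr_mono2') (auto simp: field_simps)
    also have "\<dots> = (4 powr \<alpha> * poly_decay \<alpha> t) * h powr \<alpha>"
      using h by (simp add: powr_divide powr_minus powr_mult poly_decay_def field_simps)
    also have "\<dots> \<le> (4 powr \<alpha> * poly_decay \<alpha> t) * h powr 1"
      using h \<alpha> by (intro mult_left_mono powr_mono') (auto simp: nn)
    finally have "poly_decay \<alpha> y * poly_decay \<alpha> z \<le> poly_decay \<alpha> y * ((4 powr \<alpha> * poly_decay \<alpha> t) * h)"
      using h by (intro mult_left_mono nn) auto
    also have "\<dots> = (4 powr \<alpha> * poly_decay \<alpha> t) * (h * poly_decay \<alpha> y)" by simp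
    also have "\<dots> \<le> (4 powr \<alpha> * poly_decay \<alpha> t) * (poly_decay \<alpha> z + h * poly_decay \<alpha> y)"
      by (intro mult_left_mono) (auto simp: nn)
    finally show ?thesis .
  qed
qed

section \<open>Almost diagonal matrices\<close>

text \<open>The injection \<open>h\<close> is used to count levels downwards from a finest one as well as upwards
  from the coarsest one.\<close>

lemma sum_geometric_int_le:
  assumes e: "0 < \<epsilon>" and F: "finite F" "inj_on h F" "\<And>j. j \<in> F \<Longrightarrow> (0::int) \<le> h j"
  shows "(\<Sum>j\<in>F. 2 powr (- \<epsilon> * real_of_int (h j))) \<le> 1 / (1 - 2 powr (- \<epsilon>))"
proof -
  have inj: "inj_on (\<lambda>j. nat (h j)) F"
    using F(2,3) by (metis (no_types, lifting) eq_nat_nat_iff inj_on_def)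
  have lt: "2 powr (- \<epsilon>) < 1" using e powr_less_mono[of "-\<epsilon>" 0 2] by simp
  have "(\<Sum>j\<in>F. 2 powr (- \<epsilon> * real_of_int (h j))) = (\<Sum>j\<in>F. (2 powr (- \<epsilon>)) ^ nat (h j))"
    using F(3) by (intro sum.cong) (auto simp: powr_powr powr_realpow[symmetric])
  also have "\<dots> = (\<Sum>n\<in>(\<lambda>j. nat (h j)) ` F. (2 powr (- \<epsilon>)) ^ n)"
    by (simp add: sum.reindex[OF inj])
  also have "\<dots> \<le> (\<Sum>n. (2 powr (- \<epsilon>)) ^ n)"
    using F(1) lt by (intro sum_le_suminf summable_geometric) auto
  also have "\<dots> = 1 / (1 - 2 powr (- \<epsilon>))"
    using lt by (intro suminf_geometric) auto
  finally show ?thesis .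
qed

text \<open>Matrices between wavelet indices \<open>l\<close> of all levels in \<open>{j0..m}\<close> and scaling function indices
  \<open>k \<in> D\<close> of the single level \<open>m\<close>. The decay is measured on the coarser scale: \<open>2\<^bsup>-(m-j)\<^esup> k\<close> is
  the position of \<open>k\<close> in units of the grid of level \<open>j\<close>.\<close>

definition almost_diagonal ::
    "real \<Rightarrow> real \<Rightarrow> int \<Rightarrow> int \<Rightarrow> (int \<Rightarrow> index set) \<Rightarrow> index set \<Rightarrow> (index \<Rightarrow> index \<Rightarrow> real) \<Rightarrow> bool" where
  "almost_diagonal \<alpha> C j0 m N D b \<longleftrightarrow>
     (\<forall>j\<in>{j0..m}. finite (N j) \<and> (\<forall>l\<in>N j. fst l = j)) \<and> finite D \<and> (\<forall>k\<in>D. fst k = m) \<and>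
     (\<forall>j\<in>{j0..m}. \<forall>l\<in>N j. \<forall>k\<in>D. \<bar>b l k\<bar> \<le> C * 2 powr (- (real_of_int (m - j) / 2)) *
        poly_decay \<alpha> (2 powr (- real_of_int (m - j)) * real_of_int (snd k) - real_of_int (snd l)))"

lemma almost_diagonal_powr:
  assumes ad: "almost_diagonal \<alpha> C j0 m N D b" and \<rho>: "0 < \<rho>" and C: "0 < C"
    and j: "j \<in> {j0..m}" "l \<in> N j" "k \<in> D"
  shows "\<bar>b l k\<bar> powr \<rho> \<le> C powr \<rho> * 2 powr (- (real_of_int (m - j) * \<rho> / 2)) *
           poly_decay (\<alpha> * \<rho>) (2 powr (- real_of_int (m - j)) * real_of_int (snd k) - real_of_int (snd l))"
proof -
  let ?t = "2 powr (- real_of_int (m - j)) * real_of_int (snd k) - real_of_int (snd l)"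
  have "\<bar>b l k\<bar> powr \<rho> \<le> (C * 2 powr (- (real_of_int (m - j) / 2)) * poly_decay \<alpha> ?t) powr \<rho>"
    using ad j \<rho> by (intro powr_mono2) (auto simp: almost_diagonal_def)
  also have "\<dots> = C powr \<rho> * 2 powr (- (real_of_int (m - j) * \<rho> / 2)) * poly_decay (\<alpha> * \<rho>) ?t"
    by (simp add: powr_mult powr_powr poly_decay_def)
  finally show ?thesis .
qed

text \<open>Over the fine indices \<open>k\<close>, about \<open>2\<^bsup>d\<^esup>\<close> entries are of full size \<open>2\<^bsup>-d/2\<^esup>\<close>, where
  \<open>d = m - j\<close>; over the coarse indices \<open>l\<close> of one level, only boundedly many are.\<close>

lemma almost_diagonal_sums:
  assumes ad: "almost_diagonal \<alpha> C j0 m N D b" and \<rho>: "0 < \<rho>" "1 < \<alpha> * \<rho>" and C: "0 < C"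
    and A: "A = C powr \<rho> * (2 powr (\<alpha> * \<rho>) * (2 / (\<alpha> * \<rho> - 1)))" and j: "j \<in> {j0..m}"
  shows almost_diagonal_sum_fine:
        "l \<in> N j \<Longrightarrow> (\<Sum>k\<in>D. \<bar>b l k\<bar> powr \<rho>) \<le> A * 2 powr (real_of_int (m - j) * (1 - \<rho> / 2))"
    and almost_diagonal_sum_coarse:
        "k \<in> D \<Longrightarrow> (\<Sum>l\<in>N j. \<bar>b l k\<bar> powr \<rho>) \<le> A * 2 powr (- (real_of_int (m - j) * \<rho> / 2))"
proof -
  let ?d = "real_of_int (m - j)"
  define h where "h = 2 powr (- ?d)"
  define c where "c = C powr \<rho> * 2 powr (- (?d * \<rho> / 2))"
  have d: "0 \<le> ?d" using j by auto
  have h: "0 < h" "h \<le> 1" using d powr_mono[of "- ?d" 0 2] by (auto simp: h_def)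
  have c: "0 < c" using C by (simp add: c_def)
  have D: "finite D" "inj_on snd D" and N: "finite (N j)" "inj_on snd (N j)"
    using ad j by (auto simp: almost_diagonal_def inj_on_def prod_eq_iff)
  { assume l: "l \<in> N j"
    have "(\<Sum>k\<in>D. \<bar>b l k\<bar> powr \<rho>) \<le> (\<Sum>k\<in>D. c * poly_decay (\<alpha> * \<rho>) (h * real_of_int (snd k) - real_of_int (snd l)))"
      using almost_diagonal_powr[OF ad \<rho>(1) C j l] by (intro sum_mono) (simp add: c_def h_def)
    also have "\<dots> = c * (\<Sum>k\<in>snd ` D. poly_decay (\<alpha> * \<rho>) (h * real_of_int k - real_of_int (snd l)))"
      by (simp add: sum_distrib_left sum.reindex[OF D(2)])
    also have "\<dots> \<le> c * (2 powr (\<alpha> * \<rho>) * (2 / (\<alpha> * \<rho> - 1)) / h)"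
      using c h D by (intro mult_left_mono sum_poly_decay_le \<rho>) auto
    also have "\<dots> = A * (2 powr (- (?d * \<rho> / 2)) / h)" by (simp add: A c_def)
    also have "2 powr (- (?d * \<rho> / 2)) / h = 2 powr (?d * (1 - \<rho> / 2))"
      by (simp add: h_def powr_diff[symmetric] algebra_simps)
    finally show "(\<Sum>k\<in>D. \<bar>b l k\<bar> powr \<rho>) \<le> A * 2 powr (?d * (1 - \<rho> / 2))" . }
  { assume k: "k \<in> D"
    have "(\<Sum>l\<in>N j. \<bar>b l k\<bar> powr \<rho>) \<le> (\<Sum>l\<in>N j. c * poly_decay (\<alpha> * \<rho>) (1 * real_of_int (snd l) - h * real_of_int (snd k)))"
    proof (intro sum_mono)
      fix l assume l: "l \<in> N j"
      have "poly_decay (\<alpha> * \<rho>) (h * real_of_int (snd k) - real_of_int (snd l)) =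
            poly_decay (\<alpha> * \<rho>) (1 * real_of_int (snd l) - h * real_of_int (snd k))"
        by (subst poly_decay_uminus[symmetric]) simp
      then show "\<bar>b l k\<bar> powr \<rho> \<le> c * poly_decay (\<alpha> * \<rho>) (1 * real_of_int (snd l) - h * real_of_int (snd k))"
        using almost_diagonal_powr[OF ad \<rho>(1) C j l k] by (simp add: c_def h_def)
    qed
    also have "\<dots> = c * (\<Sum>l\<in>snd ` N j. poly_decay (\<alpha> * \<rho>) (1 * real_of_int l - h * real_of_int (snd k)))"
      by (simp add: sum_distrib_left sum.reindex[OF N(2)])
    also have "\<dots> \<le> c * (2 powr (\<alpha> * \<rho>) * (2 / (\<alpha> * \<rho> - 1)) / 1)"
      using c N by (intro mult_left_mono sum_poly_decay_le \<rho>) auto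
    also have "\<dots> = A * 2 powr (- (?d * \<rho> / 2))" by (simp add: A c_def)
    finally show "(\<Sum>l\<in>N j. \<bar>b l k\<bar> powr \<rho>) \<le> A * 2 powr (- (?d * \<rho> / 2))" . }
qed

lemma almost_diagonal_UN:
  assumes "almost_diagonal \<alpha> C j0 m N D b"
  shows "(\<Sum>l\<in>(\<Union>j\<in>{j0..m}. N j). f l) = (\<Sum>j\<in>{j0..m}. \<Sum>l\<in>N j. f l)"
  using assms by (intro sum.UNION_disjoint) (auto simp: almost_diagonal_def, metis atLeastAtMost_iff fst_conv)

text \<open>The column weights are constant, while the row bound grows with the level difference \<open>d\<close> like
  \<open>2\<^bsup>d(1 - \<rho>/2)\<^esup>\<close>. A column then collects from level \<open>j\<close> the amount
  \<open>2\<^bsup>d\<sigma>(1 - \<rho>/2) - d\<rho>/2\<^esup> = 2\<^bsup>-d(\<tau>/2 - \<sigma>)\<^esup>\<close>, which is summable over the levels because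
  \<open>\<sigma> < \<tau>/2\<close> for \<open>0 < \<tau> < 2\<close>.\<close>

lemma schur_bound_fine_to_coarse:
  assumes \<tau>: "0 < \<tau>" "\<tau> < 2" and \<alpha>: "1 < \<alpha> * schur_rho \<tau>" and C: "0 < C"
  shows "\<exists>K>0. \<forall>m N D b. almost_diagonal \<alpha> C j0 m N D b \<longrightarrow>
           (\<exists>w R. schur_bound \<tau> (\<Union>j\<in>{j0..m}. N j) D b w R K)"
proof -
  define \<rho> \<sigma> where "\<rho> = schur_rho \<tau>" and "\<sigma> = schur_sigma \<tau>"
  note ex = schur_exponents[OF \<tau>(1), folded \<rho>_def \<sigma>_def]
  define A where "A = C powr \<rho> * (2 powr (\<alpha> * \<rho>) * (2 / (\<alpha> * \<rho> - 1)))"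
  have A: "0 < A" using \<alpha> C by (simp add: A_def \<rho>_def)
  \<comment> \<open>the rate at which the contributions to a column decay in the level difference\<close>
  define \<epsilon> where "\<epsilon> = \<tau> / 2 - \<sigma>"
  have \<epsilon>: "0 < \<epsilon>" using \<tau> by (auto simp: \<epsilon>_def \<sigma>_def schur_sigma_def max_def)
  have exponent: "d * (1 - \<rho> / 2) * \<sigma> + - (d * \<rho> / 2) = - \<epsilon> * d" for d
  proof -
    have "d * (1 - \<rho> / 2) * \<sigma> + - (d * \<rho> / 2) = d * (\<sigma> - \<rho> * (1 + \<sigma>) / 2)"
      by (simp add: field_simps)
    also have "\<dots> = - \<epsilon> * d" unfolding ex(3) \<epsilon>_def by (simp add: algebra_simps)
    finally show ?thesis .
  qed
  define K where "K = A powr \<sigma> * A / (1 - 2 powr (- \<epsilon>))"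
  have "2 powr (- \<epsilon>) < 1" using \<epsilon> powr_less_mono[of "-\<epsilon>" 0 2] by simp
  then have K: "0 < K" using A by (simp add: K_def)
  show ?thesis
  proof (intro exI[of _ K] conjI allI impI K)
    fix m N D b assume ad: "almost_diagonal \<alpha> C j0 m N D b"
    define R where "R = (\<lambda>l::index. A * 2 powr (real_of_int (m - fst l) * (1 - \<rho> / 2)))"
    have "schur_bound \<tau> (\<Union>j\<in>{j0..m}. N j) D b (\<lambda>_. 1) R K"
      unfolding schur_bound_def \<rho>_def[symmetric] \<sigma>_def[symmetric]
    proof (intro conjI ballI)
      show "finite (\<Union>j\<in>{j0..m}. N j)" "finite D" using ad by (auto simp: almost_diagonal_def)
      fix l assume "l \<in> (\<Union>j\<in>{j0..m}. N j)"
      then obtain j where j: "j \<in> {j0..m}" "l \<in> N j" by auto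
      then have "fst l = j" using ad by (auto simp: almost_diagonal_def)
      then show "(\<Sum>k\<in>D. \<bar>b l k\<bar> powr \<rho> * 1) \<le> R l"
        using almost_diagonal_sum_fine[OF ad ex(1) _ C A_def j] \<alpha> by (simp add: R_def \<rho>_def)
    next
      fix k assume k: "k \<in> D"
      have "(\<Sum>l\<in>(\<Union>j\<in>{j0..m}. N j). R l powr \<sigma> * \<bar>b l k\<bar> powr \<rho>) =
            (\<Sum>j\<in>{j0..m}. \<Sum>l\<in>N j. R l powr \<sigma> * \<bar>b l k\<bar> powr \<rho>)"
        by (rule almost_diagonal_UN[OF ad])
      also have "\<dots> \<le> (\<Sum>j\<in>{j0..m}. A powr \<sigma> * A * 2 powr (- \<epsilon> * real_of_int (m - j)))"
      proof (intro sum_mono)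
        fix j assume j: "j \<in> {j0..m}"
        let ?d = "real_of_int (m - j)"
        have "(\<Sum>l\<in>N j. R l powr \<sigma> * \<bar>b l k\<bar> powr \<rho>) =
              (\<Sum>l\<in>N j. (A powr \<sigma> * 2 powr (?d * (1 - \<rho> / 2) * \<sigma>)) * \<bar>b l k\<bar> powr \<rho>)"
          using ad j A by (intro sum.cong) (auto simp: almost_diagonal_def R_def powr_mult powr_powr)
        also have "\<dots> \<le> (A powr \<sigma> * 2 powr (?d * (1 - \<rho> / 2) * \<sigma>)) * (A * 2 powr (- (?d * \<rho> / 2)))"
          unfolding sum_distrib_left[symmetric]
          using almost_diagonal_sum_coarse[OF ad ex(1) _ C A_def j k] \<alpha>
          by (intro mult_left_mono) (auto simp: \<rho>_def)
        also have "\<dots> = A powr \<sigma> * A * (2 powr (?d * (1 - \<rho> / 2) * \<sigma> + - (?d * \<rho> / 2)))"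
          by (simp only: powr_add mult_ac)
        also have "?d * (1 - \<rho> / 2) * \<sigma> + - (?d * \<rho> / 2) = - \<epsilon> * ?d" by (rule exponent)
        finally show "(\<Sum>l\<in>N j. R l powr \<sigma> * \<bar>b l k\<bar> powr \<rho>) \<le> A powr \<sigma> * A * 2 powr (- \<epsilon> * ?d)" .
      qed
      also have "\<dots> \<le> A powr \<sigma> * A * (1 / (1 - 2 powr (- \<epsilon>)))"
        unfolding sum_distrib_left[symmetric] using A \<epsilon>
        by (intro mult_left_mono sum_geometric_int_le) (auto simp: inj_on_def)
      finally show "(\<Sum>l\<in>(\<Union>j\<in>{j0..m}. N j). R l powr \<sigma> * \<bar>b l k\<bar> powr \<rho>) \<le> K * 1 powr \<sigma>"
        by (simp add: K_def)
    qed (use A in \<open>auto simp: R_def\<close>)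
    then show "\<exists>w R. schur_bound \<tau> (\<Union>j\<in>{j0..m}. N j) D b w R K" by blast
  qed
qed

text \<open>From coarse to fine the operator norm from level \<open>j\<close> alone is \<open>2\<^bsup>(m-j)(1 - \<tau>/2)\<^esup>\<close> (for
  \<open>\<tau>\<close>-th powers). The weight \<open>w\<^sub>l = 2\<^bsup>-j/\<tau>\<^esup>\<close> sums these contributions without a loss in \<open>m\<close>:
  it decays faster than \<open>2\<^bsup>-j\<rho>/2\<^esup>\<close>, so that the row sums are dominated by the coarsest level, and
  slowly enough for the exponent of \<open>2\<^bsup>j\<^esup>\<close> left in the column condition to be at most zero.\<close>

lemma schur_bound_coarse_to_fine:
  assumes \<tau>: "0 < \<tau>" "\<tau> < 2" and \<alpha>: "1 < \<alpha> * schur_rho \<tau>" and C: "0 < C"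
  shows "\<exists>K>0. \<forall>m N D b. almost_diagonal \<alpha> C j0 m N D b \<longrightarrow>
           (\<exists>w R. schur_bound \<tau> D (\<Union>j\<in>{j0..m}. N j) (\<lambda>k l. b l k) w R
                    (K * 2 powr (real_of_int m * (1 - \<tau> / 2))))"
proof -
  define \<rho> \<sigma> where "\<rho> = schur_rho \<tau>" and "\<sigma> = schur_sigma \<tau>"
  note ex = schur_exponents[OF \<tau>(1), folded \<rho>_def \<sigma>_def]
  define A where "A = C powr \<rho> * (2 powr (\<alpha> * \<rho>) * (2 / (\<alpha> * \<rho> - 1)))"
  have A: "0 < A" using \<alpha> C by (simp add: A_def \<rho>_def)
  \<comment> \<open>decay rate in \<open>j\<close> of the weighted row sums\<close>
  define \<delta> where "\<delta> = 1 / \<tau> - \<rho> / 2"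
  have \<delta>: "0 < \<delta>"
  proof -
    have "\<rho> / 2 \<le> 1 / 2" by (simp add: \<rho>_def schur_rho_def)
    also have "\<dots> < 1 / \<tau>" using \<tau> by (simp add: field_simps)
    finally show ?thesis by (simp add: \<delta>_def)
  qed
  \<comment> \<open>minus the exponent of \<open>2\<^bsup>j\<^esup>\<close> that remains in the column condition\<close>
  define \<eta> where "\<eta> = 1 - \<rho> / 2 - \<sigma> / \<tau>"
  have \<eta>: "0 \<le> \<eta>"
    using \<tau> by (auto simp: \<eta>_def \<rho>_def \<sigma>_def schur_rho_def schur_sigma_def min_def max_def field_simps)
  define G where "G = 2 powr (- \<delta> * real_of_int j0) * (1 / (1 - 2 powr (- \<delta>)))"
  have "2 powr (- \<delta>) < 1" using \<delta> powr_less_mono[of "-\<delta>" 0 2] by simp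
  then have G: "0 < G" by (simp add: G_def)
  define K where "K = (A * G) powr \<sigma> * A * 2 powr (- \<eta> * real_of_int j0)"
  have K: "0 < K" using A G by (simp add: K_def)
  show ?thesis
  proof (intro exI[of _ K] conjI allI impI K)
    fix m N D b assume ad: "almost_diagonal \<alpha> C j0 m N D b"
    define R where "R = A * G * 2 powr (- (real_of_int m * \<rho> / 2))"
    define w where "w = (\<lambda>l::index. 2 powr (- (real_of_int (fst l) / \<tau>)))"
    have "schur_bound \<tau> D (\<Union>j\<in>{j0..m}. N j) (\<lambda>k l. b l k) w (\<lambda>_. R) (K * 2 powr (real_of_int m * (1 - \<tau> / 2)))"
      unfolding schur_bound_def \<rho>_def[symmetric] \<sigma>_def[symmetric]
    proof (intro conjI ballI)
      show "finite (\<Union>j\<in>{j0..m}. N j)" "finite D" using ad by (auto simp: almost_diagonal_def)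
    next
      fix k assume k: "k \<in> D"
      have "(\<Sum>l\<in>(\<Union>j\<in>{j0..m}. N j). \<bar>b l k\<bar> powr \<rho> * w l) =
            (\<Sum>j\<in>{j0..m}. \<Sum>l\<in>N j. \<bar>b l k\<bar> powr \<rho> * w l)"
        by (rule almost_diagonal_UN[OF ad])
      also have "\<dots> \<le> (\<Sum>j\<in>{j0..m}. A * 2 powr (- (real_of_int m * \<rho> / 2)) * 2 powr (- \<delta> * real_of_int j0) *
                          2 powr (- \<delta> * real_of_int (j - j0)))"
      proof (intro sum_mono)
        fix j assume j: "j \<in> {j0..m}"
        let ?d = "real_of_int (m - j)"
        have "(\<Sum>l\<in>N j. \<bar>b l k\<bar> powr \<rho> * w l) = (\<Sum>l\<in>N j. \<bar>b l k\<bar> powr \<rho>) * 2 powr (- (real_of_int j / \<tau>))"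
          unfolding sum_distrib_right
          using ad j by (intro sum.cong) (auto simp: almost_diagonal_def w_def)
        also have "\<dots> \<le> (A * 2 powr (- (?d * \<rho> / 2))) * 2 powr (- (real_of_int j / \<tau>))"
          using almost_diagonal_sum_coarse[OF ad ex(1) _ C A_def j k] \<alpha>
          by (intro mult_right_mono) (auto simp: \<rho>_def)
        also have "\<dots> = A * 2 powr (- (?d * \<rho> / 2) - real_of_int j / \<tau>)"
          by (simp add: powr_add[symmetric])
        also have "- (?d * \<rho> / 2) - real_of_int j / \<tau> =
            (- (real_of_int m * \<rho> / 2)) + (- \<delta> * real_of_int j0) + (- \<delta> * real_of_int (j - j0))"
          using \<tau> by (simp add: \<delta>_def field_simps)
        finally show "(\<Sum>l\<in>N j. \<bar>b l k\<bar> powr \<rho> * w l) \<le>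
           A * 2 powr (- (real_of_int m * \<rho> / 2)) * 2 powr (- \<delta> * real_of_int j0) * 2 powr (- \<delta> * real_of_int (j - j0))"
          by (simp only: powr_add mult.assoc)
      qed
      also have "\<dots> \<le> A * 2 powr (- (real_of_int m * \<rho> / 2)) * 2 powr (- \<delta> * real_of_int j0) * (1 / (1 - 2 powr (- \<delta>)))"
        unfolding sum_distrib_left[symmetric] using A \<delta>
        by (intro mult_left_mono sum_geometric_int_le) (auto simp: inj_on_def)
      finally show "(\<Sum>l\<in>(\<Union>j\<in>{j0..m}. N j). \<bar>b l k\<bar> powr \<rho> * w l) \<le> R"
        by (simp add: R_def G_def mult_ac)
    next
      fix l assume "l \<in> (\<Union>j\<in>{j0..m}. N j)"
      then obtain j where j: "j \<in> {j0..m}" "l \<in> N j" by auto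
      then have lj: "fst l = j" using ad by (auto simp: almost_diagonal_def)
      let ?d = "real_of_int (m - j)"
      have R\<sigma>: "R powr \<sigma> = (A * G) powr \<sigma> * 2 powr (- (real_of_int m * \<rho> / 2) * \<sigma>)"
        using A G by (simp add: R_def powr_mult powr_powr)
      have "(\<Sum>k\<in>D. R powr \<sigma> * \<bar>b l k\<bar> powr \<rho>) \<le> R powr \<sigma> * (A * 2 powr (?d * (1 - \<rho> / 2)))"
        unfolding sum_distrib_left[symmetric]
        using almost_diagonal_sum_fine[OF ad ex(1) _ C A_def j] \<alpha>
        by (intro mult_left_mono) (auto simp: \<rho>_def)
      also have "\<dots> =
                 (A * G) powr \<sigma> * A * 2 powr (- (real_of_int m * \<rho> / 2) * \<sigma> + ?d * (1 - \<rho> / 2))"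
        by (simp only: R\<sigma> powr_add mult_ac)
      also have "- (real_of_int m * \<rho> / 2) * \<sigma> + ?d * (1 - \<rho> / 2) =
          real_of_int m * (1 - \<rho> * (1 + \<sigma>) / 2) + (- \<eta> * real_of_int j) + (- (real_of_int j / \<tau>)) * \<sigma>"
        using \<tau> by (simp add: \<eta>_def field_simps)
      also have "\<dots> = real_of_int m * (1 - \<tau> / 2) + (- \<eta> * real_of_int j) + (- (real_of_int j / \<tau>)) * \<sigma>"
        by (simp only: ex(3))
      also have "(A * G) powr \<sigma> * A * 2 powr \<dots> \<le>
          (A * G) powr \<sigma> * A * 2 powr (real_of_int m * (1 - \<tau> / 2) + (- \<eta> * real_of_int j0) + (- (real_of_int j / \<tau>)) * \<sigma>)"
      proof (intro mult_left_mono powr_mono)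
        have "\<eta> * real_of_int j0 \<le> \<eta> * real_of_int j" using j \<eta> by (intro mult_left_mono) auto
        then show "real_of_int m * (1 - \<tau> / 2) + (- \<eta> * real_of_int j) + (- (real_of_int j / \<tau>)) * \<sigma>
          \<le> real_of_int m * (1 - \<tau> / 2) + (- \<eta> * real_of_int j0) + (- (real_of_int j / \<tau>)) * \<sigma>"
          by simp
      qed (use A in auto)
      also have "\<dots> = K * 2 powr (real_of_int m * (1 - \<tau> / 2)) * w l powr \<sigma>"
        unfolding K_def w_def lj powr_powr powr_add by (simp only: mult_ac)
      finally show "(\<Sum>k\<in>D. R powr \<sigma> * \<bar>b l k\<bar> powr \<rho>) \<le> K * 2 powr (real_of_int m * (1 - \<tau> / 2)) * w l powr \<sigma>" .
    qed (use A G in \<open>auto simp: R_def w_def\<close>)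
    then show "\<exists>w R. schur_bound \<tau> D (\<Union>j\<in>{j0..m}. N j) (\<lambda>k l. b l k) w R
                    (K * 2 powr (real_of_int m * (1 - \<tau> / 2)))" by blast
  qed
qed

section \<open>Finite biorthogonal expansions\<close>

lemma L2_unit_iff:
  "f \<in> L2_unit \<longleftrightarrow> (\<lambda>x. indicator {0..1} x * f x) \<in> borel_measurable borel \<and>
                   integrable lborel (\<lambda>x. (indicator {0..1} x * f x)\<^sup>2)"
proof -
  have "(\<lambda>x. indicator {0..1} x *\<^sub>R (f x)\<^sup>2) = (\<lambda>x. (indicator {0..1} x * f x)\<^sup>2)"
    by (auto simp: indicator_def fun_eq_iff)
  then show ?thesis
    by (simp add: L2_unit_def set_borel_measurable_def set_integrable_def)
qed

lemma L2_unit_mult_integrable: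
  assumes "f \<in> L2_unit" "g \<in> L2_unit"
  shows "integrable lborel (\<lambda>x. indicator {0..1} x * (f x * g x))"
proof (rule Bochner_Integration.integrable_bound)
  let ?f = "\<lambda>x. indicator {0..1} x * f x" and ?g = "\<lambda>x. indicator {0..1} x * g x"
  have [measurable]: "?f \<in> borel_measurable borel" "?g \<in> borel_measurable borel"
    and i: "integrable lborel (\<lambda>x. (?f x)\<^sup>2)" "integrable lborel (\<lambda>x. (?g x)\<^sup>2)"
    using assms by (auto simp: L2_unit_iff)
  show "integrable lborel (\<lambda>x. (?f x)\<^sup>2 + (?g x)\<^sup>2)" using i by simp
  have eq: "(\<lambda>x. indicator {0..1} x * (f x * g x)) = (\<lambda>x. ?f x * ?g x)"
    by (auto simp: indicator_def)
  show "(\<lambda>x. indicator {0..1} x * (f x * g x)) \<in> borel_measurable lborel"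
    unfolding eq by measurable
  show "AE x in lborel. norm (indicator {0..1} x * (f x * g x)) \<le> norm ((?f x)\<^sup>2 + (?g x)\<^sup>2)"
  proof (intro AE_I2)
    fix x
    have "2 * \<bar>a * b\<bar> \<le> a\<^sup>2 + b\<^sup>2" for a b :: real
      using sum_squares_bound[of "\<bar>a\<bar>" "\<bar>b\<bar>"] by (simp add: abs_mult)
    then have "2 * \<bar>?f x * ?g x\<bar> \<le> (?f x)\<^sup>2 + (?g x)\<^sup>2" .
    moreover have "0 \<le> \<bar>?f x * ?g x\<bar>" by (rule abs_ge_zero)
    ultimately have "\<bar>?f x * ?g x\<bar> \<le> \<bar>(?f x)\<^sup>2 + (?g x)\<^sup>2\<bar>" by linarith
    then show "norm (indicator {0..1} x * (f x * g x)) \<le> norm ((?f x)\<^sup>2 + (?g x)\<^sup>2)"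
      unfolding fun_cong[OF eq, of x] real_norm_def .
  qed
qed

lemma L2_unit_add:
  assumes "f \<in> L2_unit" "g \<in> L2_unit"
  shows "(\<lambda>x. f x + g x) \<in> L2_unit"
proof -
  let ?f = "\<lambda>x. indicator {0..1} x * f x" and ?g = "\<lambda>x. indicator {0..1} x * g x"
  have [measurable]: "?f \<in> borel_measurable borel" "?g \<in> borel_measurable borel"
    and i: "integrable lborel (\<lambda>x. (?f x)\<^sup>2)" "integrable lborel (\<lambda>x. (?g x)\<^sup>2)"
    using assms by (auto simp: L2_unit_iff)
  have eq: "(\<lambda>x. indicator {0..1} x * (f x + g x)) = (\<lambda>x. ?f x + ?g x)"
    by (auto simp: algebra_simps)
  have eq2: "(\<lambda>x. (indicator {0..1} x * (f x + g x))\<^sup>2) =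
      (\<lambda>x. (?f x)\<^sup>2 + (?g x)\<^sup>2 + 2 * (indicator {0..1} x * (f x * g x)))"
    by (auto simp: fun_eq_iff indicator_def power2_eq_square algebra_simps)
  show ?thesis
    unfolding L2_unit_iff eq eq2 using i L2_unit_mult_integrable[OF assms] by simp
qed

lemma L2_unit_cmult:
  assumes "f \<in> L2_unit"
  shows "(\<lambda>x. c * f x) \<in> L2_unit"
proof -
  let ?f = "\<lambda>x. indicator {0..1} x * f x"
  have [measurable]: "?f \<in> borel_measurable borel" and i: "integrable lborel (\<lambda>x. (?f x)\<^sup>2)"
    using assms by (auto simp: L2_unit_iff)
  have eq: "(\<lambda>x. indicator {0..1} x * (c * f x)) = (\<lambda>x. c * ?f x)"
    by (simp add: mult.left_commute)
  have eq2: "(\<lambda>x. (indicator {0..1} x * (c * f x))\<^sup>2) = (\<lambda>x. c\<^sup>2 * (?f x)\<^sup>2)"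
    by (simp add: power_mult_distrib mult.left_commute)
  show ?thesis
    unfolding L2_unit_iff eq2 eq using i by simp
qed

lemma L2_unit_zero: "(\<lambda>x. 0) \<in> L2_unit"
  by (simp add: L2_unit_iff)

lemma L2_unit_sum:
  assumes "finite F" "\<And>i. i \<in> F \<Longrightarrow> f i \<in> L2_unit"
  shows "(\<lambda>x. \<Sum>i\<in>F. a i * f i x) \<in> L2_unit"
  using assms by (induction F) (auto intro!: L2_unit_add L2_unit_cmult L2_unit_zero)

lemma L2_inner_alt: "L2_inner f g = (\<integral>x. indicator {0..1} x * (f x * g x) \<partial>lborel)"
  by (simp add: L2_inner_def set_lebesgue_integral_def)

lemma L2_inner_commute: "L2_inner f g = L2_inner g f"
  by (simp add: L2_inner_def mult.commute)

lemma L2_inner_cong: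
  assumes "f \<in> L2_unit" "f' \<in> L2_unit" "g \<in> L2_unit" "L2_eq f f'"
  shows "L2_inner f g = L2_inner f' g"
  unfolding L2_inner_alt
  by (intro integral_cong_AE borel_measurable_integrable L2_unit_mult_integrable assms)
    (use assms(4) in \<open>auto simp: L2_eq_def indicator_def elim!: eventually_mono\<close>)

lemma L2_inner_sum_left:
  assumes "finite F" "\<And>i. i \<in> F \<Longrightarrow> f i \<in> L2_unit" "g \<in> L2_unit"
  shows "L2_inner (\<lambda>x. \<Sum>i\<in>F. a i * f i x) g = (\<Sum>i\<in>F. a i * L2_inner (f i) g)"
proof -
  have "L2_inner (\<lambda>x. \<Sum>i\<in>F. a i * f i x) g =
        (\<integral>x. (\<Sum>i\<in>F. a i * (indicator {0..1} x * (f i x * g x))) \<partial>lborel)"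
    by (simp add: L2_inner_alt sum_distrib_left sum_distrib_right mult_ac)
  also have "\<dots> = (\<Sum>i\<in>F. a i * L2_inner (f i) g)"
    using assms by (subst Bochner_Integration.integral_sum)
      (auto simp: L2_inner_alt intro!: L2_unit_mult_integrable)
  finally show ?thesis .
qed

lemma L2_eq_trans: "L2_eq f g \<Longrightarrow> L2_eq g h \<Longrightarrow> L2_eq f h"
  unfolding L2_eq_def by (elim AE_mp) auto

lemma L2_eq_add: "L2_eq f f' \<Longrightarrow> L2_eq g g' \<Longrightarrow> L2_eq (\<lambda>x. f x + g x) (\<lambda>x. f' x + g' x)"
  unfolding L2_eq_def by (elim AE_mp) auto

lemma L2_span_finite:
  assumes "finite I"
  shows "g \<in> L2_span I f \<longleftrightarrow> g \<in> L2_unit \<and> (\<exists>a. L2_eq g (\<lambda>x. \<Sum>i\<in>I. a i * f i x))"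
proof
  assume "g \<in> L2_span I f"
  then obtain F a where F: "g \<in> L2_unit" "F \<subseteq> I" "L2_eq g (\<lambda>x. \<Sum>i\<in>F. a i * f i x)"
    by (auto simp: L2_span_def)
  have "(\<lambda>x. \<Sum>i\<in>F. a i * f i x) = (\<lambda>x. \<Sum>i\<in>I. (if i \<in> F then a i else 0) * f i x)"
    using F(2) assms by (intro ext sum.mono_neutral_cong_left) auto
  with F show "g \<in> L2_unit \<and> (\<exists>a. L2_eq g (\<lambda>x. \<Sum>i\<in>I. a i * f i x))"
    by (intro conjI exI[of _ "\<lambda>i. if i \<in> F then a i else 0"]) auto
qed (use assms in \<open>auto simp: L2_span_def\<close>)

lemma L2_span_mono: "I \<subseteq> J \<Longrightarrow> L2_span I f \<subseteq> L2_span J f"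
  unfolding L2_span_def by blast

lemma L2_span_add:
  assumes "finite I" "v \<in> L2_span I f" "w \<in> L2_span I f" "g \<in> L2_unit" "L2_eq g (\<lambda>x. v x + w x)"
  shows "g \<in> L2_span I f"
proof -
  obtain a b where "L2_eq v (\<lambda>x. \<Sum>i\<in>I. a i * f i x)" "L2_eq w (\<lambda>x. \<Sum>i\<in>I. b i * f i x)"
    using assms by (auto simp: L2_span_finite)
  then have "L2_eq g (\<lambda>x. (\<Sum>i\<in>I. a i * f i x) + (\<Sum>i\<in>I. b i * f i x))"
    by (intro L2_eq_trans[OF assms(5)] L2_eq_add)
  then have "L2_eq g (\<lambda>x. \<Sum>i\<in>I. (a i + b i) * f i x)"
    by (simp add: sum.distrib distrib_right)
  with assms show ?thesis by (subst L2_span_finite) (auto intro!: exI[of _ "\<lambda>i. a i + b i"])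
qed

lemma L2_span_cong:
  assumes "\<And>i x. i \<in> I \<Longrightarrow> x \<in> {0..1} \<Longrightarrow> f i x = f' i x"
  shows "L2_span I f = L2_span I f'"
proof -
  have "L2_eq g (\<lambda>x. \<Sum>i\<in>F. a i * f i x) \<longleftrightarrow> L2_eq g (\<lambda>x. \<Sum>i\<in>F. a i * f' i x)" if "F \<subseteq> I" for g F a
    unfolding L2_eq_def
    by (intro arg_cong[where f="\<lambda>P. eventually P (ae_filter lborel)"] ext)
       (use that assms in \<open>auto intro!: sum.cong simp: subset_iff\<close>)
  then show ?thesis unfolding L2_span_def by blast
qed

lemma L2_span_base:
  assumes "i \<in> I" "f i \<in> L2_unit"
  shows "f i \<in> L2_span I f"
  using assms unfolding L2_span_def
  by (auto intro!: exI[of _ "{i}"] exI[of _ "\<lambda>_. 1"] simp: L2_eq_def)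

lemma L2_span_zero: "(\<lambda>x. 0) \<in> L2_span I f"
  unfolding L2_span_def by (auto intro!: exI[of _ "{}"] L2_unit_zero simp: L2_eq_def)

text \<open>Membership in the span provides some coefficients; pairing with the dual system identifies
  them.\<close>

lemma biorthogonal_expansion:
  assumes "finite I" "g \<in> L2_span I f"
    and L2: "\<And>i. i \<in> I \<Longrightarrow> f i \<in> L2_unit" "\<And>i. i \<in> I \<Longrightarrow> h i \<in> L2_unit"
    and bio: "\<And>i i'. i \<in> I \<Longrightarrow> i' \<in> I \<Longrightarrow> L2_inner (f i) (h i') = (if i = i' then 1 else 0)"
  shows "L2_eq g (\<lambda>x. \<Sum>i\<in>I. L2_inner g (h i) * f i x)"
proof -
  obtain a where g: "g \<in> L2_unit" and a: "L2_eq g (\<lambda>x. \<Sum>i\<in>I. a i * f i x)"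
    using assms by (auto simp: L2_span_finite)
  have "L2_inner g (h i') = a i'" if "i' \<in> I" for i'
  proof -
    have "L2_inner g (h i') = L2_inner (\<lambda>x. \<Sum>i\<in>I. a i * f i x) (h i')"
      by (intro L2_inner_cong g L2_unit_sum L2 that a assms(1))
    also have "\<dots> = (\<Sum>i\<in>I. a i * L2_inner (f i) (h i'))"
      by (intro L2_inner_sum_left L2 that assms(1))
    also have "\<dots> = (\<Sum>i\<in>I. if i = i' then a i else 0)"
      by (intro sum.cong) (auto simp: bio that)
    also have "\<dots> = a i'" using that assms(1) by simp
    finally show ?thesis .
  qed
  then have "(\<lambda>x. \<Sum>i\<in>I. L2_inner g (h i) * f i x) = (\<lambda>x. \<Sum>i\<in>I. a i * f i x)"
    by (intro ext sum.cong) auto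
  with a show ?thesis by simp
qed

lemma multiresolutionD:
  assumes "multiresolution j0 \<Delta> N \<phi> \<psi>"
  shows "\<And>j. j0 \<le> j \<Longrightarrow> finite (\<Delta> j)" "\<And>j. j0 \<le> j \<Longrightarrow> finite (N j)"
    "\<And>j l. j0 \<le> j \<Longrightarrow> l \<in> \<Delta> j \<Longrightarrow> fst l = j" "\<And>j l. j0 \<le> j \<Longrightarrow> l \<in> N j \<Longrightarrow> fst l = j"
    "\<And>j l. j0 \<le> j \<Longrightarrow> l \<in> \<Delta> j \<Longrightarrow> \<phi> l \<in> L2_unit" "\<And>j l. j0 \<le> j \<Longrightarrow> l \<in> N j \<Longrightarrow> \<psi> l \<in> L2_unit"
    "\<And>j. j0 \<le> j \<Longrightarrow> L2_span (\<Delta> j) \<phi> \<subseteq> L2_span (\<Delta> (j + 1)) \<phi>"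
    "\<And>j. j0 < j \<Longrightarrow> L2_direct_sum (L2_span (\<Delta> j) \<phi>) (L2_span (\<Delta> (j - 1)) \<phi>) (L2_span (N j) \<psi>)"
    "N j0 = \<Delta> j0" "\<And>l x. l \<in> N j0 \<Longrightarrow> x \<in> {0..1} \<Longrightarrow> \<psi> l x = \<phi> l x"
proof -
  note U = assms[unfolded multiresolution_def Let_def]
  have fin: "\<forall>j\<ge>j0. finite (\<Delta> j) \<and> finite (N j)" and lev: "\<forall>j\<ge>j0. \<forall>l \<in> \<Delta> j \<union> N j. fst l = j"
    and rs: "\<exists>c C. \<forall>j\<ge>j0. riesz_system c C (\<Delta> j) \<phi>"
    and nest: "\<forall>j\<ge>j0. L2_span (\<Delta> j) \<phi> \<subseteq> L2_span (\<Delta> (j + 1)) \<phi>"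
    and ds: "\<forall>j>j0. L2_direct_sum (L2_span (\<Delta> j) \<phi>) (L2_span (\<Delta> (j - 1)) \<phi>) (L2_span (N j) \<psi>)"
    and base: "N j0 = \<Delta> j0" "\<forall>l\<in>N j0. \<forall>x\<in>{0..1}. \<psi> l x = \<phi> l x"
    and rb: "riesz_basis (\<Union>j\<in>{j0..}. N j) \<psi>"
    using U by simp_all
  show "finite (\<Delta> j)" "finite (N j)" if "j0 \<le> j" for j using fin that by auto
  show "fst l = j" if "j0 \<le> j" "l \<in> \<Delta> j" for j l using lev that by blast
  show "fst l = j" if "j0 \<le> j" "l \<in> N j" for j l using lev that by blast
  show "\<phi> l \<in> L2_unit" if "j0 \<le> j" "l \<in> \<Delta> j" for j l
    using rs that unfolding riesz_system_def by blast
  show "\<psi> l \<in> L2_unit" if "j0 \<le> j" "l \<in> N j" for j l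
  proof -
    have "l \<in> (\<Union>j\<in>{j0..}. N j)" using that by auto
    with rb show ?thesis unfolding riesz_basis_def riesz_system_def by blast
  qed
  show "L2_span (\<Delta> j) \<phi> \<subseteq> L2_span (\<Delta> (j + 1)) \<phi>" if "j0 \<le> j" for j using nest that by auto
  show "L2_direct_sum (L2_span (\<Delta> j) \<phi>) (L2_span (\<Delta> (j - 1)) \<phi>) (L2_span (N j) \<psi>)" if "j0 < j" for j
    using ds that by auto
  show "N j0 = \<Delta> j0" by (rule base)
  show "\<psi> l x = \<phi> l x" if "l \<in> N j0" "x \<in> {0..1}" for l x using base(2) that by auto
qed

lemma multiresolution_nested:
  assumes M: "multiresolution j0 \<Delta> N \<phi> \<psi>" and "j0 \<le> j" "j \<le> m"
  shows "L2_span (\<Delta> j) \<phi> \<subseteq> L2_span (\<Delta> m) \<phi>"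
  using assms(3)
proof (induction m rule: int_ge_induct)
  case (step i)
  then show ?case using multiresolutionD(7)[OF M, of i] assms(2) by auto
qed auto

text \<open>For \<open>j > j0\<close> this is \<open>W\<^sub>j \<subseteq> V\<^sub>j \<subseteq> V\<^sub>m\<close>; on the coarsest level wavelets and scaling functions
  agree.\<close>

lemma wavelet_in_scaling_span:
  assumes M: "multiresolution j0 \<Delta> N \<phi> \<psi>" and j: "j0 \<le> j" "j \<le> m" and l: "l \<in> N j"
  shows "\<psi> l \<in> L2_span (\<Delta> m) \<phi>"
proof -
  note D = multiresolutionD[OF M]
  have \<psi>: "\<psi> l \<in> L2_span (N j) \<psi>" using D(6)[OF j(1) l] l by (intro L2_span_base)
  have "\<psi> l \<in> L2_span (\<Delta> j) \<phi>"
  proof (cases "j = j0")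
    case True
    then have "L2_span (\<Delta> j) \<phi> = L2_span (N j) \<psi>"
      using D(9,10) by (auto intro!: L2_span_cong)
    with \<psi> show ?thesis by simp
  next
    case False
    have "L2_eq (\<psi> l) (\<lambda>x. 0 + \<psi> l x)" by (simp add: L2_eq_def)
    moreover have "L2_span (\<Delta> j) \<phi> =
        {f \<in> L2_unit. \<exists>v\<in>L2_span (\<Delta> (j - 1)) \<phi>. \<exists>w\<in>L2_span (N j) \<psi>. L2_eq f (\<lambda>x. v x + w x)}"
      using D(8)[of j] False j(1) by (auto simp: L2_direct_sum_def)
    ultimately show ?thesis
      using \<psi> D(6)[OF j(1) l] L2_span_zero[of "\<Delta> (j - 1)" \<phi>] by (auto intro!: bexI)
  qed
  with multiresolution_nested[OF M j] show ?thesis by auto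
qed

text \<open>Iterating \<open>V\<^sub>m = V\<^bsub>m-1\<^esub> \<oplus> W\<^sub>m\<close> down to the coarsest level.\<close>

lemma scaling_span_subset_wavelet_span:
  assumes M: "multiresolution j0 \<Delta> N \<phi> \<psi>" and m: "j0 \<le> m"
  shows "L2_span (\<Delta> m) \<phi> \<subseteq> L2_span (\<Union>j\<in>{j0..m}. N j) \<psi>"
  using m
proof (induction m rule: int_ge_induct)
  case base
  have "L2_span (\<Delta> j0) \<phi> = L2_span (N j0) \<psi>"
    using multiresolutionD(9,10)[OF M] by (auto intro!: L2_span_cong)
  then show ?case by simp
next
  case (step i)
  note D = multiresolutionD[OF M]
  let ?\<Lambda> = "\<lambda>m. \<Union>j\<in>{j0..m}. N j"
  show ?case
  proof
    fix g assume "g \<in> L2_span (\<Delta> (i + 1)) \<phi>"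
    moreover have "L2_direct_sum (L2_span (\<Delta> (i + 1)) \<phi>) (L2_span (\<Delta> i) \<phi>) (L2_span (N (i + 1)) \<psi>)"
      using D(8)[of "i + 1"] step by simp
    ultimately obtain v w where vw: "g \<in> L2_unit" "v \<in> L2_span (\<Delta> i) \<phi>" "w \<in> L2_span (N (i + 1)) \<psi>"
        "L2_eq g (\<lambda>x. v x + w x)"
      unfolding L2_direct_sum_def by blast
    show "g \<in> L2_span (?\<Lambda> (i + 1)) \<psi>"
    proof (rule L2_span_add)
      show "finite (?\<Lambda> (i + 1))" using D(2) by auto
      have "?\<Lambda> i \<subseteq> ?\<Lambda> (i + 1)" by (intro UN_mono) auto
      then show "v \<in> L2_span (?\<Lambda> (i + 1)) \<psi>" using vw step.IH L2_span_mono by blast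
      have "N (i + 1) \<subseteq> ?\<Lambda> (i + 1)" 
        using step.hyps by (intro UN_upper) auto
      then show "w \<in> L2_span (?\<Lambda> (i + 1)) \<psi>" using vw L2_span_mono by blast
    qed (use vw in auto)
  qed
qed

definition wav_upto :: "wavelet_system \<Rightarrow> int \<Rightarrow> index set" where
  "wav_upto S m = (\<Union>j\<in>{coarse S..m}. wav_idx S j)"

lemma biorthogonal_waveletsD:
  assumes "biorthogonal_wavelets S"
  shows "multiresolution (coarse S) (scal_idx S) (wav_idx S) (scal S) (wav S)"
    "multiresolution (coarse S) (scal_idx S) (wav_idx S) (dscal S) (dwav S)"
    "\<And>j l l'. coarse S \<le> j \<Longrightarrow> l \<in> scal_idx S j \<Longrightarrow> l' \<in> scal_idx S j \<Longrightarrow>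
        L2_inner (dscal S l') (scal S l) = (if l = l' then 1 else 0)"
    "\<And>j l j' l'. coarse S \<le> j \<Longrightarrow> l \<in> wav_idx S j \<Longrightarrow> coarse S \<le> j' \<Longrightarrow> l' \<in> wav_idx S j' \<Longrightarrow>
        L2_inner (dwav S l') (wav S l) = (if l = l' then 1 else 0)"
  using assms unfolding biorthogonal_wavelets_def
  by ((elim conjE, assumption) | (elim conjE, blast))+

text \<open>With its converse below, the univariate change of basis from which the multivariate ones are
  built.\<close>

lemma dual_wavelet_expansion:
  assumes B: "biorthogonal_wavelets S" and m: "coarse S \<le> m" and l: "l \<in> wav_upto S m"
  shows "L2_eq (dwav S l) (\<lambda>x. \<Sum>k\<in>scal_idx S m. L2_inner (dwav S l) (scal S k) * dscal S k x)"
proof -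
  note B = biorthogonal_waveletsD[OF B]
  note D1 = multiresolutionD[OF B(1)] and D2 = multiresolutionD[OF B(2)]
  obtain j where "j \<in> {coarse S..m}" "l \<in> wav_idx S j" using l by (auto simp: wav_upto_def)
  then have "dwav S l \<in> L2_span (scal_idx S m) (dscal S)"
    using wavelet_in_scaling_span[OF B(2), of j m l] by auto
  with m show ?thesis
    by (intro biorthogonal_expansion) (auto simp: D1 D2 B)
qed

lemma dual_scaling_expansion:
  assumes B: "biorthogonal_wavelets S" and m: "coarse S \<le> m" and k: "k \<in> scal_idx S m"
  shows "L2_eq (dscal S k) (\<lambda>x. \<Sum>l\<in>wav_upto S m. L2_inner (dscal S k) (wav S l) * dwav S l x)"
proof -
  note B = biorthogonal_waveletsD[OF B]
  note D1 = multiresolutionD[OF B(1)] and D2 = multiresolutionD[OF B(2)]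
  have "dscal S k \<in> L2_span (scal_idx S m) (dscal S)"
    using k m D2(5) by (intro L2_span_base) auto
  then have *: "dscal S k \<in> L2_span (wav_upto S m) (dwav S)"
    using scaling_span_subset_wavelet_span[OF B(2) m] by (auto simp: wav_upto_def)
  have fin: "finite (wav_upto S m)" using D1(2) by (auto simp: wav_upto_def)
  show ?thesis
  proof (rule biorthogonal_expansion[OF fin *])
    fix i i' assume "i \<in> wav_upto S m" "i' \<in> wav_upto S m"
    then obtain j j' where "j \<in> {coarse S..m}" "i \<in> wav_idx S j" "j' \<in> {coarse S..m}" "i' \<in> wav_idx S j'"
      by (auto simp: wav_upto_def)
    then show "L2_inner (dwav S i) (wav S i') = (if i = i' then 1 else 0)"
      using B(4)[of j' i' j i] by simp
  qed (auto simp: wav_upto_def D1 D2)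
qed

section \<open>Inner products and tensor coefficients\<close>

lemma decaysE:
  assumes "decays j0 I \<alpha> f"
  obtains C where "0 < C"
    "\<And>j k x. j0 \<le> j \<Longrightarrow> (j, k) \<in> I j \<Longrightarrow> x \<in> {0..1} \<Longrightarrow>
        \<bar>f (j, k) x\<bar> \<le> C * 2 powr (j / 2) * poly_decay \<alpha> (2 powr j * x - k)"
proof -
  obtain C where C: "\<And>j k x. j0 \<le> j \<Longrightarrow> (j, k) \<in> I j \<Longrightarrow> x \<in> {0..1} \<Longrightarrow>
        \<bar>f (j, k) x\<bar> \<le> C * 2 powr (j / 2) * poly_decay \<alpha> (2 powr j * x - k)"
    using assms unfolding decays_def poly_decay_def by blast
  show thesis
  proof (rule that[of "max 1 C"])
    fix j k :: int and x :: real assume a: "j0 \<le> j" "(j, k) \<in> I j" "x \<in> {0..1}"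
    have "\<bar>f (j, k) x\<bar> \<le> C * (2 powr (j / 2) * poly_decay \<alpha> (2 powr j * x - k))"
      using C[OF a] by (simp add: mult.assoc)
    also have "\<dots> \<le> max 1 C * (2 powr (j / 2) * poly_decay \<alpha> (2 powr j * x - k))"
      by (intro mult_right_mono) (auto simp: less_imp_le poly_decay_pos)
    finally show "\<bar>f (j, k) x\<bar> \<le> max 1 C * 2 powr (j / 2) * poly_decay \<alpha> (2 powr j * x - k)"
      by (simp add: mult.assoc)
  qed simp
qed

text \<open>A function of the fine level \<open>m\<close> is paired with one of a coarser level \<open>j\<close>. The pointwise
  bound for the product of two bumps extracts the decay in the distance; the remaining integrals
  over the line are of order \<open>2\<^bsup>-m\<^esup>\<close>, and with the normalisation \<open>2\<^bsup>m/2\<^esup> 2\<^bsup>j/2\<^esup>\<close> this leaves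
  \<open>2\<^bsup>-(m-j)/2\<^esup>\<close>.\<close>

lemma decay_inner_bound:
  assumes f: "decays j0 I \<alpha> f" and g: "decays j0 J \<alpha> g" and \<alpha>: "1 < \<alpha>"
  shows "\<exists>C>0. \<forall>j m k l. j0 \<le> j \<and> j \<le> m \<and> (m, k) \<in> I m \<and> (j, l) \<in> J j \<and>
           f (m, k) \<in> L2_unit \<and> g (j, l) \<in> L2_unit \<longrightarrow>
           \<bar>L2_inner (f (m, k)) (g (j, l))\<bar> \<le> C * 2 powr (- (real_of_int (m - j) / 2)) *
              poly_decay \<alpha> (2 powr (- real_of_int (m - j)) * real_of_int k - real_of_int l)"
proof -
  obtain Cf where Cf: "0 < Cf" and f: "\<And>j k x. j0 \<le> j \<Longrightarrow> (j, k) \<in> I j \<Longrightarrow> x \<in> {0..1} \<Longrightarrow>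
        \<bar>f (j, k) x\<bar> \<le> Cf * 2 powr (j / 2) * poly_decay \<alpha> (2 powr j * x - k)"
    by (rule decaysE[OF f]) blast
  obtain Cg where Cg: "0 < Cg" and g: "\<And>j k x. j0 \<le> j \<Longrightarrow> (j, k) \<in> J j \<Longrightarrow> x \<in> {0..1} \<Longrightarrow>
        \<bar>g (j, k) x\<bar> \<le> Cg * 2 powr (j / 2) * poly_decay \<alpha> (2 powr j * x - k)"
    by (rule decaysE[OF g]) blast
  define C where "C = Cf * Cg * 4 powr \<alpha> * (4 / (\<alpha> - 1))"
  have C: "0 < C" using Cf Cg \<alpha> by (simp add: C_def)
  show ?thesis
  proof (intro exI[of _ C] conjI C allI impI, elim conjE)
    fix j m k l :: int
    assume jm: "j0 \<le> j" "j \<le> m" "(m, k) \<in> I m" "(j, l) \<in> J j"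
      and L2: "f (m, k) \<in> L2_unit" "g (j, l) \<in> L2_unit"
    define h where "h = 2 powr (- real_of_int (m - j))"
    have h: "0 < h" "h \<le> 1" using jm powr_mono[of "- real_of_int (m - j)" 0 2] by (auto simp: h_def)
    define t where "t = h * real_of_int k - real_of_int l"
    define M where "M = Cf * Cg * 2 powr (m / 2) * 2 powr (j / 2) * 4 powr \<alpha> * poly_decay \<alpha> t"
    have M: "0 < M" using Cf Cg by (simp add: M_def poly_decay_pos)
    let ?z = "\<lambda>x. 2 powr m * x - real_of_int k" and ?y = "\<lambda>x. 2 powr j * x - real_of_int l"
    have pw: "\<bar>f (m, k) x * g (j, l) x\<bar> \<le> M * (poly_decay \<alpha> (?z x) + h * poly_decay \<alpha> (?y x))"
      if x: "x \<in> {0..1}" for x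
    proof -
      have "h * 2 powr m = 2 powr j" by (simp add: h_def powr_add[symmetric])
      then have ht: "t = ?y x - h * ?z x" by (simp add: t_def right_diff_distrib mult.assoc[symmetric])
      have "\<bar>f (m, k) x * g (j, l) x\<bar> \<le>
          (Cf * 2 powr (m / 2) * poly_decay \<alpha> (?z x)) * (Cg * 2 powr (j / 2) * poly_decay \<alpha> (?y x))"
        unfolding abs_mult using jm x Cf Cg
        by (intro mult_mono f g) (auto simp: less_imp_le poly_decay_pos)
      also have "\<dots> = (Cf * Cg * 2 powr (m / 2) * 2 powr (j / 2)) * (poly_decay \<alpha> (?y x) * poly_decay \<alpha> (?z x))"
        by simp
      also have "\<dots> \<le> (Cf * Cg * 2 powr (m / 2) * 2 powr (j / 2)) *
           (4 powr \<alpha> * poly_decay \<alpha> t * (poly_decay \<alpha> (?z x) + h * poly_decay \<alpha> (?y x)))"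
        using Cf Cg by (intro mult_left_mono poly_decay_product[OF \<alpha> h ht]) auto
      also have "\<dots> = M * (poly_decay \<alpha> (?z x) + h * poly_decay \<alpha> (?y x))"
        by (simp add: M_def)
      finally show ?thesis .
    qed
    have "ennreal \<bar>L2_inner (f (m, k)) (g (j, l))\<bar> \<le>
       (\<integral>\<^sup>+x. norm (indicator {0..1} x * (f (m, k) x * g (j, l) x)) \<partial>lborel)"
      unfolding L2_inner_alt real_norm_def[symmetric]
      by (intro integral_norm_bound_ennreal L2_unit_mult_integrable L2)
    also have "\<dots> \<le> (\<integral>\<^sup>+x. ennreal M * (ennreal (poly_decay \<alpha> (?z x)) + ennreal h * ennreal (poly_decay \<alpha> (?y x))) \<partial>lborel)"
    proof (intro nn_integral_mono)
      fix x :: real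
      show "ennreal (norm (indicator {0..1} x * (f (m, k) x * g (j, l) x))) \<le>
        ennreal M * (ennreal (poly_decay \<alpha> (?z x)) + ennreal h * ennreal (poly_decay \<alpha> (?y x)))"
      proof (cases "x \<in> {0..1}")
        case True
        have "ennreal \<bar>f (m, k) x * g (j, l) x\<bar> \<le> ennreal (M * (poly_decay \<alpha> (?z x) + h * poly_decay \<alpha> (?y x)))"
          by (intro ennreal_leI pw True)
        also have "\<dots> = ennreal M * (ennreal (poly_decay \<alpha> (?z x)) + ennreal h * ennreal (poly_decay \<alpha> (?y x)))"
          using M h by (simp add: ennreal_mult ennreal_plus less_imp_le poly_decay_pos)
        finally show ?thesis using True by simp
      qed simp
    qed
    also have "\<dots> = ennreal M * ((\<integral>\<^sup>+x. ennreal (poly_decay \<alpha> (?z x)) \<partial>lborel) +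
                                    ennreal h * (\<integral>\<^sup>+x. ennreal (poly_decay \<alpha> (?y x)) \<partial>lborel))"
      by (subst nn_integral_cmult, simp, subst nn_integral_add) (simp_all add: nn_integral_cmult)
    also have "\<dots> \<le> ennreal M * (ennreal (2 / (\<alpha> - 1) / 2 powr m) + ennreal h * ennreal (2 / (\<alpha> - 1) / 2 powr j))"
      by (intro mult_left_mono add_mono nn_integral_poly_decay_affine \<alpha>) auto
    also have "\<dots> = ennreal (M * (2 / (\<alpha> - 1) / 2 powr m + h * (2 / (\<alpha> - 1) / 2 powr j)))"
    proof -
      have "ennreal M * (ennreal p + ennreal h * ennreal r) = ennreal (M * (p + h * r))"
        if "0 \<le> p" "0 \<le> r" for p r
        using that M h by (simp add: ennreal_mult ennreal_plus)
      from this[of "2 / (\<alpha> - 1) / 2 powr m" "2 / (\<alpha> - 1) / 2 powr j"] show ?thesis using \<alpha> by simp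
    qed
    also have "M * (2 / (\<alpha> - 1) / 2 powr m + h * (2 / (\<alpha> - 1) / 2 powr j)) = M * (4 / (\<alpha> - 1)) / 2 powr m"
    proof -
      have "h / 2 powr j = 1 / 2 powr m"
        by (simp add: h_def powr_minus powr_diff field_simps)
      then have "h * (2 / (\<alpha> - 1) / 2 powr j) = 2 / (\<alpha> - 1) / 2 powr m"
        by (metis mult.commute mult.right_neutral times_divide_eq_left times_divide_eq_right)
      then show ?thesis by (simp add: field_simps)
    qed
    also have "\<dots> = C * poly_decay \<alpha> t * (2 powr (m / 2) * 2 powr (j / 2) / 2 powr m)"
      by (simp add: M_def C_def)
    also have "2 powr (m / 2) * 2 powr (j / 2) / 2 powr m = 2 powr (- (real_of_int (m - j) / 2))"
    proof -
      have "2 powr (m / 2) * 2 powr (j / 2) / 2 powr m = 2 powr (m / 2 + j / 2 - real_of_int m)"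
        by (simp only: powr_add powr_diff)
      also have "m / 2 + j / 2 - real_of_int m = - (real_of_int (m - j) / 2)"
        by (simp add: field_simps)
      finally show ?thesis .
    qed
    finally have "\<bar>L2_inner (f (m, k)) (g (j, l))\<bar> \<le> C * poly_decay \<alpha> t * 2 powr (- (real_of_int (m - j) / 2))"
      using C by (subst (asm) ennreal_le_iff) (auto simp: less_imp_le poly_decay_pos)
    then show "\<bar>L2_inner (f (m, k)) (g (j, l))\<bar> \<le> C * 2 powr (- (real_of_int (m - j) / 2)) *
              poly_decay \<alpha> (2 powr (- real_of_int (m - j)) * real_of_int k - real_of_int l)"
      by (simp add: t_def h_def mult_ac)
  qed
qed

text \<open>Null sets of the line pull back to null sets under coordinate projections: Lebesgue measure
  on \<open>real ^ 'n\<close> is the image of the product measure, and a box with one null side is null.\<close>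

lemma AE_lborel_vec_nth:
  assumes "AE x in lborel. P (x :: real)"
  shows "AE x in (lborel :: (real ^ 'n::finite) measure). P (x $ i)"
proof -
  interpret product_sigma_finite "\<lambda>_ :: real ^ 'n. lborel :: real measure" by standard
  obtain N where N: "{x. \<not> P x} \<subseteq> N" "N \<in> null_sets lborel"
    using assms by (auto simp: eventually_ae_filter)
  have [measurable]: "N \<in> sets borel" and N0: "emeasure lborel N = 0"
    using N(2) by auto
  let ?A = "{x :: real ^ 'n. x $ i \<in> N}"
  have A: "?A \<in> sets borel" by measurable
  have ax: "axis i 1 \<in> (Basis :: (real ^ 'n) set)" by (auto simp: Basis_vec_def)
  have "emeasure (lborel :: (real ^ 'n) measure) ?A =
      emeasure (\<Pi>\<^sub>M b\<in>(Basis :: (real ^ 'n) set). lborel)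
        ((\<lambda>f. \<Sum>b\<in>Basis. f b *\<^sub>R b) -` ?A \<inter> space (\<Pi>\<^sub>M b\<in>(Basis :: (real ^ 'n) set). lborel))"
    using A by (subst lborel_eq) (intro emeasure_distr, auto)
  also have "(\<lambda>f. \<Sum>b\<in>Basis. f b *\<^sub>R b) -` ?A \<inter> space (\<Pi>\<^sub>M b\<in>(Basis :: (real ^ 'n) set). lborel) =
      PiE Basis (\<lambda>b. if b = axis i 1 then N else UNIV)"
  proof -
    have "(\<Sum>b\<in>(Basis :: (real ^ 'n) set). f b *\<^sub>R b) $ i = f (axis i 1)" for f
      using ax by (simp only: cart_eq_inner_axis inner_sum_left_Basis)
    then show ?thesis
      using ax by (auto simp: space_PiM PiE_iff split: if_splits)
  qed
  also have "emeasure (\<Pi>\<^sub>M b\<in>(Basis :: (real ^ 'n) set). lborel) \<dots> =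
      (\<Prod>b\<in>(Basis :: (real ^ 'n) set). emeasure lborel (if b = axis i 1 then N else UNIV))"
    by (intro emeasure_PiM) auto
  also have "\<dots> = 0"
    using ax N0 by (intro prod_zero) (auto intro!: bexI[of _ "axis i 1"])
  finally have "?A \<in> null_sets lborel" using A by auto
  then show ?thesis
    by (rule AE_I') (use N(1) in auto)
qed

text \<open>Measurability of the univariate factors is known on \<open>[0,1]\<close> only, which suffices since the cube
  restricts every coordinate to that interval.\<close>

lemma tensor_mult_measurable:
  fixes f :: "'n::finite \<Rightarrow> real \<Rightarrow> real"
  assumes f: "\<And>i. f i \<in> L2_unit" and u: "u \<in> L1_cube"
  shows "(\<lambda>x. indicator unit_cube x * (tensor f x * u x)) \<in> borel_measurable borel"
proof -
  have [measurable]: "(\<lambda>x. indicator {0..1} x * f i x) \<in> borel_measurable borel" for i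
    using f by (simp add: L2_unit_iff)
  have [measurable]: "(\<lambda>x. indicator unit_cube x * u x) \<in> borel_measurable borel"
    using u borel_measurable_integrable by (fastforce simp: L1_cube_def set_integrable_def)
  have *: "(\<lambda>x::real ^ 'n. indicator {0..1} (x $ i) * f i (x $ i)) \<in> borel_measurable borel" for i
    by (rule measurable_compose[where g="\<lambda>y. indicator {0..1} y * f i y" and f="\<lambda>x. x $ i"]) measurable
  have "(\<lambda>x. indicator unit_cube x * (tensor f x * u x)) =
      (\<lambda>x. (\<Prod>i\<in>UNIV. indicator {0..1} (x $ i) * f i (x $ i)) * (indicator unit_cube x * u x))"
  proof
    fix x :: "real ^ 'n"
    show "indicator unit_cube x * (tensor f x * u x) =
       (\<Prod>i\<in>UNIV. indicator {0..1} (x $ i) * f i (x $ i)) * (indicator unit_cube x * u x)"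
    proof (cases "x \<in> unit_cube")
      case True
      then have "indicator {0..1} (x $ i) = (1::real)" for i
        by (simp add: unit_cube_def less_imp_le)
      then show ?thesis by (simp add: tensor_def)
    qed simp
  qed
  also have "\<dots> \<in> borel_measurable borel"
    using * by measurable
  finally show ?thesis .
qed

text \<open>The factors that can be paired with integrable, not necessarily square integrable,
  functions on the cube.\<close>

definition L2_bounded :: "(real \<Rightarrow> real) set" where
  "L2_bounded = {f \<in> L2_unit. \<exists>B. \<forall>x\<in>{0..1}. \<bar>f x\<bar> \<le> B}"

lemma decays_L2_bounded:
  assumes f: "decays j0 I \<alpha> f" and \<alpha>: "1 < \<alpha>" and "j0 \<le> j" "l \<in> I j" "fst l = j" "f l \<in> L2_unit"
  shows "f l \<in> L2_bounded"
proof -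
  obtain C where C: "0 < C" "\<And>j k x. j0 \<le> j \<Longrightarrow> (j, k) \<in> I j \<Longrightarrow> x \<in> {0..1} \<Longrightarrow>
        \<bar>f (j, k) x\<bar> \<le> C * 2 powr (j / 2) * poly_decay \<alpha> (2 powr j * x - k)"
    by (rule decaysE[OF f]) blast
  obtain k where l: "l = (j, k)" using assms(5) by (cases l) auto
  have "\<bar>f l x\<bar> \<le> C * 2 powr (j / 2)" if "x \<in> {0..1}" for x
  proof -
    have "\<bar>f l x\<bar> \<le> C * 2 powr (j / 2) * poly_decay \<alpha> (2 powr j * x - k)"
      using C(2)[OF assms(3) _ that] assms(4) unfolding l by auto
    also have "\<dots> \<le> C * 2 powr (j / 2) * 1"
      using C(1) \<alpha> by (intro mult_left_mono poly_decay_le_1) auto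
    finally show ?thesis by simp
  qed
  with assms(6) show ?thesis
    unfolding L2_bounded_def by (intro CollectI conjI exI[of _ "C * 2 powr (j / 2)"]) auto
qed

lemma tensor_mult_integrable:
  fixes f :: "'n::finite \<Rightarrow> real \<Rightarrow> real"
  assumes f: "\<And>i. f i \<in> L2_bounded" and u: "u \<in> L1_cube"
  shows "integrable lborel (\<lambda>x. indicator unit_cube x * (tensor f x * u x))"
proof -
  have "\<forall>i. \<exists>B. \<forall>x\<in>{0..1}. \<bar>f i x\<bar> \<le> B" using f by (auto simp: L2_bounded_def)
  then obtain B where B: "\<And>i x. x \<in> {0..1} \<Longrightarrow> \<bar>f i x\<bar> \<le> B i" by metis
  have i: "integrable lborel (\<lambda>x. indicator unit_cube x * u x)"
    using u by (simp add: L1_cube_def set_integrable_def)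
  show ?thesis
  proof (rule Bochner_Integration.integrable_bound)
    show "integrable lborel (\<lambda>x. (\<Prod>i\<in>UNIV. B i) * (indicator unit_cube x * u x))" using i by simp
    show "(\<lambda>x. indicator unit_cube x * (tensor f x * u x)) \<in> borel_measurable lborel"
      using tensor_mult_measurable[of f u] f u by (auto simp: L2_bounded_def)
    show "AE x in lborel. norm (indicator unit_cube x * (tensor f x * u x)) \<le>
        norm ((\<Prod>i\<in>UNIV. B i) * (indicator unit_cube x * u x))"
    proof (intro AE_I2)
      fix x :: "real ^ 'n"
      show "norm (indicator unit_cube x * (tensor f x * u x)) \<le> norm ((\<Prod>i\<in>UNIV. B i) * (indicator unit_cube x * u x))"
      proof (cases "x \<in> unit_cube")
        case True
        then have x: "x $ i \<in> {0..1}" for i by (simp add: unit_cube_def less_imp_le)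
        have "\<bar>tensor f x\<bar> \<le> (\<Prod>i\<in>UNIV. B i)"
          unfolding tensor_def abs_prod by (intro prod_mono) (auto intro!: B x)
        then have "\<bar>tensor f x\<bar> * \<bar>u x\<bar> \<le> \<bar>\<Prod>i\<in>UNIV. B i\<bar> * \<bar>u x\<bar>"
          by (intro mult_right_mono) auto
        with True show ?thesis by (simp add: abs_mult)
      qed simp
    qed
  qed
qed

lemma cube_pairing_alt:
  "cube_pairing f u = (\<integral>x. indicator unit_cube x * (f x * u x) \<partial>lborel)"
  by (simp add: cube_pairing_def set_lebesgue_integral_def)

lemma cube_pairing_cong:
  fixes f g :: "'n::finite \<Rightarrow> real \<Rightarrow> real"
  assumes "\<And>i. f i \<in> L2_unit" "\<And>i. g i \<in> L2_unit" "u \<in> L1_cube" "\<And>i. L2_eq (f i) (g i)"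
  shows "cube_pairing (tensor f) u = cube_pairing (tensor g) u"
  unfolding cube_pairing_alt
proof (rule integral_cong_AE)
  have "AE x in (lborel :: (real ^ 'n) measure). \<forall>i. x $ i \<in> {0..1} \<longrightarrow> f i (x $ i) = g i (x $ i)"
    unfolding AE_all_countable using assms(4) by (intro allI AE_lborel_vec_nth) (simp add: L2_eq_def)
  then show "AE x in lborel. indicator unit_cube x * (tensor f x * u x) =
                             indicator unit_cube x * (tensor g x * u x)"
  proof (rule AE_mp, intro AE_I2 impI)
    fix x :: "real ^ 'n" assume *: "\<forall>i. x $ i \<in> {0..1} \<longrightarrow> f i (x $ i) = g i (x $ i)"
    show "indicator unit_cube x * (tensor f x * u x) = indicator unit_cube x * (tensor g x * u x)"
    proof (cases "x \<in> unit_cube")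
      case True
      then have "x $ i \<in> {0..1}" for i by (simp add: unit_cube_def less_imp_le)
      with * show ?thesis by (simp add: tensor_def)
    qed simp
  qed
qed (use tensor_mult_measurable assms in auto)

text \<open>Multilinearity of the tensor product: the product of the univariate sums is multiplied out.
  The univariate identities hold almost everywhere, hence so does their product on the cube.\<close>

lemma cube_pairing_expansion:
  fixes f :: "'n::finite \<Rightarrow> real \<Rightarrow> real"
  assumes f: "\<And>i. f i \<in> L2_unit" and u: "u \<in> L1_cube" and K: "\<And>i. finite (K i)"
    and g: "\<And>i k. k \<in> K i \<Longrightarrow> g i k \<in> L2_bounded"
    and eq: "\<And>i. L2_eq (f i) (\<lambda>x. \<Sum>k\<in>K i. c i k * g i k x)"
  shows "cube_pairing (tensor f) u =
     (\<Sum>k\<in>PiE UNIV K. (\<Prod>i\<in>UNIV. c i (k i)) * cube_pairing (tensor (\<lambda>i. g i (k i))) u)"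
proof -
  have "cube_pairing (tensor f) u = cube_pairing (tensor (\<lambda>i x. \<Sum>k\<in>K i. c i k * g i k x)) u"
    using g by (intro cube_pairing_cong f u eq L2_unit_sum K) (auto simp: L2_bounded_def)
  also have "tensor (\<lambda>i x. \<Sum>k\<in>K i. c i k * g i k x) =
     (\<lambda>x. \<Sum>k\<in>PiE UNIV K. (\<Prod>i\<in>UNIV. c i (k i)) * tensor (\<lambda>i. g i (k i)) x)"
    by (rule ext) (simp add: tensor_def prod_sum_PiE K prod.distrib)
  also have "cube_pairing \<dots> u = (\<integral>x. (\<Sum>k\<in>PiE UNIV K. (\<Prod>i\<in>UNIV. c i (k i)) *
      (indicator unit_cube x * (tensor (\<lambda>i. g i (k i)) x * u x))) \<partial>lborel)"
    by (simp add: cube_pairing_alt sum_distrib_left sum_distrib_right mult_ac)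
  also have "\<dots> = (\<Sum>k\<in>PiE UNIV K. (\<Prod>i\<in>UNIV. c i (k i)) * cube_pairing (tensor (\<lambda>i. g i (k i))) u)"
    by (subst Bochner_Integration.integral_sum)
      (auto simp: cube_pairing_alt PiE_iff intro!: tensor_mult_integrable g u)
  finally show ?thesis .
qed

section \<open>Box estimates\<close>

text \<open>Tensor indices with level exactly \<open>m\<close> in the directions selected by \<open>e\<close> and below \<open>m\<close> in
  the others. For \<open>e\<close> not identically false, these boxes partition the indices whose maximal level is \<open>m\<close>.\<close>

definition hybrid_box :: "wavelet_system \<Rightarrow> ('n \<Rightarrow> bool) \<Rightarrow> int \<Rightarrow> ('n \<Rightarrow> index) set" where
  "hybrid_box S e m = PiE UNIV (\<lambda>i. if e i then wav_idx S m else wav_upto S (m - 1))"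

text \<open>The indices \<open>l\<close> for which \<open>(m, e, l)\<close> is an isotropic index, if \<open>m\<close> is above the coarsest
  level and \<open>e\<close> is not identically false.\<close>

definition iso_box :: "wavelet_system \<Rightarrow> ('n \<Rightarrow> bool) \<Rightarrow> int \<Rightarrow> ('n \<Rightarrow> index) set" where
  "iso_box S e m = PiE UNIV (\<lambda>i. if e i then wav_idx S m else scal_idx S (m - 1))"

lemma wav_upto_finite:
  assumes "biorthogonal_wavelets S" shows "finite (wav_upto S m)"
  using multiresolutionD(2)[OF biorthogonal_waveletsD(1)[OF assms]] by (auto simp: wav_upto_def)

lemma dual_L2_bounded:
  assumes B: "biorthogonal_wavelets S" and D: "wavelet_decay S \<alpha>" and \<alpha>: "1 < \<alpha>" and j: "coarse S \<le> j"
  shows "l \<in> wav_idx S j \<Longrightarrow> dwav S l \<in> L2_bounded" "k \<in> scal_idx S j \<Longrightarrow> dscal S k \<in> L2_bounded"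
proof -
  note M = multiresolutionD[OF biorthogonal_waveletsD(2)[OF B]]
  show "dwav S l \<in> L2_bounded" if "l \<in> wav_idx S j"
    using D j that M(4,6)[OF j that] unfolding wavelet_decay_def
    by (intro decays_L2_bounded[of "coarse S" "wav_idx S" \<alpha> "dwav S" j] \<alpha>) auto
  show "dscal S k \<in> L2_bounded" if "k \<in> scal_idx S j"
    using D j that M(3,5)[OF j that] unfolding wavelet_decay_def
    by (intro decays_L2_bounded[of "coarse S" "scal_idx S" \<alpha> "dscal S" j] \<alpha>) auto
qed

lemma dual_L2_bounded_upto:
  assumes "biorthogonal_wavelets S" "wavelet_decay S \<alpha>" "1 < \<alpha>" "l \<in> wav_upto S m"
  shows "dwav S l \<in> L2_bounded"
proof -
  obtain j where "j \<in> {coarse S..m}" "l \<in> wav_idx S j" using assms(4) by (auto simp: wav_upto_def)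
  then show ?thesis using dual_L2_bounded(1)[OF assms(1-3), of j l] by simp
qed

lemma almost_diagonal_inner:
  assumes B: "biorthogonal_wavelets S"
    and M: "\<And>j l. coarse S \<le> j \<Longrightarrow> l \<in> wav_idx S j \<Longrightarrow> g l \<in> L2_unit"
           "\<And>j k. coarse S \<le> j \<Longrightarrow> k \<in> scal_idx S j \<Longrightarrow> f k \<in> L2_unit"
    and dec: "decays (coarse S) (scal_idx S) \<alpha> f" "decays (coarse S) (wav_idx S) \<alpha> g" and \<alpha>: "1 < \<alpha>"
  shows "\<exists>C>0. \<forall>m\<ge>coarse S. almost_diagonal \<alpha> C (coarse S) m (wav_idx S) (scal_idx S m) (\<lambda>l k. L2_inner (f k) (g l))"
proof -
  note D = multiresolutionD[OF biorthogonal_waveletsD(1)[OF B]]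
  obtain C where C: "0 < C" and bd: "\<And>j m k l. coarse S \<le> j \<Longrightarrow> j \<le> m \<Longrightarrow> (m, k) \<in> scal_idx S m \<Longrightarrow>
        (j, l) \<in> wav_idx S j \<Longrightarrow> f (m, k) \<in> L2_unit \<Longrightarrow> g (j, l) \<in> L2_unit \<Longrightarrow>
           \<bar>L2_inner (f (m, k)) (g (j, l))\<bar> \<le> C * 2 powr (- (real_of_int (m - j) / 2)) *
              poly_decay \<alpha> (2 powr (- real_of_int (m - j)) * real_of_int k - real_of_int l)"
    using decay_inner_bound[OF dec \<alpha>] by blast
  show ?thesis
  proof (intro exI[of _ C] conjI C allI impI)
    fix m assume m: "coarse S \<le> m"
    show "almost_diagonal \<alpha> C (coarse S) m (wav_idx S) (scal_idx S m) (\<lambda>l k. L2_inner (f k) (g l))"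
      unfolding almost_diagonal_def
    proof (intro conjI ballI)
      fix j l k assume a: "j \<in> {coarse S..m}" "l \<in> wav_idx S j" "k \<in> scal_idx S m"
      have "l = (j, snd l)" "k = (m, snd k)" using a D(3)[OF m, of k] D(4)[of j l] by (auto simp: prod_eq_iff)
      then show "\<bar>L2_inner (f k) (g l)\<bar> \<le> C * 2 powr (- (real_of_int (m - j) / 2)) *
        poly_decay \<alpha> (2 powr (- real_of_int (m - j)) * real_of_int (snd k) - real_of_int (snd l))"
        using bd[of j m "snd k" "snd l"] a m M(1)[of j l] M(2)[of m k] by auto
    qed (use D m in auto)
  qed
qed

text \<open>In the directions selected by \<open>e\<close> both systems use the same function; in the others the coarse dual wavelet lies
  in the span of the dual scaling functions of level \<open>m - 1\<close>.\<close>

lemma tensor_coeff_from_iso: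
  fixes u :: "real ^ 'n::finite \<Rightarrow> real"
  assumes B: "biorthogonal_wavelets S" and D: "wavelet_decay S \<alpha>" and \<alpha>: "1 < \<alpha>"
    and u: "u \<in> L1_cube" and m: "coarse S < m" and l: "l \<in> hybrid_box S e m"
  shows "cube_pairing (dual_tensor_wavelet S l) u =
    (\<Sum>k\<in>iso_box S e m. (\<Prod>i\<in>UNIV. (if e i then (\<lambda>l k. if l = k then 1 else 0)
        else (\<lambda>l k. L2_inner (scal S k) (dwav S l))) (l i) (k i)) *
      cube_pairing (dual_iso_wavelet S (m, e, k)) u)"
proof -
  note M = multiresolutionD[OF biorthogonal_waveletsD(2)[OF B]]
  have li: "e i \<Longrightarrow> l i \<in> wav_idx S m" "\<not> e i \<Longrightarrow> l i \<in> wav_upto S (m - 1)" for i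
    using l by (auto simp: hybrid_box_def PiE_iff split: if_splits)
  have "cube_pairing (tensor (\<lambda>i. dwav S (l i))) u =
    (\<Sum>k\<in>PiE UNIV (\<lambda>i. if e i then wav_idx S m else scal_idx S (m - 1)).
      (\<Prod>i\<in>UNIV. (if e i then (\<lambda>l k. if l = k then 1 else 0) else (\<lambda>l k. L2_inner (scal S k) (dwav S l))) (l i) (k i)) *
      cube_pairing (tensor (\<lambda>i. (if e i then dwav S else dscal S) (k i))) u)"
  proof (rule cube_pairing_expansion[OF _ u])
    fix i
    show "dwav S (l i) \<in> L2_unit"
      using li[of i] M(6)[of m "l i"] dual_L2_bounded_upto[OF B D \<alpha>, of "l i" "m - 1"] m
      by (cases "e i") (auto simp: L2_bounded_def)
    show "finite (if e i then wav_idx S m else scal_idx S (m - 1))" using M(1,2) m by auto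
    show "(if e i then dwav S else dscal S) k \<in> L2_bounded"
      if "k \<in> (if e i then wav_idx S m else scal_idx S (m - 1))" for k
      using that m dual_L2_bounded(1)[OF B D \<alpha>, of m k] dual_L2_bounded(2)[OF B D \<alpha>, of "m - 1" k]
      by (auto split: if_splits)
    show "L2_eq (dwav S (l i)) (\<lambda>x. \<Sum>k\<in>(if e i then wav_idx S m else scal_idx S (m - 1)).
        (if e i then (\<lambda>l k. if l = k then 1 else 0) else (\<lambda>l k. L2_inner (scal S k) (dwav S l))) (l i) k *
        (if e i then dwav S else dscal S) k x)"
    proof (cases "e i")
      case True
      have "(\<Sum>k\<in>wav_idx S m. (if l i = k then 1 else 0) * dwav S k x) = dwav S (l i) x" for x
      proof -
        have "(\<Sum>k\<in>wav_idx S m. (if l i = k then 1 else 0) * dwav S k x) =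
              (\<Sum>k\<in>wav_idx S m. if l i = k then dwav S k x else 0)" by (intro sum.cong) auto
        then show ?thesis using li(1)[OF True] M(2)[of m] m by simp
      qed
      with True show ?thesis by (simp add: L2_eq_def)
    next
      case False
      with dual_wavelet_expansion[OF B _ li(2)[OF False]] m show ?thesis
        by (simp add: L2_inner_commute)
    qed
  qed
  then show ?thesis
    by (simp add: dual_tensor_wavelet_def dual_iso_wavelet_def iso_box_def if_distribR)
qed

text \<open>The inverse change of basis, with the multilevel decomposition of the dual scaling functions
  of level \<open>m - 1\<close>.\<close>

lemma iso_coeff_from_tensor:
  fixes u :: "real ^ 'n::finite \<Rightarrow> real"
  assumes B: "biorthogonal_wavelets S" and D: "wavelet_decay S \<alpha>" and \<alpha>: "1 < \<alpha>"
    and u: "u \<in> L1_cube" and m: "coarse S < m" and k: "k \<in> iso_box S e m"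
  shows "cube_pairing (dual_iso_wavelet S (m, e, k)) u =
    (\<Sum>l\<in>hybrid_box S e m. (\<Prod>i\<in>UNIV. (if e i then (\<lambda>k l. if k = l then 1 else 0)
        else (\<lambda>k l. L2_inner (dscal S k) (wav S l))) (k i) (l i)) *
      cube_pairing (dual_tensor_wavelet S l) u)"
proof -
  note M = multiresolutionD[OF biorthogonal_waveletsD(2)[OF B]]
  have ki: "e i \<Longrightarrow> k i \<in> wav_idx S m" "\<not> e i \<Longrightarrow> k i \<in> scal_idx S (m - 1)" for i
    using k by (auto simp: iso_box_def PiE_iff split: if_splits)
  have "cube_pairing (tensor (\<lambda>i. if e i then dwav S (k i) else dscal S (k i))) u =
    (\<Sum>l\<in>PiE UNIV (\<lambda>i. if e i then wav_idx S m else wav_upto S (m - 1)).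
      (\<Prod>i\<in>UNIV. (if e i then (\<lambda>k l. if k = l then 1 else 0) else (\<lambda>k l. L2_inner (dscal S k) (wav S l))) (k i) (l i)) *
      cube_pairing (tensor (\<lambda>i. dwav S (l i))) u)"
  proof (rule cube_pairing_expansion[OF _ u])
    fix i
    show "(if e i then dwav S (k i) else dscal S (k i)) \<in> L2_unit"
      using ki[of i] M(6)[of m "k i"] M(5)[of "m - 1" "k i"] m by auto
    show "finite (if e i then wav_idx S m else wav_upto S (m - 1))"
      using M(2) m wav_upto_finite[OF B] by auto
    show "dwav S l \<in> L2_bounded" if "l \<in> (if e i then wav_idx S m else wav_upto S (m - 1))" for l
      using that m dual_L2_bounded(1)[OF B D \<alpha>, of m l] dual_L2_bounded_upto[OF B D \<alpha>, of l "m - 1"]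
      by (auto split: if_splits)
    show "L2_eq (if e i then dwav S (k i) else dscal S (k i))
       (\<lambda>x. \<Sum>l\<in>(if e i then wav_idx S m else wav_upto S (m - 1)).
        (if e i then (\<lambda>k l. if k = l then 1 else 0) else (\<lambda>k l. L2_inner (dscal S k) (wav S l))) (k i) l * dwav S l x)"
    proof (cases "e i")
      case True
      have "(\<Sum>l\<in>wav_idx S m. (if k i = l then 1 else 0) * dwav S l x) = dwav S (k i) x" for x
      proof -
        have "(\<Sum>l\<in>wav_idx S m. (if k i = l then 1 else 0) * dwav S l x) =
              (\<Sum>l\<in>wav_idx S m. if k i = l then dwav S l x else 0)" by (intro sum.cong) auto
        then show ?thesis using ki(1)[OF True] M(2)[of m] m by simp
      qed
      with True show ?thesis by (simp add: L2_eq_def)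
    next
      case False
      with dual_scaling_expansion[OF B _ ki(2)[OF False]] m show ?thesis by simp
    qed
  qed
  then show ?thesis
    by (simp add: dual_tensor_wavelet_def dual_iso_wavelet_def hybrid_box_def)
qed

text \<open>The tensor product of the Schur bounds from fine to coarse, which are uniform in \<open>m\<close>, with
  those of identity matrices.\<close>

lemma hybrid_box_energy_le:
  assumes B: "biorthogonal_wavelets S" and D: "wavelet_decay S \<alpha>" and \<alpha>: "1 < \<alpha>"
    and \<tau>: "0 < \<tau>" "\<tau> < 2" "1 < \<alpha> * schur_rho \<tau>"
  shows "\<exists>K>0. \<forall>u\<in>L1_cube. \<forall>m>coarse S. \<forall>e.
    (\<Sum>l\<in>hybrid_box S e m. \<bar>cube_pairing (dual_tensor_wavelet S l) u\<bar> powr \<tau>) \<le>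
     K * (\<Sum>k\<in>iso_box S e m. \<bar>cube_pairing (dual_iso_wavelet S (m, e, k)) (u :: real ^ 'n::finite \<Rightarrow> real)\<bar> powr \<tau>)"
proof -
  note M1 = multiresolutionD[OF biorthogonal_waveletsD(1)[OF B]]
  note M2 = multiresolutionD[OF biorthogonal_waveletsD(2)[OF B]]
  let ?b = "\<lambda>l k. L2_inner (scal S k) (dwav S l)"
  have ad: "\<exists>C>0. \<forall>m\<ge>coarse S. almost_diagonal \<alpha> C (coarse S) m (wav_idx S) (scal_idx S m) ?b"
  proof (rule almost_diagonal_inner[OF B _ _ _ _ \<alpha>])
    show "dwav S l \<in> L2_unit" if "coarse S \<le> j" "l \<in> wav_idx S j" for j l by (rule M2(6)[OF that])
    show "scal S k \<in> L2_unit" if "coarse S \<le> j" "k \<in> scal_idx S j" for j k by (rule M1(5)[OF that])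
  qed (use D in \<open>simp_all add: wavelet_decay_def\<close>)
  obtain C where C: "0 < C" "\<And>m. coarse S \<le> m \<Longrightarrow> almost_diagonal \<alpha> C (coarse S) m (wav_idx S) (scal_idx S m) ?b"
    using ad by blast
  obtain K0 where K0: "0 < K0" "\<And>m N D b. almost_diagonal \<alpha> C (coarse S) m N D b \<Longrightarrow>
     \<exists>w R. schur_bound \<tau> (\<Union>j\<in>{coarse S..m}. N j) D b w R K0"
    using schur_bound_fine_to_coarse[OF \<tau> C(1)] by blast
  define K where "K = max 1 K0 ^ CARD('n)"
  have K: "0 < K" by (simp add: K_def)
  show ?thesis
  proof (intro exI[of _ K] conjI K ballI allI impI)
    fix u :: "real ^ 'n \<Rightarrow> real" and m and e :: "'n \<Rightarrow> bool"
    assume u: "u \<in> L1_cube" and m: "coarse S < m"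
    \<comment> \<open>identity matrices in the directions of \<open>e\<close>, with trivial weights and constant 1\<close>
    let ?a = "\<lambda>i. if e i then (\<lambda>l k. if l = k then 1 else 0) else ?b"
    let ?V = "\<lambda>k. cube_pairing (dual_iso_wavelet S (m, e, k)) u"
    obtain w0 R0 where wR0: "schur_bound \<tau> (wav_upto S (m - 1)) (scal_idx S (m - 1)) ?b w0 R0 K0"
      using K0(2)[OF C(2)[of "m - 1"]] m unfolding wav_upto_def by auto
    let ?w = "\<lambda>i. if e i then (\<lambda>_. 1) else w0" and ?R = "\<lambda>i. if e i then (\<lambda>_. 1) else R0"
      and ?K = "\<lambda>i. if e i then 1 else K0"
    have "schur_bound \<tau> (if e i then wav_idx S m else wav_upto S (m - 1))
        (if e i then wav_idx S m else scal_idx S (m - 1)) (?a i) (?w i) (?R i) (?K i)" for i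
      using schur_bound_delta[OF M1(2)[of m]] wR0 m by auto
    from schur_bound_tensor[of \<tau> "\<lambda>i. if e i then wav_idx S m else wav_upto S (m - 1)"
        "\<lambda>i. if e i then wav_idx S m else scal_idx S (m - 1)" ?a ?w ?R ?K, OF this]
    have "schur_bound \<tau> (hybrid_box S e m) (iso_box S e m) (\<lambda>l k. \<Prod>i\<in>UNIV. ?a i (l i) (k i))
      (\<lambda>k. \<Prod>i\<in>UNIV. ?w i (k i)) (\<lambda>l. \<Prod>i\<in>UNIV. ?R i (l i)) (\<Prod>i\<in>UNIV. ?K i)"
      unfolding hybrid_box_def iso_box_def .
    from schur_test[OF this \<tau>(1), of ?V]
    have "(\<Sum>l\<in>hybrid_box S e m. \<bar>cube_pairing (dual_tensor_wavelet S l) u\<bar> powr \<tau>) \<le>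
        (\<Prod>i\<in>UNIV. ?K i) * (\<Sum>k\<in>iso_box S e m. \<bar>?V k\<bar> powr \<tau>)"
      using tensor_coeff_from_iso[OF B D \<alpha> u m] by simp
    also have "\<dots> \<le> K * (\<Sum>k\<in>iso_box S e m. \<bar>?V k\<bar> powr \<tau>)"
    proof (intro mult_right_mono sum_nonneg)
      have "(\<Prod>i\<in>UNIV. ?K i) \<le> (\<Prod>i\<in>(UNIV :: 'n set). max 1 K0)"
        using K0(1) by (intro prod_mono) auto
      then show "(\<Prod>i\<in>UNIV. ?K i) \<le> K" by (simp add: K_def)
    qed simp
    finally show "(\<Sum>l\<in>hybrid_box S e m. \<bar>cube_pairing (dual_tensor_wavelet S l) u\<bar> powr \<tau>) \<le>
        K * (\<Sum>k\<in>iso_box S e m. \<bar>?V k\<bar> powr \<tau>)" .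
  qed
qed

text \<open>Each direction with \<open>e\<^sub>i\<close> false contributes a factor of order \<open>2\<^bsup>m(1 - \<tau>/2)\<^esup>\<close>. Since \<open>e\<close>
  is not identically false, there are at most \<open>n - 1\<close> of them.\<close>

lemma iso_box_energy_le:
  assumes B: "biorthogonal_wavelets S" and D: "wavelet_decay S \<alpha>" and \<alpha>: "1 < \<alpha>"
    and \<tau>: "0 < \<tau>" "\<tau> < 2" "1 < \<alpha> * schur_rho \<tau>"
  shows "\<exists>K>0. \<forall>u\<in>L1_cube. \<forall>m>coarse S. \<forall>e. (\<exists>i. e i) \<longrightarrow>
    (\<Sum>k\<in>iso_box S e m. \<bar>cube_pairing (dual_iso_wavelet S (m, e, k)) u\<bar> powr \<tau>) \<le>
     K * 2 powr (real_of_int m * (1 - \<tau> / 2) * (real CARD('n) - 1)) *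
     (\<Sum>l\<in>hybrid_box S e m. \<bar>cube_pairing (dual_tensor_wavelet S l) (u :: real ^ 'n::finite \<Rightarrow> real)\<bar> powr \<tau>)"
proof -
  note M1 = multiresolutionD[OF biorthogonal_waveletsD(1)[OF B]]
  note M2 = multiresolutionD[OF biorthogonal_waveletsD(2)[OF B]]
  let ?b = "\<lambda>l k. L2_inner (dscal S k) (wav S l)"
  have ad: "\<exists>C>0. \<forall>m\<ge>coarse S. almost_diagonal \<alpha> C (coarse S) m (wav_idx S) (scal_idx S m) ?b"
  proof (rule almost_diagonal_inner[OF B _ _ _ _ \<alpha>])
    show "wav S l \<in> L2_unit" if "coarse S \<le> j" "l \<in> wav_idx S j" for j l by (rule M1(6)[OF that])
    show "dscal S k \<in> L2_unit" if "coarse S \<le> j" "k \<in> scal_idx S j" for j k by (rule M2(5)[OF that])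
  qed (use D in \<open>simp_all add: wavelet_decay_def\<close>)
  obtain C where C: "0 < C" "\<And>m. coarse S \<le> m \<Longrightarrow> almost_diagonal \<alpha> C (coarse S) m (wav_idx S) (scal_idx S m) ?b"
    using ad by blast
  obtain K0 where K0: "0 < K0" "\<And>m N D b. almost_diagonal \<alpha> C (coarse S) m N D b \<Longrightarrow>
     \<exists>w R. schur_bound \<tau> D (\<Union>j\<in>{coarse S..m}. N j) (\<lambda>k l. b l k) w R (K0 * 2 powr (real_of_int m * (1 - \<tau> / 2)))"
    using schur_bound_coarse_to_fine[OF \<tau> C(1)] by blast
  define x where "x = 1 - \<tau> / 2"
  have x: "0 < x" using \<tau> by (simp add: x_def)
  \<comment> \<open>the second term makes \<open>1 \<le> c 2\<^bsup>mx\<^esup>\<close> also for negative levels \<open>m\<close>\<close>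
  define c where "c = max K0 (2 powr (- real_of_int (coarse S) * x))"
  have c: "0 < c" using K0(1) by (simp add: c_def less_max_iff_disj)
  define K where "K = c ^ (CARD('n) - 1)"
  have K: "0 < K" using c by (simp add: K_def)
  show ?thesis
    unfolding x_def[symmetric]
  proof (intro exI[of _ K] conjI K ballI allI impI)
    fix u :: "real ^ 'n \<Rightarrow> real" and m and e :: "'n \<Rightarrow> bool"
    assume u: "u \<in> L1_cube" and m: "coarse S < m" and "\<exists>i. e i"
    then obtain i0 where i0: "e i0" by blast
    let ?a = "\<lambda>i. if e i then (\<lambda>k l. if k = l then 1 else 0) else (\<lambda>k l. ?b l k)"
    let ?U = "\<lambda>l. cube_pairing (dual_tensor_wavelet S l) u"
    define K1 where "K1 = K0 * 2 powr (real_of_int (m - 1) * x)"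
    obtain w0 R0 where wR0: "schur_bound \<tau> (scal_idx S (m - 1)) (wav_upto S (m - 1)) (\<lambda>k l. ?b l k) w0 R0 K1"
      using K0(2)[OF C(2)[of "m - 1"]] m unfolding wav_upto_def K1_def x_def by auto
    let ?w = "\<lambda>i. if e i then (\<lambda>_. 1) else w0" and ?R = "\<lambda>i. if e i then (\<lambda>_. 1) else R0"
      and ?K = "\<lambda>i. if e i then 1 else K1"
    have "schur_bound \<tau> (if e i then wav_idx S m else scal_idx S (m - 1))
        (if e i then wav_idx S m else wav_upto S (m - 1)) (?a i) (?w i) (?R i) (?K i)" for i
      using schur_bound_delta[OF M1(2)[of m]] wR0 m by auto
    from schur_bound_tensor[of \<tau> "\<lambda>i. if e i then wav_idx S m else scal_idx S (m - 1)"
        "\<lambda>i. if e i then wav_idx S m else wav_upto S (m - 1)" ?a ?w ?R ?K, OF this]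
    have "schur_bound \<tau> (iso_box S e m) (hybrid_box S e m) (\<lambda>k l. \<Prod>i\<in>UNIV. ?a i (k i) (l i))
      (\<lambda>k. \<Prod>i\<in>UNIV. ?w i (k i)) (\<lambda>l. \<Prod>i\<in>UNIV. ?R i (l i)) (\<Prod>i\<in>UNIV. ?K i)"
      unfolding hybrid_box_def iso_box_def .
    from schur_test[OF this \<tau>(1), of ?U]
    have "(\<Sum>k\<in>iso_box S e m. \<bar>cube_pairing (dual_iso_wavelet S (m, e, k)) u\<bar> powr \<tau>) \<le>
        (\<Prod>i\<in>UNIV. ?K i) * (\<Sum>l\<in>hybrid_box S e m. \<bar>?U l\<bar> powr \<tau>)"
      using iso_coeff_from_tensor[OF B D \<alpha> u m] by simp
    also have "\<dots> \<le> (K * 2 powr (real_of_int m * x * (real CARD('n) - 1))) * (\<Sum>l\<in>hybrid_box S e m. \<bar>?U l\<bar> powr \<tau>)"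
    proof (intro mult_right_mono sum_nonneg)
      have K1: "0 \<le> K1" using K0 by (simp add: K1_def)
      have Ki: "?K i \<le> c * 2 powr (real_of_int m * x)" for i
      proof (cases "e i")
        case True
        have "1 \<le> 2 powr (- real_of_int (coarse S) * x + real_of_int m * x)"
          using m x by (intro ge_one_powr_ge_zero) (auto simp: mult_right_mono)
        also have "\<dots> = 2 powr (- real_of_int (coarse S) * x) * 2 powr (real_of_int m * x)"
          by (simp only: powr_add)
        also have "\<dots> \<le> c * 2 powr (real_of_int m * x)"
          by (intro mult_right_mono) (auto simp: c_def)
        finally show ?thesis using True by simp
      next
        case False
        have "K1 \<le> c * 2 powr (real_of_int m * x)"
          unfolding K1_def using x K0(1) by (intro mult_mono powr_mono mult_right_mono) (auto simp: c_def)
        with False show ?thesis by simp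
      qed
      have "(\<Prod>i\<in>UNIV. ?K i) = (\<Prod>i\<in>UNIV - {i0}. ?K i)"
        using i0 by (subst prod.remove[of UNIV i0]) auto
      also have "\<dots> \<le> (\<Prod>i\<in>UNIV - {i0}. c * 2 powr (real_of_int m * x))"
        using K1 Ki by (intro prod_mono) auto
      also have "\<dots> = c ^ (CARD('n) - 1) * (2 powr (real_of_int m * x)) ^ (CARD('n) - 1)"
        by (simp add: power_mult_distrib)
      also have "(2 powr (real_of_int m * x)) ^ (CARD('n) - 1) = 2 powr (real_of_int m * x * (real CARD('n) - 1))"
      proof -
        have "real (CARD('n) - 1) = real CARD('n) - 1"
          using zero_less_card_finite[where 'a='n] by (simp add: of_nat_diff)
        then show ?thesis by (simp add: powr_realpow[symmetric] powr_powr)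
      qed
      finally show "(\<Prod>i\<in>UNIV. ?K i) \<le> K * 2 powr (real_of_int m * x * (real CARD('n) - 1))"
        by (simp add: K_def)
    qed simp
    finally show "(\<Sum>k\<in>iso_box S e m. \<bar>cube_pairing (dual_iso_wavelet S (m, e, k)) u\<bar> powr \<tau>) \<le>
        K * 2 powr (real_of_int m * x * (real CARD('n) - 1)) * (\<Sum>l\<in>hybrid_box S e m. \<bar>?U l\<bar> powr \<tau>)" .
  qed
qed

section \<open>Level energies and the embeddings\<close>

text \<open>Grouping the level vectors by their maximum is what matches the hybrid scale to isotropic
  levels: the weight \<open>2\<^bsup>\<tau>q|j|\<^esup>\<close> is constant on each group.\<close>

definition hybrid_energy :: "wavelet_system \<Rightarrow> real \<Rightarrow> (real ^ 'n::finite \<Rightarrow> real) \<Rightarrow> int \<Rightarrow> real" where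
  "hybrid_energy S \<tau> u m = (\<Sum>j | (\<forall>i. coarse S \<le> j i) \<and> level_max j = m.
      \<Sum>l\<in>tensor_idx S j. \<bar>cube_pairing (dual_tensor_wavelet S l) u\<bar> powr \<tau>)"

definition iso_energy :: "wavelet_system \<Rightarrow> real \<Rightarrow> (real ^ 'n::finite \<Rightarrow> real) \<Rightarrow> int \<Rightarrow> real" where
  "iso_energy S \<tau> u m = (\<Sum>\<mu>\<in>iso_idx S m. \<bar>cube_pairing (dual_iso_wavelet S \<mu>) u\<bar> powr \<tau>)"

lemma level_max_ge: "j i \<le> level_max (j :: 'n::finite \<Rightarrow> int)"
  by (simp add: level_max_def)

lemma level_max_attained: "\<exists>i. j i = level_max (j :: 'n::finite \<Rightarrow> int)"
proof -
  have "level_max j \<in> range j" unfolding level_max_def by (intro Max_in) auto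
  then show ?thesis by auto
qed

lemma level_max_eqI: "(\<And>i. j i \<le> m) \<Longrightarrow> j i0 = m \<Longrightarrow> level_max (j :: 'n::finite \<Rightarrow> int) = m"
  unfolding level_max_def by (intro Max_eqI) auto

lemma finite_levels: "finite {j :: 'n::finite \<Rightarrow> int. (\<forall>i. j0 \<le> j i) \<and> level_max j = m}"
proof (rule finite_subset)
  show "{j :: 'n \<Rightarrow> int. (\<forall>i. j0 \<le> j i) \<and> level_max j = m} \<subseteq> PiE UNIV (\<lambda>_. {j0..m})"
    using level_max_ge by (auto simp: PiE_iff)
qed (auto intro!: finite_PiE)

lemma tensor_idx_eq_PiE: "tensor_idx S j = PiE UNIV (\<lambda>i. wav_idx S (j i))"
  by (auto simp: tensor_idx_def PiE_iff)

text \<open>The box of an index is read off from its levels: \<open>e\<close> marks the directions in which the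
  maximal level \<open>m\<close> is attained.\<close>

lemma hybrid_energy_boxes:
  fixes u :: "real ^ 'n::finite \<Rightarrow> real"
  assumes B: "biorthogonal_wavelets S" and m: "coarse S \<le> m"
  shows "hybrid_energy S \<tau> u m = (\<Sum>e | \<exists>i. e i. \<Sum>l\<in>hybrid_box S e m. \<bar>cube_pairing (dual_tensor_wavelet S l) u\<bar> powr \<tau>)"
proof -
  note M = multiresolutionD[OF biorthogonal_waveletsD(1)[OF B]]
  let ?f = "\<lambda>l. \<bar>cube_pairing (dual_tensor_wavelet S l) u\<bar> powr \<tau>"
  let ?J = "{j :: 'n \<Rightarrow> int. (\<forall>i. coarse S \<le> j i) \<and> level_max j = m}"
  let ?E = "{e :: 'n \<Rightarrow> bool. \<exists>i. e i}"
  have lev: "fst (l i) = j i" if "j \<in> ?J" "l \<in> tensor_idx S j" for j l i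
    using that M(4)[of "j i" "l i"] by (simp add: tensor_idx_def)
  have box: "fst (l i) \<le> m \<and> coarse S \<le> fst (l i) \<and> l i \<in> wav_idx S (fst (l i)) \<and> (fst (l i) = m \<longleftrightarrow> e i)"
    if "l \<in> hybrid_box S e m" for l e i
  proof (cases "e i")
    case True
    then have "l i \<in> wav_idx S m" using that by (auto simp: hybrid_box_def PiE_iff split: if_splits)
    with True show ?thesis using M(4)[OF m, of "l i"] m by simp
  next
    case False
    then have "l i \<in> wav_upto S (m - 1)" using that by (auto simp: hybrid_box_def PiE_iff split: if_splits)
    then obtain j where "j \<in> {coarse S..m - 1}" "l i \<in> wav_idx S j" by (auto simp: wav_upto_def)
    with False show ?thesis using M(4)[of j "l i"] by auto
  qed
  have "hybrid_energy S \<tau> u m = sum ?f (\<Union>j\<in>?J. tensor_idx S j)"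
    unfolding hybrid_energy_def
  proof (rule sum.UNION_disjoint[symmetric])
    show "finite ?J" by (rule finite_levels)
    show "\<forall>j\<in>?J. finite (tensor_idx S j)"
      using M(2) by (auto simp: tensor_idx_eq_PiE intro!: finite_PiE)
    show "\<forall>j\<in>?J. \<forall>j'\<in>?J. j \<noteq> j' \<longrightarrow> tensor_idx S j \<inter> tensor_idx S j' = {}"
    proof (intro ballI impI, rule ccontr)
      fix j j' assume j: "j \<in> ?J" "j' \<in> ?J" "j \<noteq> j'" and "tensor_idx S j \<inter> tensor_idx S j' \<noteq> {}"
      then obtain l where l: "l \<in> tensor_idx S j" "l \<in> tensor_idx S j'" by blast
      have "j i = j' i" for i using lev[OF j(1) l(1), of i] lev[OF j(2) l(2), of i] by simp
      with j(3) show False by blast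
    qed
  qed
  also have "(\<Union>j\<in>?J. tensor_idx S j) = (\<Union>e\<in>?E. hybrid_box S e m)"
  proof (intro equalityI subsetI)
    fix l assume "l \<in> (\<Union>j\<in>?J. tensor_idx S j)"
    then obtain j where j: "j \<in> ?J" "l \<in> tensor_idx S j" by blast
    \<comment> \<open>the directions in which the maximum is attained\<close>
    let ?e = "\<lambda>i. j i = m"
    have "\<exists>i. ?e i" using level_max_attained[of j] j(1) by auto
    moreover have "l i \<in> (if ?e i then wav_idx S m else wav_upto S (m - 1))" for i
    proof (cases "j i = m")
      case False
      then have "j i \<in> {coarse S..m - 1}" using level_max_ge[of j i] j(1) by auto
      with False j(2) show ?thesis by (auto simp: tensor_idx_def wav_upto_def)
    qed (use j(2) in \<open>auto simp: tensor_idx_def\<close>)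
    ultimately show "l \<in> (\<Union>e\<in>?E. hybrid_box S e m)"
      by (intro UN_I[of ?e]) (auto simp: hybrid_box_def)
  next
    fix l assume "l \<in> (\<Union>e\<in>?E. hybrid_box S e m)"
    then obtain e i0 where l: "l \<in> hybrid_box S e m" "e i0" by blast
    have "level_max (\<lambda>i. fst (l i)) = m"
      using box[OF l(1)] l(2) by (intro level_max_eqI[of _ _ i0]) auto
    then show "l \<in> (\<Union>j\<in>?J. tensor_idx S j)"
      using box[OF l(1)] by (intro UN_I[of "\<lambda>i. fst (l i)"]) (auto simp: tensor_idx_def)
  qed
  also have "sum ?f \<dots> = (\<Sum>e\<in>?E. sum ?f (hybrid_box S e m))"
  proof (rule sum.UNION_disjoint)
    show "\<forall>e\<in>?E. finite (hybrid_box S e m)"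
      using M(2) m wav_upto_finite[OF B] by (auto simp: hybrid_box_def intro!: finite_PiE)
    show "\<forall>e\<in>?E. \<forall>e'\<in>?E. e \<noteq> e' \<longrightarrow> hybrid_box S e m \<inter> hybrid_box S e' m = {}"
    proof (intro ballI impI, rule ccontr)
      fix e e' :: "'n \<Rightarrow> bool" assume "e \<noteq> e'" and "hybrid_box S e m \<inter> hybrid_box S e' m \<noteq> {}"
      then obtain l where l: "l \<in> hybrid_box S e m" "l \<in> hybrid_box S e' m" by blast
      have "e i = e' i" for i using box[OF l(1), of i] box[OF l(2), of i] by simp
      with \<open>e \<noteq> e'\<close> show False by blast
    qed
  qed simp
  finally show ?thesis .
qed

lemma iso_energy_boxes:
  fixes u :: "real ^ 'n::finite \<Rightarrow> real"
  assumes B: "biorthogonal_wavelets S" and m: "coarse S < m"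
  shows "iso_energy S \<tau> u m = (\<Sum>e | \<exists>i. e i. \<Sum>k\<in>iso_box S e m. \<bar>cube_pairing (dual_iso_wavelet S (m, e, k)) u\<bar> powr \<tau>)"
proof -
  note M = multiresolutionD[OF biorthogonal_waveletsD(1)[OF B]]
  let ?E = "{e :: 'n \<Rightarrow> bool. \<exists>i. e i}"
  have eq: "iso_idx S m = (\<Union>e\<in>?E. (\<lambda>k. (m, e, k)) ` iso_box S e m)"
  proof (intro equalityI subsetI)
    fix \<mu> :: "'n iso_index" assume "\<mu> \<in> iso_idx S m"
    then obtain e l where \<mu>: "\<mu> = (m, e, l)" "\<exists>i. e i"
        "\<forall>i. l i \<in> (if e i then wav_idx S m else scal_idx S (m - 1))"
      using m unfolding iso_idx_def by auto
    then have "l \<in> iso_box S e m" by (simp add: iso_box_def PiE_iff)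
    with \<mu>(1,2) show "\<mu> \<in> (\<Union>e\<in>?E. (\<lambda>k. (m, e, k)) ` iso_box S e m)" by blast
  next
    fix \<mu> :: "'n iso_index" assume "\<mu> \<in> (\<Union>e\<in>?E. (\<lambda>k. (m, e, k)) ` iso_box S e m)"
    then obtain e l where \<mu>: "\<mu> = (m, e, l)" "\<exists>i. e i" "l \<in> iso_box S e m" by blast
    then have "\<forall>i. l i \<in> (if e i then wav_idx S m else scal_idx S (m - 1))"
      by (simp add: iso_box_def PiE_iff)
    with \<mu>(1,2) m show "\<mu> \<in> iso_idx S m" unfolding iso_idx_def by simp
  qed
  have fin: "finite (iso_box S e m)" for e :: "'n \<Rightarrow> bool"
    using M(1,2) m by (auto simp: iso_box_def intro!: finite_PiE)
  have inj: "inj_on (\<lambda>k. (m, e, k)) (iso_box S e m)" for e :: "'n \<Rightarrow> bool" by (auto simp: inj_on_def)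
  show ?thesis
    unfolding iso_energy_def eq
    by (subst sum.UNION_disjoint) (auto simp: fin sum.reindex[OF inj])
qed

text \<open>On the coarsest level wavelets and scaling functions coincide, and so do the two systems.\<close>

lemma energy_coarse:
  fixes u :: "real ^ 'n::finite \<Rightarrow> real"
  assumes B: "biorthogonal_wavelets S" and u: "u \<in> L1_cube"
  shows "hybrid_energy S \<tau> u (coarse S) = iso_energy S \<tau> u (coarse S)"
proof -
  note M = multiresolutionD[OF biorthogonal_waveletsD(2)[OF B]]
  let ?j0 = "coarse S" and ?o = "\<lambda>_::'n. False"
  have J: "{j :: 'n \<Rightarrow> int. (\<forall>i. ?j0 \<le> j i) \<and> level_max j = ?j0} = {\<lambda>_. ?j0}"
  proof (intro equalityI subsetI)
    fix j :: "'n \<Rightarrow> int" assume "j \<in> {j. (\<forall>i. ?j0 \<le> j i) \<and> level_max j = ?j0}"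
    then have "j i = ?j0" for i using level_max_ge[of j i] by (auto intro: antisym)
    then show "j \<in> {\<lambda>_. ?j0}" by auto
  qed (auto intro: level_max_eqI)
  have eq: "iso_idx S ?j0 = (\<lambda>l. (?j0, ?o, l)) ` tensor_idx S (\<lambda>_. ?j0)"
    using M(9) by (auto simp: iso_idx_def tensor_idx_def image_iff fun_eq_iff)
  have inj: "inj_on (\<lambda>l. (?j0, ?o, l)) A" for A :: "('n \<Rightarrow> index) set" by (auto simp: inj_on_def)
  have co: "cube_pairing (dual_tensor_wavelet S l) u = cube_pairing (dual_iso_wavelet S (?j0, ?o, l)) u"
    if "l \<in> tensor_idx S (\<lambda>_. ?j0)" for l
  proof -
    have l: "l i \<in> wav_idx S ?j0" for i using that by (simp add: tensor_idx_def)
    have "cube_pairing (tensor (\<lambda>i. dwav S (l i))) u = cube_pairing (tensor (\<lambda>i. dscal S (l i))) u"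
    proof (rule cube_pairing_cong[OF _ _ u])
      fix i
      show "dwav S (l i) \<in> L2_unit" using M(6)[OF _ l] by simp
      show "dscal S (l i) \<in> L2_unit" using M(5)[of ?j0 "l i"] l[of i] M(9) by simp
      show "L2_eq (dwav S (l i)) (dscal S (l i))" using M(10)[OF l] by (simp add: L2_eq_def)
    qed
    then show ?thesis by (simp add: dual_tensor_wavelet_def dual_iso_wavelet_def)
  qed
  show ?thesis
    unfolding hybrid_energy_def iso_energy_def J eq by (simp add: sum.reindex[OF inj] co)
qed

text \<open>Summation of the box estimates over the types \<open>e\<close>; the constants are enlarged so as to cover the coarsest
  level, where the two energies agree.\<close>

lemma energy_le:
  assumes B: "biorthogonal_wavelets S" and D: "wavelet_decay S \<alpha>" and \<alpha>: "1 < \<alpha>"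
    and \<tau>: "0 < \<tau>" "\<tau> < 2" "1 < \<alpha> * schur_rho \<tau>"
  shows hybrid_energy_le: "\<exists>K>0. \<forall>u\<in>L1_cube. \<forall>m\<ge>coarse S.
        hybrid_energy S \<tau> (u :: real ^ 'n::finite \<Rightarrow> real) m \<le> K * iso_energy S \<tau> u m"
    and iso_energy_le: "\<exists>K>0. \<forall>u\<in>L1_cube. \<forall>m\<ge>coarse S.
        iso_energy S \<tau> (u :: real ^ 'n::finite \<Rightarrow> real) m \<le>
          K * 2 powr (real_of_int m * (1 - \<tau> / 2) * (real CARD('n) - 1)) * hybrid_energy S \<tau> u m"
proof -
  have nonneg: "0 \<le> hybrid_energy S \<tau> u m" "0 \<le> iso_energy S \<tau> u m" for u :: "real ^ 'n \<Rightarrow> real" and m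
    by (auto simp: hybrid_energy_def iso_energy_def intro!: sum_nonneg)
  obtain K where K: "0 < K" and le: "\<And>u m e. u \<in> L1_cube \<Longrightarrow> coarse S < m \<Longrightarrow>
    (\<Sum>l\<in>hybrid_box S e m. \<bar>cube_pairing (dual_tensor_wavelet S l) u\<bar> powr \<tau>) \<le>
     K * (\<Sum>k\<in>iso_box S e m. \<bar>cube_pairing (dual_iso_wavelet S (m, e, k)) (u :: real ^ 'n \<Rightarrow> real)\<bar> powr \<tau>)"
    using hybrid_box_energy_le[OF B D \<alpha> \<tau>] by blast
  show "\<exists>K>0. \<forall>u\<in>L1_cube. \<forall>m\<ge>coarse S. hybrid_energy S \<tau> (u :: real ^ 'n \<Rightarrow> real) m \<le> K * iso_energy S \<tau> u m"
  proof (intro exI[of _ "max 1 K"] conjI ballI allI impI)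
    fix u :: "real ^ 'n \<Rightarrow> real" and m assume u: "u \<in> L1_cube" and m: "coarse S \<le> m"
    show "hybrid_energy S \<tau> u m \<le> max 1 K * iso_energy S \<tau> u m"
    proof (cases "m = coarse S")
      case True
      have "1 * iso_energy S \<tau> u m \<le> max 1 K * iso_energy S \<tau> u m"
        using nonneg by (intro mult_right_mono) auto
      then show ?thesis using energy_coarse[OF B u] True by simp
    next
      case False
      with m have m': "coarse S < m" by simp
      have "hybrid_energy S \<tau> u m \<le> K * iso_energy S \<tau> u m"
        unfolding hybrid_energy_boxes[OF B m] iso_energy_boxes[OF B m']
        by (subst sum_distrib_left) (intro sum_mono le[OF u m'])
      also have "\<dots> \<le> max 1 K * iso_energy S \<tau> u m"
        using nonneg by (intro mult_right_mono) auto
      finally show ?thesis .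
    qed
  qed simp
  let ?w = "\<lambda>m. 2 powr (real_of_int m * (1 - \<tau> / 2) * (real CARD('n) - 1))"
  obtain K' where K': "0 < K'" and le': "\<And>u m e. u \<in> L1_cube \<Longrightarrow> coarse S < m \<Longrightarrow> \<exists>i. e i \<Longrightarrow>
    (\<Sum>k\<in>iso_box S e m. \<bar>cube_pairing (dual_iso_wavelet S (m, e, k)) u\<bar> powr \<tau>) \<le>
     K' * ?w m * (\<Sum>l\<in>hybrid_box S e m. \<bar>cube_pairing (dual_tensor_wavelet S l) (u :: real ^ 'n \<Rightarrow> real)\<bar> powr \<tau>)"
    using iso_box_energy_le[OF B D \<alpha> \<tau>] by blast
  \<comment> \<open>the first term accounts for the coarsest level\<close>
  define c where "c = max (1 / ?w (coarse S)) K'"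
  show "\<exists>K>0. \<forall>u\<in>L1_cube. \<forall>m\<ge>coarse S.
        iso_energy S \<tau> (u :: real ^ 'n \<Rightarrow> real) m \<le> K * ?w m * hybrid_energy S \<tau> u m"
  proof (intro exI[of _ c] conjI ballI allI impI)
    show "0 < c" using K' by (simp add: c_def less_max_iff_disj)
    fix u :: "real ^ 'n \<Rightarrow> real" and m assume u: "u \<in> L1_cube" and m: "coarse S \<le> m"
    show "iso_energy S \<tau> u m \<le> c * ?w m * hybrid_energy S \<tau> u m"
    proof (cases "m = coarse S")
      case True
      have "1 / ?w m \<le> c" using True by (simp add: c_def)
      then have "1 \<le> c * ?w m" by (simp add: field_simps)
      then have "1 * hybrid_energy S \<tau> u m \<le> c * ?w m * hybrid_energy S \<tau> u m"
        using nonneg by (intro mult_right_mono) auto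
      then show ?thesis using energy_coarse[OF B u] True by simp
    next
      case False
      with m have m': "coarse S < m" by simp
      have "iso_energy S \<tau> u m \<le> (K' * ?w m) * hybrid_energy S \<tau> u m"
        unfolding hybrid_energy_boxes[OF B m] iso_energy_boxes[OF B m']
        by (subst sum_distrib_left) (intro sum_mono le'[OF u m'], simp)
      also have "\<dots> \<le> (c * ?w m) * hybrid_energy S \<tau> u m"
        using nonneg by (intro mult_right_mono) (auto simp: c_def)
      finally show ?thesis .
    qed
  qed
qed

lemma besov_term_energy:
  fixes u :: "real ^ 'n::finite \<Rightarrow> real"
  assumes "0 < \<tau>"
  shows "besov_term S a \<tau> \<tau> u m =
    2 powr (\<tau> * m * (a + real CARD('n) * (1/2 - 1/\<tau>))) * iso_energy S \<tau> u m"
proof -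
  let ?c = "2 powr (real CARD('n) * real_of_int m * (1/2 - 1/\<tau>) * \<tau>)"
  have "(\<Sum>\<mu>\<in>iso_idx S m. \<bar>iso_coeff S \<tau> u \<mu>\<bar> powr \<tau>) = ?c * iso_energy S \<tau> u m"
    unfolding iso_energy_def sum_distrib_left
  proof (intro sum.cong refl)
    fix \<mu> :: "'n iso_index" assume "\<mu> \<in> iso_idx S m"
    then have "fst \<mu> = m" by (auto simp: iso_idx_def split: if_splits)
    then show "\<bar>iso_coeff S \<tau> u \<mu>\<bar> powr \<tau> = ?c * \<bar>cube_pairing (dual_iso_wavelet S \<mu>) u\<bar> powr \<tau>"
      by (simp add: iso_coeff_def abs_mult powr_mult powr_powr)
  qed
  moreover have "0 \<le> iso_energy S \<tau> u m" by (simp add: iso_energy_def sum_nonneg)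
  ultimately have "besov_term S a \<tau> \<tau> u m = 2 powr (\<tau> * m * a) * (?c * iso_energy S \<tau> u m)"
    using assms by (simp add: besov_term_def)
  also have "\<dots> = 2 powr (\<tau> * m * a + real CARD('n) * real_of_int m * (1/2 - 1/\<tau>) * \<tau>) * iso_energy S \<tau> u m"
    by (simp add: powr_add)
  also have "\<tau> * m * a + real CARD('n) * real_of_int m * (1/2 - 1/\<tau>) * \<tau> =
      \<tau> * m * (a + real CARD('n) * (1/2 - 1/\<tau>))"
    by (simp only: distrib_left mult_ac)
  finally show ?thesis .
qed

text \<open>The weight \<open>2\<^bsup>\<tau>s|j|\<^sub>1\<^esup>\<close> of the norm cancels the rescaling of the coefficients exactly, because
  \<open>1/\<tau> - 1/2 = s\<close>.\<close>

lemma hybrid_term_energy: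
  fixes u :: "real ^ 'n::finite \<Rightarrow> real"
  assumes B: "biorthogonal_wavelets S" and \<tau>: "0 < \<tau>" "1 / \<tau> = s + 1/2" and j: "\<forall>i. coarse S \<le> j i"
  shows "hybrid_term S q s \<tau> \<tau> u j = 2 powr (\<tau> * q * level_max j) *
     (\<Sum>l\<in>tensor_idx S j. \<bar>cube_pairing (dual_tensor_wavelet S l) u\<bar> powr \<tau>)"
proof -
  note M = multiresolutionD[OF biorthogonal_waveletsD(1)[OF B]]
  let ?c = "2 powr (- (s * level_sum j * \<tau>))"
  let ?E = "\<Sum>l\<in>tensor_idx S j. \<bar>cube_pairing (dual_tensor_wavelet S l) u\<bar> powr \<tau>"
  have ex: "1/2 - 1/\<tau> = - s" using \<tau>(2) by simp
  have "(\<Sum>l\<in>tensor_idx S j. \<bar>tensor_coeff S \<tau> u l\<bar> powr \<tau>) = ?c * ?E"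
    unfolding sum_distrib_left
  proof (intro sum.cong refl)
    fix l assume l: "l \<in> tensor_idx S j"
    have "fst (l i) = j i" for i using l j M(4)[of "j i" "l i"] by (simp add: tensor_idx_def)
    then have "(\<lambda>i. fst (l i)) = j" by auto
    then show "\<bar>tensor_coeff S \<tau> u l\<bar> powr \<tau> = ?c * \<bar>cube_pairing (dual_tensor_wavelet S l) u\<bar> powr \<tau>"
      by (simp add: tensor_coeff_def ex abs_mult powr_mult powr_powr mult_ac)
  qed
  moreover have "0 \<le> ?E" by (simp add: sum_nonneg)
  ultimately have "hybrid_term S q s \<tau> \<tau> u j = 2 powr (\<tau> * (q * level_max j + s * level_sum j)) * (?c * ?E)"
    using \<tau> by (simp add: hybrid_term_def)
  also have "\<dots> = 2 powr (\<tau> * (q * level_max j + s * level_sum j) + - (s * level_sum j * \<tau>)) * ?E"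
    by (simp only: powr_add mult.assoc)
  also have "\<tau> * (q * level_max j + s * level_sum j) + - (s * level_sum j * \<tau>) = \<tau> * q * level_max j"
    by (simp add: algebra_simps)
  finally show ?thesis .
qed

text \<open>Transfers estimates between finite blocks to sums over different index sets; here one set
  consists of levels and the other of level vectors.\<close>

lemma summable_on_infsum_comparison:
  fixes f :: "'a \<Rightarrow> real" and g :: "'b \<Rightarrow> real"
  assumes f: "\<And>x. x \<in> A \<Longrightarrow> 0 \<le> f x" and g: "\<And>y. y \<in> B \<Longrightarrow> 0 \<le> g y" "g summable_on B" and C: "0 \<le> C"
    and dom: "\<And>F. finite F \<Longrightarrow> F \<subseteq> A \<Longrightarrow> \<exists>G. finite G \<and> G \<subseteq> B \<and> sum f F \<le> C * sum g G"
  shows "f summable_on A" "infsum f A \<le> C * infsum g B"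
proof -
  have *: "sum f F \<le> C * infsum g B" if F: "finite F" "F \<subseteq> A" for F
  proof -
    obtain G where G: "finite G" "G \<subseteq> B" "sum f F \<le> C * sum g G" using dom[OF F] by blast
    have "sum g G \<le> infsum g B" using G g by (intro finite_sum_le_infsum) auto
    then have "C * sum g G \<le> C * infsum g B" using C by (rule mult_left_mono)
    with G(3) show ?thesis by linarith
  qed
  show "f summable_on A"
    by (rule nonneg_bdd_above_summable_on) (use f * in \<open>auto intro!: bdd_aboveI[of _ "C * infsum g B"]\<close>)
  then show "infsum f A \<le> C * infsum g B"
    by (rule infsum_le_finite_sums) (use * in auto)
qed

lemma continuously_embedded_powr:
  assumes \<tau>: "0 < \<tau>" and C: "0 \<le> C"
    and nX: "\<And>u. u \<in> X \<Longrightarrow> 0 \<le> nX u"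
    and le: "\<And>u. u \<in> X \<Longrightarrow> u \<in> Y \<and> 0 \<le> nY u \<and> nY u \<le> C * nX u"
  shows "continuously_embedded X (\<lambda>u. nX u powr (1 / \<tau>)) Y (\<lambda>u. nY u powr (1 / \<tau>) :: real)"
  unfolding continuously_embedded_def
proof (intro conjI exI[of _ "C powr (1 / \<tau>)"] ballI)
  show "X \<subseteq> Y" using le by auto
  fix u assume u: "u \<in> X"
  have "nY u powr (1 / \<tau>) \<le> (C * nX u) powr (1 / \<tau>)"
    using le[OF u] \<tau> by (intro powr_mono2) auto
  then show "nY u powr (1 / \<tau>) \<le> C powr (1 / \<tau>) * nX u powr (1 / \<tau>)"
    using C nX[OF u] by (simp add: powr_mult)
qed

lemma sum_hybrid_terms:
  fixes u :: "real ^ 'n::finite \<Rightarrow> real"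
  assumes B: "biorthogonal_wavelets S" and \<tau>: "0 < \<tau>" "1 / \<tau> = s + 1/2"
  shows "(\<Sum>j | (\<forall>i. coarse S \<le> j i) \<and> level_max j = m. hybrid_term S q s \<tau> \<tau> u j) =
     2 powr (\<tau> * q * m) * hybrid_energy S \<tau> u m"
  unfolding hybrid_energy_def sum_distrib_left
  by (intro sum.cong refl) (auto simp: hybrid_term_energy[OF B \<tau>] sum_distrib_left)

lemma nonneg_terms: "0 \<le> hybrid_term S q s p \<tau> u j" "0 \<le> besov_term S a p \<tau> u m"
  by (auto simp: hybrid_term_def besov_term_def)

theorem theorem5p3:
  fixes S :: wavelet_system and \<alpha> q s \<tau> :: real
  assumes "biorthogonal_wavelets S"
    and "\<alpha> > 1" and "wavelet_decay S \<alpha>"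
    and "s > 0" and "s < \<alpha> - 1/2"
    and "q + s > max 0 (real CARD('n::finite) * (s - 1/2))"
    and "q + s * real CARD('n) > max 0 (real CARD('n) * (s - 1/2))"
    and "1 / \<tau> = s + 1/2"
  shows "continuously_embedded
           (besov_space S (q + s * real CARD('n)) \<tau> \<tau> :: (real ^ 'n \<Rightarrow> real) set)
           (besov_norm S (q + s * real CARD('n)) \<tau> \<tau>)
           (hybrid_space S q s \<tau> \<tau>) (hybrid_norm S q s \<tau> \<tau>)
       \<and> continuously_embedded
           (hybrid_space S q s \<tau> \<tau> :: (real ^ 'n \<Rightarrow> real) set) (hybrid_norm S q s \<tau> \<tau>)
           (besov_space S (q + s) \<tau> \<tau>) (besov_norm S (q + s) \<tau> \<tau>)"
proof -
  note B = assms(1) and \<alpha> = assms(2) and D = assms(3)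
  let ?n = "real CARD('n)" and ?A = "{j :: 'n \<Rightarrow> int. \<forall>i. coarse S \<le> j i}"
  let ?J = "\<lambda>m. {j :: 'n \<Rightarrow> int. (\<forall>i. coarse S \<le> j i) \<and> level_max j = m}"
  have \<tau>: "0 < \<tau>" using assms(4,8) by (metis add_pos_pos half_gt_zero_iff zero_less_divide_1_iff zero_less_one)
  have s: "s = 1 / \<tau> - 1 / 2" using assms(8) by simp
  have \<tau>2: "\<tau> < 2" using assms(4) \<tau> unfolding s by (simp add: field_simps)
  \<comment> \<open>the bound \<open>s < \<alpha> - 1/2\<close> in terms of \<open>\<tau>\<close>; with \<open>\<alpha> > 1\<close> it gives \<open>\<alpha>\<rho> > 1\<close> for \<open>\<rho> = min 1 \<tau>\<close>\<close>
  have "1 < \<alpha> * \<tau>" using assms(5) \<tau> unfolding s by (simp add: field_simps)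
  then have \<alpha>\<tau>: "1 < \<alpha> * schur_rho \<tau>" using \<alpha> by (simp add: schur_rho_def min_def)
  have exps: "\<tau> * m * (q + s * ?n + ?n * (1/2 - 1/\<tau>)) = \<tau> * q * m"
    "\<tau> * m * (q + s + ?n * (1/2 - 1/\<tau>)) + m * (1 - \<tau> / 2) * (?n - 1) = \<tau> * q * m" for m :: real
    using \<tau> unfolding s by (simp_all add: field_simps)
  obtain K1 where K1: "0 < K1" and le1: "\<And>u m. u \<in> L1_cube \<Longrightarrow> coarse S \<le> m \<Longrightarrow>
      hybrid_energy S \<tau> (u :: real ^ 'n \<Rightarrow> real) m \<le> K1 * iso_energy S \<tau> u m"
    using hybrid_energy_le[OF B D \<alpha> \<tau> \<tau>2 \<alpha>\<tau>] by blast
  obtain K2 where K2: "0 < K2" and le2: "\<And>u m. u \<in> L1_cube \<Longrightarrow> coarse S \<le> m \<Longrightarrow>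
      iso_energy S \<tau> (u :: real ^ 'n \<Rightarrow> real) m \<le>
        K2 * 2 powr (real_of_int m * (1 - \<tau> / 2) * (?n - 1)) * hybrid_energy S \<tau> u m"
    using iso_energy_le[OF B D \<alpha> \<tau> \<tau>2 \<alpha>\<tau>] by blast
  have term1: "(\<Sum>j\<in>?J m. hybrid_term S q s \<tau> \<tau> u j) \<le> K1 * besov_term S (q + s * ?n) \<tau> \<tau> u m"
    if "u \<in> L1_cube" "coarse S \<le> m" for u :: "real ^ 'n \<Rightarrow> real" and m
  proof -
    have "(\<Sum>j\<in>?J m. hybrid_term S q s \<tau> \<tau> u j) = 2 powr (\<tau> * q * m) * hybrid_energy S \<tau> u m"
      by (rule sum_hybrid_terms[OF B \<tau> assms(8)])
    also have "\<dots> \<le> 2 powr (\<tau> * q * m) * (K1 * iso_energy S \<tau> u m)"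
      by (intro mult_left_mono le1 that) auto
    also have "\<dots> = K1 * besov_term S (q + s * ?n) \<tau> \<tau> u m"
      by (simp add: besov_term_energy[OF \<tau>] exps(1))
    finally show ?thesis .
  qed
  have term2: "besov_term S (q + s) \<tau> \<tau> u m \<le> K2 * (\<Sum>j\<in>?J m. hybrid_term S q s \<tau> \<tau> u j)"
    if "u \<in> L1_cube" "coarse S \<le> m" for u :: "real ^ 'n \<Rightarrow> real" and m
  proof -
    let ?x = "2 powr (\<tau> * m * (q + s + ?n * (1/2 - 1/\<tau>)))" and ?y = "2 powr (real_of_int m * (1 - \<tau> / 2) * (?n - 1))"
    have "besov_term S (q + s) \<tau> \<tau> u m = ?x * iso_energy S \<tau> u m"
      by (rule besov_term_energy[OF \<tau>])
    also have "\<dots> \<le> ?x * (K2 * ?y * hybrid_energy S \<tau> u m)"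
      by (intro mult_left_mono le2 that) auto
    also have "\<dots> = K2 * ((?x * ?y) * hybrid_energy S \<tau> u m)" by (simp only: mult_ac)
    also have "?x * ?y = 2 powr (\<tau> * q * m)" by (simp only: powr_add[symmetric] exps(2))
    finally show ?thesis by (simp only: sum_hybrid_terms[OF B \<tau> assms(8)])
  qed
  have emb1: "hybrid_term S q s \<tau> \<tau> u summable_on ?A \<and>
      infsum (hybrid_term S q s \<tau> \<tau> u) ?A \<le> K1 * infsum (besov_term S (q + s * ?n) \<tau> \<tau> u) {coarse S..}"
    if u: "u \<in> besov_space S (q + s * ?n) \<tau> \<tau>" for u :: "real ^ 'n \<Rightarrow> real"
  proof -
    have u': "u \<in> L1_cube" "besov_term S (q + s * ?n) \<tau> \<tau> u summable_on {coarse S..}"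
      using u by (auto simp: besov_space_def)
    have "\<exists>G. finite G \<and> G \<subseteq> {coarse S..} \<and> sum (hybrid_term S q s \<tau> \<tau> u) F \<le> K1 * sum (besov_term S (q + s * ?n) \<tau> \<tau> u) G"
      if F: "finite F" "F \<subseteq> ?A" for F
    proof (intro exI[of _ "level_max ` F"] conjI)
      show "finite (level_max ` F)" using F by simp
      show G: "level_max ` F \<subseteq> {coarse S..}"
      proof (rule image_subsetI)
        fix j assume "j \<in> F"
        then have "coarse S \<le> j undefined" using F(2) by auto
        with level_max_ge[of j undefined] show "level_max j \<in> {coarse S..}" by simp
      qed
      \<comment> \<open>enlarge \<open>F\<close> to full groups of equal maximal level\<close>
      have "sum (hybrid_term S q s \<tau> \<tau> u) F = (\<Sum>m\<in>level_max ` F. sum (hybrid_term S q s \<tau> \<tau> u) {j \<in> F. level_max j = m})"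
        by (rule sum.image_gen[OF F(1)])
      also have "\<dots> \<le> (\<Sum>m\<in>level_max ` F. sum (hybrid_term S q s \<tau> \<tau> u) (?J m))"
        using F by (intro sum_mono sum_mono2 finite_levels nonneg_terms) auto
      also have "\<dots> \<le> (\<Sum>m\<in>level_max ` F. K1 * besov_term S (q + s * ?n) \<tau> \<tau> u m)"
        using G by (intro sum_mono term1 u') auto
      finally show "sum (hybrid_term S q s \<tau> \<tau> u) F \<le> K1 * sum (besov_term S (q + s * ?n) \<tau> \<tau> u) (level_max ` F)"
        by (simp add: sum_distrib_left)
    qed
    note cmp = summable_on_infsum_comparison[OF nonneg_terms(1) nonneg_terms(2) u'(2) less_imp_le[OF K1] this]
    show ?thesis using cmp by (intro conjI)
  qed
  have emb2: "besov_term S (q + s) \<tau> \<tau> u summable_on {coarse S..} \<and>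
      infsum (besov_term S (q + s) \<tau> \<tau> u) {coarse S..} \<le> K2 * infsum (hybrid_term S q s \<tau> \<tau> u) ?A"
    if u: "u \<in> hybrid_space S q s \<tau> \<tau>" for u :: "real ^ 'n \<Rightarrow> real"
  proof -
    have u': "u \<in> L1_cube" "hybrid_term S q s \<tau> \<tau> u summable_on ?A"
      using u by (auto simp: hybrid_space_def)
    have "\<exists>G. finite G \<and> G \<subseteq> ?A \<and> sum (besov_term S (q + s) \<tau> \<tau> u) F \<le> K2 * sum (hybrid_term S q s \<tau> \<tau> u) G"
      if F: "finite F" "F \<subseteq> {coarse S..}" for F
    proof (intro exI[of _ "\<Union>m\<in>F. ?J m"] conjI)
      show "finite (\<Union>m\<in>F. ?J m)" using F finite_levels by blast
      have "sum (besov_term S (q + s) \<tau> \<tau> u) F \<le> (\<Sum>m\<in>F. K2 * (\<Sum>j\<in>?J m. hybrid_term S q s \<tau> \<tau> u j))"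
        using F by (intro sum_mono term2 u') auto
      also have "\<dots> = K2 * sum (hybrid_term S q s \<tau> \<tau> u) (\<Union>m\<in>F. ?J m)"
        unfolding sum_distrib_left[symmetric] using F finite_levels
        by (subst sum.UNION_disjoint) auto
      finally show "sum (besov_term S (q + s) \<tau> \<tau> u) F \<le> K2 * sum (hybrid_term S q s \<tau> \<tau> u) (\<Union>m\<in>F. ?J m)" .
    qed auto
    note cmp = summable_on_infsum_comparison[OF nonneg_terms(2) nonneg_terms(1) u'(2) less_imp_le[OF K2] this]
    show ?thesis using cmp by (intro conjI)
  qed
  show ?thesis
  proof
    show "continuously_embedded (besov_space S (q + s * ?n) \<tau> \<tau> :: (real ^ 'n \<Rightarrow> real) set)
           (besov_norm S (q + s * ?n) \<tau> \<tau>) (hybrid_space S q s \<tau> \<tau>) (hybrid_norm S q s \<tau> \<tau>)"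
      unfolding besov_norm_def hybrid_norm_def
      by (rule continuously_embedded_powr[OF \<tau> less_imp_le[OF K1]])
        (use emb1 in \<open>auto simp: besov_space_def hybrid_space_def intro!: infsum_nonneg nonneg_terms\<close>)
    show "continuously_embedded (hybrid_space S q s \<tau> \<tau> :: (real ^ 'n \<Rightarrow> real) set) (hybrid_norm S q s \<tau> \<tau>)
           (besov_space S (q + s) \<tau> \<tau>) (besov_norm S (q + s) \<tau> \<tau>)"
      unfolding besov_norm_def hybrid_norm_def
      by (rule continuously_embedded_powr[OF \<tau> less_imp_le[OF K2]])
        (use emb2 in \<open>auto simp: besov_space_def hybrid_space_def intro!: infsum_nonneg nonneg_terms\<close>)
  qed
qed

end
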